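(* For any integers $0\le\ell\le k$ there is a $k$-complex $F'$ containing, for every $(k+2)$-element subset $j$ of $\{1,2,\ldots,k+\ell+3\}$, disjoint subcomplexes $\Sigma^k_j\cong S^k$ and $\Sigma^\ell_j\cong S^\ell$, such that $F'$ is PL embeddable into $\mathbb{R}^{k+\ell+1}$ and such that for any PL almost embedding $f:F'\to\mathbb{R}^{k+\ell+1}$ the number of linked modulo 2 unordered pairs of the images $f\Sigma^k_j$ and $f\Sigma^\ell_j$ (where $j$ ranges over the $(k+2)$-element subsets of $\{1,\ldots,k+\ell+3\}$) is odd.
   Context: A complex means a finite simplicial complex, identified with its geometric realization when speaking of maps; a $k$-complex is a complex all of whose simplices have dimension at most $k$. PL means piecewise linear. A map $g:K\to\mathbb{R}^d$ of a complex $K$ is an almost embedding if $g(\alpha)\cap g(\beta)=\emptyset$ for any two disjoint (closed) simplices $\alpha,\beta$ of $K$. In particular, for an almost embedding $f$ of $F'$ the images $f\Sigma^k_j$ and $f\Sigma^\ell_j$ are disjoint. A disjoint (possibly self-intersecting, i.e. singular) $k$-sphere and $\ell$-sphere in $\mathbb{R}^{k+\ell+1}$ are linked modulo 2 if a general position singular cone over the first one intersects the second one at an odd number of points (equivalently, their linking number is odd). *)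

theory Defs
  imports "HOL-Analysis.Analysis" "HOL-Analysis.Finite_Function_Topology"
begin

type_synonym real_inf = "(nat, real) poly_mapping"

text \<open>
  A finite simplicial complex is given by the vertex sets of its (nonempty, closed) simplices, the
  simplex with vertex set \<open>\<sigma>\<close> being \<open>convex hull \<sigma>\<close>. The library's
  \<open>simplicial_complex\<close> is confined to a Euclidean space of fixed dimension; here the
  ambient space is any real vector space. In particular every finite simplicial complex has a
  realization in the space \<open>real_inf\<close> of finitely supported real sequences.
\<close>

definition geometric_complex :: "'a::real_vector set set \<Rightarrow> bool" where
  "geometric_complex K \<longleftrightarrow>
     finite K \<and>
     (\<forall>\<sigma>\<in>K. finite \<sigma> \<and> \<sigma> \<noteq> {} \<and> \<not> affine_dependent \<sigma>) \<and>
     (\<forall>\<sigma>\<in>K. \<forall>\<tau>. \<tau> \<subseteq> \<sigma> \<and> \<tau> \<noteq> {} \<longrightarrow> \<tau> \<in> K) \<and>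
     (\<forall>\<sigma>\<in>K. \<forall>\<tau>\<in>K. convex hull \<sigma> \<inter> convex hull \<tau> = convex hull (\<sigma> \<inter> \<tau>))"

definition k_complex :: "nat \<Rightarrow> 'a::real_vector set set \<Rightarrow> bool" where
  "k_complex k K \<longleftrightarrow> geometric_complex K \<and> (\<forall>\<sigma>\<in>K. card \<sigma> \<le> k + 1)"

definition body :: "'a::real_vector set set \<Rightarrow> 'a set" where
  "body K = (\<Union>\<sigma>\<in>K. convex hull \<sigma>)"

definition subcomplex :: "'a::real_vector set set \<Rightarrow> 'a set set \<Rightarrow> bool" where
  "subcomplex L K \<longleftrightarrow> L \<subseteq> K \<and> geometric_complex L"

definition subdivision :: "'a::real_vector set set \<Rightarrow> 'a set set \<Rightarrow> bool" where
  "subdivision A K \<longleftrightarrow>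
     geometric_complex A \<and> body A = body K \<and>
     (\<forall>\<sigma>\<in>A. \<exists>\<tau>\<in>K. convex hull \<sigma> \<subseteq> convex hull \<tau>)"

definition linear_on_simplices ::
    "'a::real_vector set set \<Rightarrow> ('a \<Rightarrow> 'b::real_vector) \<Rightarrow> bool" where
  "linear_on_simplices A f \<longleftrightarrow>
     (\<forall>\<sigma>\<in>A. \<forall>x\<in>convex hull \<sigma>. \<forall>y\<in>convex hull \<sigma>. \<forall>t\<in>{0..1}.
        f ((1 - t) *\<^sub>R x + t *\<^sub>R y) = (1 - t) *\<^sub>R f x + t *\<^sub>R f y)"

text \<open>Maps of a complex are total functions of which only the values on \<open>body K\<close> matter.\<close>

definition PL_map :: "'a::real_vector set set \<Rightarrow> ('a \<Rightarrow> 'b::real_vector) \<Rightarrow> bool" where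
  "PL_map K f \<longleftrightarrow> (\<exists>A. subdivision A K \<and> linear_on_simplices A f)"

text \<open>A PL map is continuous on the compact set \<open>body K\<close>, so an injective one is an embedding.\<close>

definition PL_embedding :: "'a::real_vector set set \<Rightarrow> ('a \<Rightarrow> 'b::real_vector) \<Rightarrow> bool" where
  "PL_embedding K f \<longleftrightarrow> PL_map K f \<and> inj_on f (body K)"

definition almost_embedding :: "'a::real_vector set set \<Rightarrow> ('a \<Rightarrow> 'b) \<Rightarrow> bool" where
  "almost_embedding K f \<longleftrightarrow>
     (\<forall>\<alpha>\<in>K. \<forall>\<beta>\<in>K. convex hull \<alpha> \<inter> convex hull \<beta> = {} \<longrightarrow>
        f ` (convex hull \<alpha>) \<inter> f ` (convex hull \<beta>) = {})"

definition sphere_complex :: "nat \<Rightarrow> 'a::real_normed_vector set set \<Rightarrow> bool" where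
  "sphere_complex n L \<longleftrightarrow> top_of_set (body L) homeomorphic_space nsphere n"

definition in_general_position :: "'b::euclidean_space \<Rightarrow> 'b set \<Rightarrow> bool" where
  "in_general_position p V \<longleftrightarrow>
     (\<forall>W. W \<subseteq> V \<and> finite W \<and> card W \<le> DIM('b) \<longrightarrow> p \<notin> affine hull W)"

text \<open>
  The singular cone with apex \<open>p\<close> over a singular sphere \<open>f\<close> on \<open>body K\<close> is the map
  \<open>(x, t) \<mapsto> (1 - t) f x + t p\<close>. Its intersections with the singular sphere \<open>g\<close> on \<open>body L\<close> are
  counted in the domains of the two maps, since \<open>f\<close> and \<open>g\<close> need not be injective: if, say, \<open>g\<close>
  folds a sphere onto a disk, then a point of the image carries two intersections. The value
  \<open>t = 1\<close>, which stands for the single cone point, is left out: an apex in general position does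
  not lie on the image of \<open>g\<close>.
\<close>

definition cone_intersections ::
    "'b::real_vector \<Rightarrow> 'a::real_vector set set \<Rightarrow> ('a \<Rightarrow> 'b) \<Rightarrow> 'c::real_vector set set \<Rightarrow> ('c \<Rightarrow> 'b)
      \<Rightarrow> ('a \<times> real \<times> 'c) set" where
  "cone_intersections p K f L g =
     {(x, t, y). x \<in> body K \<and> 0 \<le> t \<and> t < 1 \<and> y \<in> body L \<and> (1 - t) *\<^sub>R f x + t *\<^sub>R p = g y}"

text \<open>
  For PL maps \<open>f\<close>, \<open>g\<close> with disjoint images of a \<open>k\<close>-sphere and an \<open>l\<close>-sphere to a space of
  dimension \<open>k + l + 1\<close>: the cone is in general position when its apex is in general position to the
  images of the vertices of triangulations on which \<open>f\<close> and \<open>g\<close> are linear. Then only \<open>k\<close>-simplices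
  and \<open>l\<close>-simplices give rise to intersections, each such pair to at most one, at interior points,
  and transversally; this holds for degenerate \<open>f\<close>, \<open>g\<close> too. The parity does not
  depend on the cone.
\<close>

definition linked_mod2 ::
    "'a::real_vector set set \<Rightarrow> ('a \<Rightarrow> 'b::euclidean_space) \<Rightarrow> 'c::real_vector set set \<Rightarrow> ('c \<Rightarrow> 'b)
      \<Rightarrow> bool" where
  "linked_mod2 K f L g \<longleftrightarrow>
     (\<exists>A B p. subdivision A K \<and> linear_on_simplices A f \<and>
        subdivision B L \<and> linear_on_simplices B g \<and>
        in_general_position p (f ` \<Union>A \<union> g ` \<Union>B) \<and>
        odd (card (cone_intersections p K f L g)))"

end

theory Submission
  imports Defs "HOL-Library.Z2"
begin

text \<open>
  Let \<open>d = k + l + 1\<close>. The complex consists of the \<open>k\<close>-skeleton of the simplex on \<open>1, \<dots>, d + 2\<close>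
  together with the cone, with apex \<open>0\<close>, over its \<open>(l - 1)\<close>-skeleton; the two spheres of \<open>j\<close> are the
  boundaries of the simplices on \<open>j\<close> and on \<open>{0} \<union> j\<^sup>c\<close>. It embeds linearly, by general position.

  With homogeneous coordinates \<open>-(f v, 1)\<close> on the first and \<open>(g w, 1)\<close> on the second factor, the linking
  number is the degree of the linear extension to the join of the two spheres: it counts the simplices
  of the join whose cone contains \<open>(p, 1)\<close>, where \<open>p\<close> is the apex. That this does not depend on \<open>p\<close> modulo 2 is a pivoting
  argument: the nonnegative solutions of a generic linear system form a segment, which has two endpoints.

  In the sum over \<open>j\<close> the faces containing \<open>0\<close> cancel, and what remains is a sum over all pairs of disjoint
  faces \<open>\<alpha>\<close>, \<open>\<beta>\<close> with \<open>k + 1\<close> and \<open>l + 1\<close> vertices, that is, over cells of the deleted join of a simplex.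
  Its value is found as in the Borsuk--Ulam theorem. Let \<open>c\<^sub>i\<close> count the points of \<open>i\<close>-dimensional cells
  at which \<open>i\<close> generic linear functionals vanish and the next one is positive. For an almost embedding
  \<open>\<delta> c\<^bsub>i-1\<^esub> = c\<^sub>i + T c\<^sub>i\<close>, where \<open>T\<close> exchanges the factors, and \<open>c\<^sub>d\<close> is a cocycle. Evaluating
  on suitable chains of the deleted join leads from dimension \<open>d\<close> down to a single point.
\<close>

section \<open>Nonnegative solutions of linear systems\<close>

text \<open>An almost embedding separates only disjoint simplices of the complex, so every cell used
  must be a pair of disjoint faces with at most \<open>k + 1\<close> vertices each. This dictates
  the chains of the descent: the pairs of \<open>m\<close>-element sets among
  \<open>2 * m + 1\<close> vertices form a mod 2 cycle, the deleted join of the (m - 1)-skeleton of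
  a 2m-simplex. The sizes \<open>(k + 1, l + 1)\<close> are brought to balanced ones by the cocycle
  condition, one vertex at a time; since \<open>l \<le> k\<close>, no face ever exceeds
  \<open>k + 1\<close> vertices on the way.

  The other obstacle is that \<open>f\<close> is linear only on a subdivision. All counts are
  therefore made on simplices of the subdivision and summed over the pieces of a cell. That this
  commutes with boundaries modulo 2 rests on a local fact: a codimension-one piece inside a simplex
  has two cofaces, one inside a facet has a single coface.

  The last of the \<open>d + 1\<close> functionals is the height coordinate. The top cochain then
  counts exactly the crossings with the cone from one special apex, the common zero at height one of
  the other functionals.\<close>

lemma homogeneous_system_nontrivial:
  fixes M :: "'r \<Rightarrow> 'i \<Rightarrow> real"
  assumes "finite R" "finite T" "card R < card T"
  shows "\<exists>w. (\<exists>i\<in>T. w i \<noteq> 0) \<and> (\<forall>r\<in>R. (\<Sum>i\<in>T. w i * M r i) = 0)"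
  using assms
proof (induction R arbitrary: T M rule: finite_induct)
  case empty
  then have "T \<noteq> {}" by auto
  then show ?case by (intro exI[of _ "\<lambda>_. 1"]) auto
next
  case (insert r R)
  show ?case
  proof (cases "\<forall>i\<in>T. M r i = 0")
    case True
    have "card R < card T" using insert by simp
    with insert.IH[of T M] insert.prems obtain w where
      w: "\<exists>i\<in>T. w i \<noteq> 0" "\<forall>r\<in>R. (\<Sum>i\<in>T. w i * M r i) = 0" by auto
    then show ?thesis using True by (intro exI[of _ w]) auto
  next
    case False
    then obtain z where z: "z \<in> T" "M r z \<noteq> 0" by auto
    let ?T = "T - {z}"
    have "finite ?T" "card R < card ?T" using insert z by auto
    \<comment> \<open>Gaussian elimination: row \<open>r\<close> is solved for the unknown
      \<open>z\<close>, and substitution leaves a system with one equation and one unknown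
      less.\<close>
    with insert.IH[of ?T "\<lambda>q i. M q i - M q z * M r i / M r z"] obtain w where
      w: "\<exists>i\<in>?T. w i \<noteq> 0"
         "\<forall>q\<in>R. (\<Sum>i\<in>?T. w i * (M q i - M q z * M r i / M r z)) = 0" by auto
    define w' where "w' = (\<lambda>i. if i = z then - (\<Sum>i\<in>?T. w i * M r i) / M r z else w i)"
    have sum_w': "(\<Sum>i\<in>T. w' i * M q i) = (\<Sum>i\<in>?T. w i * (M q i - M q z * M r i / M r z))" for q
    proof -
      have "(\<Sum>i\<in>T. w' i * M q i) = w' z * M q z + (\<Sum>i\<in>?T. w' i * M q i)"
        using insert.prems z by (simp add: sum.remove)
      also have "(\<Sum>i\<in>?T. w' i * M q i) = (\<Sum>i\<in>?T. w i * M q i)"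
        by (rule sum.cong) (auto simp: w'_def)
      also have "w' z * M q z = - (\<Sum>i\<in>?T. w i * (M q z * M r i / M r z))"
        by (simp add: w'_def sum_distrib_left sum_distrib_right sum_divide_distrib sum_negf mult_ac)
      finally show ?thesis by (simp add: algebra_simps sum_subtractf)
    qed
    have "(\<Sum>i\<in>T. w' i * M r i) = 0"
      using z by (simp add: sum_w')
    moreover have "\<exists>i\<in>T. w' i \<noteq> 0" using w(1) by (auto simp: w'_def)
    ultimately show ?thesis using w(2) sum_w' by (intro exI[of _ w']) auto
  qed
qed

text \<open>The ratio test of the simplex method: among the coordinates that decrease along
  \<open>w\<close>, the one with the smallest ratio \<open>c i / - w i\<close> reaches zero
  first.\<close>

lemma ray_meets_orthant_boundary:
  fixes c w :: "'i \<Rightarrow> real"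
  assumes "finite T" "\<forall>i\<in>T. 0 \<le> c i" "\<exists>i\<in>T. w i < 0"
  obtains t q where "0 \<le> t" "q \<in> T" "w q < 0" "c q + t * w q = 0" "\<forall>i\<in>T. 0 \<le> c i + t * w i"
proof -
  let ?N = "{i\<in>T. w i < 0}"
  define t where "t = Min ((\<lambda>i. c i / - w i) ` ?N)"
  have ne: "finite ?N" "?N \<noteq> {}" using assms by auto
  then have "t \<in> (\<lambda>i. c i / - w i) ` ?N" unfolding t_def by (intro Min_in) auto
  then obtain q where q: "q \<in> T" "w q < 0" "t = c q / - w q" by auto
  have le: "t \<le> c i / - w i" if "i \<in> ?N" for i
    unfolding t_def using ne that by (intro Min_le) auto
  have t0: "0 \<le> t" using q assms by (auto simp: divide_nonneg_neg)
  have "0 \<le> c i + t * w i" if "i \<in> T" for i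
  proof (cases "w i < 0")
    case True
    then have "t * - w i \<le> c i" using le[of i] that by (simp add: field_simps)
    then show ?thesis by simp
  next
    case False
    then show ?thesis using assms that t0 by simp
  qed
  then show ?thesis using that[of t q] t0 q by (auto simp: field_simps)
qed

text \<open>With the first \<open>n\<close> entries of \<open>M i\<close> read as a point of
  n-space, the origin lies in the convex hull of the points of \<open>S\<close>. Leaving the
  coefficients unnormalised spares an equation.\<close>

definition hit :: "('i \<Rightarrow> nat \<Rightarrow> real) \<Rightarrow> nat \<Rightarrow> 'i set \<Rightarrow> bool" where
  "hit M n S \<longleftrightarrow> (\<exists>c. (\<forall>i\<in>S. 0 \<le> c i) \<and> (\<exists>i\<in>S. c i \<noteq> 0) \<and> (\<forall>r<n. (\<Sum>i\<in>S. c i * M i r) = 0))"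

lemma hitI_support:
  assumes "finite S" "S' \<subseteq> S" "\<forall>i\<in>S. 0 \<le> c i" "\<exists>i\<in>S'. c i \<noteq> (0::real)" "\<forall>i\<in>S - S'. c i = 0"
    "\<forall>r<n. (\<Sum>i\<in>S. c i * M i r) = 0"
  shows "hit M n S'"
proof -
  have "(\<Sum>i\<in>S'. c i * M i r) = (\<Sum>i\<in>S. c i * M i r)" for r
    using assms by (intro sum.mono_neutral_left) auto
  then show ?thesis unfolding hit_def using assms by (intro exI[of _ c]) auto
qed

lemma hit_mono:
  assumes "finite S" "S' \<subseteq> S" "hit M n S'"
  shows "hit M n S"
proof -
  obtain c where c: "\<forall>i\<in>S'. 0 \<le> c i" "\<exists>i\<in>S'. c i \<noteq> 0" "\<forall>r<n. (\<Sum>i\<in>S'. c i * M i r) = 0"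
    using assms(3) unfolding hit_def by blast
  have "(\<Sum>i\<in>S. (if i \<in> S' then c i else 0) * M i r) = (\<Sum>i\<in>S'. c i * M i r)" for r
    using assms by (intro sum.mono_neutral_cong_right) auto
  then show ?thesis unfolding hit_def using c assms
    by (intro exI[of _ "\<lambda>i. if i \<in> S' then c i else 0"]) auto
qed

text \<open>The nonnegative solutions of the \<open>n\<close> equations form, up to scaling, a segment; its two
  endpoints are the facets that are hit.\<close>

lemma even_card_hit_facets:
  assumes fin: "finite T" and cardT: "card T = n + 2"
    and generic: "\<And>x y. x \<in> T \<Longrightarrow> y \<in> T \<Longrightarrow> x \<noteq> y \<Longrightarrow> \<not> hit M n (T - {x, y})"
  shows "even (card {x\<in>T. hit M n (T - {x})})"
proof -
  define Z where "Z = {x\<in>T. hit M n (T - {x})}"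
  \<comment> \<open>By genericity a solution on the facet opposite \<open>x\<close> has no further
    zero \<open>i\<close>, as otherwise it would live on \<open>T - {x, i}\<close>.\<close>
  have sol: "\<exists>c. c x = 0 \<and> (\<forall>i\<in>T - {x}. 0 < c i) \<and> (\<forall>r<n. (\<Sum>i\<in>T. c i * M i r) = 0)" if "x \<in> Z" for x
  proof -
    from that have "x \<in> T" "hit M n (T - {x})" by (auto simp: Z_def)
    then obtain c where c: "\<forall>i\<in>T - {x}. 0 \<le> c i" "\<exists>i\<in>T - {x}. c i \<noteq> 0"
      "\<forall>r<n. (\<Sum>i\<in>T - {x}. c i * M i r) = 0" unfolding hit_def by blast
    have "0 < c i" if i: "i \<in> T - {x}" for i
    proof (rule ccontr)
      assume "\<not> 0 < c i"
      then have "c i = 0" using c(1) i by force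
      then have "hit M n (T - {x, i})"
        using c fin i by (intro hitI_support[of "T - {x}" _ c]) auto
      then show False using generic[of x i] i \<open>x \<in> T\<close> by auto
    qed
    moreover have "(\<Sum>i\<in>T. (c(x := 0)) i * M i r) = (\<Sum>i\<in>T - {x}. c i * M i r)" for r
      using fin \<open>x \<in> T\<close> by (subst sum.remove[of T x]) auto
    ultimately show ?thesis using c by (intro exI[of _ "c(x := 0)"]) auto
  qed
  show ?thesis
  proof (cases "Z = {}")
    case True
    then show ?thesis unfolding Z_def by (simp only: card.empty) simp
  next
    case False
    then obtain x where x: "x \<in> Z" by auto
    then have xT: "x \<in> T" by (auto simp: Z_def)
    obtain c where c: "c x = 0" "\<forall>i\<in>T - {x}. 0 < c i" "\<forall>r<n. (\<Sum>i\<in>T. c i * M i r) = 0"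
      using sol[OF x] by blast
    \<comment> \<open>The extra row with index \<open>n\<close> consists of ones. A nonzero solution
      then has coordinates of sum zero, hence a negative one, so that a ray in its direction leaves
      the orthant.\<close>
    have "card (insert n {..<n}) < card T" using cardT by simp
    then have "\<exists>w. (\<exists>i\<in>T. w i \<noteq> 0) \<and>
        (\<forall>r\<in>insert n {..<n}. (\<Sum>i\<in>T. w i * (if r = n then 1 else M i r)) = 0)"
      using fin by (intro homogeneous_system_nontrivial) auto
    then obtain w0 where w01: "\<exists>i\<in>T. w0 i \<noteq> 0"
      and w0': "\<forall>r\<in>insert n {..<n}. (\<Sum>i\<in>T. w0 i * (if r = n then 1 else M i r)) = 0" by blast
    have w02: "(\<Sum>i\<in>T. w0 i) = 0" using w0'[rule_format, of n] by simp
    have w03: "\<forall>r<n. (\<Sum>i\<in>T. w0 i * M i r) = 0"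
    proof (intro allI impI)
      fix r assume "r < n"
      then show "(\<Sum>i\<in>T. w0 i * M i r) = 0" using w0'[rule_format, of r] by simp
    qed
    note w0 = w01 w02 w03
    \<comment> \<open>The sign keeps the coordinate \<open>x\<close>, which is zero at the start,
      from decreasing: the ray has to leave the orthant through another facet
      \<open>y\<close>.\<close>
    define w where "w = (\<lambda>i. (if w0 x \<ge> 0 then 1 else -1) * w0 i)"
    have w: "w x \<ge> 0" "\<exists>i\<in>T. w i \<noteq> 0" "(\<Sum>i\<in>T. w i) = 0" "\<forall>r<n. (\<Sum>i\<in>T. w i * M i r) = 0"
    proof -
      show "w x \<ge> 0" "\<exists>i\<in>T. w i \<noteq> 0" using w01 by (auto simp: w_def)
      show "(\<Sum>i\<in>T. w i) = 0" using w02 by (simp add: w_def sum_negf)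
      show "\<forall>r<n. (\<Sum>i\<in>T. w i * M i r) = 0" using w03 by (simp add: w_def sum_negf)
    qed
    have "\<exists>i\<in>T. w i < 0"
    proof (rule ccontr)
      assume "\<not> (\<exists>i\<in>T. w i < 0)"
      then have "\<forall>i\<in>T. w i = 0" using w(3) fin by (subst (asm) sum_nonneg_eq_0_iff) force+
      then show False using w(2) by auto
    qed
    moreover have c0: "\<forall>i\<in>T. 0 \<le> c i"
      using c by (metis Diff_iff empty_iff insert_iff less_imp_le order_refl)
    ultimately obtain t y where ty: "0 \<le> t" "y \<in> T" "w y < 0" "c y + t * w y = 0"
      "\<forall>i\<in>T. 0 \<le> c i + t * w i" using ray_meets_orthant_boundary[OF fin] by metis
    have yx: "y \<noteq> x" using ty w by auto
    have "hit M n (T - {y})"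
    proof (rule hitI_support[OF fin, where c="\<lambda>i. c i + t * w i"])
      show "\<exists>i\<in>T - {y}. c i + t * w i \<noteq> 0"
      proof (rule ccontr)
        assume "\<not> ?thesis"
        then have "\<forall>i\<in>T. c i + t * w i = 0" using ty by auto
        then have "0 = (\<Sum>i\<in>T. c i + t * w i)" by simp
        also have "\<dots> = (\<Sum>i\<in>T. c i)" using w(3) by (simp add: sum.distrib flip: sum_distrib_left)
        finally have "\<forall>i\<in>T. c i = 0" using c0 fin by (simp add: sum_nonneg_eq_0_iff)
        then show False using c(2) ty(2) yx by force
      qed
      show "\<forall>r<n. (\<Sum>i\<in>T. (c i + t * w i) * M i r) = 0"
        using c(3) w(4) by (simp add: distrib_right sum.distrib mult.assoc flip: sum_distrib_left)
    qed (use ty in auto)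
    then have yZ: "y \<in> Z" using ty by (simp add: Z_def)
    obtain a where a: "a y = 0" "\<forall>i\<in>T - {y}. 0 < a i" "\<forall>r<n. (\<Sum>i\<in>T. a i * M i r) = 0"
      using sol[OF yZ] by blast
    have "z = x \<or> z = y" if zZ: "z \<in> Z" for z
    proof (rule ccontr)
      assume zn: "\<not> (z = x \<or> z = y)"
      obtain b where b: "b z = 0" "\<forall>i\<in>T - {z}. 0 < b i" "\<forall>r<n. (\<Sum>i\<in>T. b i * M i r) = 0"
        using sol[OF zZ] by blast
      have zT: "z \<in> T" using zZ by (simp add: Z_def)
      \<comment> \<open>Scaled to agree at \<open>x\<close>, the solutions for \<open>y\<close> and
        \<open>z\<close> differ by a direction inside the facet opposite \<open>x\<close>. Following
        it from \<open>c\<close> produces a second zero, while the growing coordinate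
        \<open>z\<close> keeps the solution nontrivial: a contradiction to genericity.\<close>
      define u where "u = (\<lambda>i. a i / a x - b i / b x)"
      have pos: "a x > 0" "b x > 0" "a z > 0" "b y > 0" using a b zn yx xT zT ty(2) by auto
      have u: "u x = 0" "u y < 0" "u z > 0" using pos a(1) b(1) by (auto simp: u_def)
      have usol: "\<forall>r<n. (\<Sum>i\<in>T. u i * M i r) = 0"
        using a(3) b(3) by (simp add: u_def left_diff_distrib sum_subtractf flip: sum_divide_distrib)
      obtain s q where sq: "0 \<le> s" "q \<in> T" "u q < 0" "c q + s * u q = 0"
        "\<forall>i\<in>T. 0 \<le> c i + s * u i"
        using ray_meets_orthant_boundary[OF fin c0] u(2) ty(2) by metis
      have "q \<noteq> x" "q \<noteq> z" using sq u by auto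
      have "c z > 0" using c(2) zT zn by auto
      have "hit M n (T - {x, q})"
      proof (rule hitI_support[OF fin, where c="\<lambda>i. c i + s * u i"])
        have "c z + s * u z > 0" using \<open>c z > 0\<close> sq(1) u(3) by (simp add: add_pos_nonneg)
        then show "\<exists>i\<in>T - {x, q}. c i + s * u i \<noteq> 0" using zT zn \<open>q \<noteq> z\<close> by force
        show "\<forall>r<n. (\<Sum>i\<in>T. (c i + s * u i) * M i r) = 0"
          using c(3) usol by (simp add: distrib_right sum.distrib mult.assoc flip: sum_distrib_left)
        show "\<forall>i\<in>T - (T - {x, q}). c i + s * u i = 0"
          using sq u c by auto
      qed (use sq in auto)
      then show False using generic[of x q] xT sq \<open>q \<noteq> x\<close> by auto
    qed
    then have "Z = {x, y}" using x yZ by auto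
    then show ?thesis using yx unfolding Z_def by simp
  qed
qed

text \<open>The first \<open>n\<close> functionals vanish at a point of the simplex where the next
  one is positive. Strict positivity already excludes the zero solution.\<close>

definition poshit :: "('i \<Rightarrow> nat \<Rightarrow> real) \<Rightarrow> nat \<Rightarrow> 'i set \<Rightarrow> bool" where
  "poshit M n S \<longleftrightarrow> (\<exists>c. (\<forall>i\<in>S. 0 \<le> c i) \<and> (\<forall>r<n. (\<Sum>i\<in>S. c i * M i r) = 0) \<and> (\<Sum>i\<in>S. c i * M i n) > 0)"

text \<open>By genericity the first \<open>n\<close> functionals vanish on a segment with endpoints
  in facets, or nowhere. The next functional has a zero on the segment exactly when its signs at the
  endpoints differ, that is, when one endpoint is positive and not none or both.\<close>

lemma parity_poshit_facets:
  assumes fin: "finite S" and cardS: "card S = n + 2"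
    and g1: "\<And>x. x \<in> S \<Longrightarrow> \<not> hit M (Suc n) (S - {x})"
    and g2: "\<And>x y. x \<in> S \<Longrightarrow> y \<in> S \<Longrightarrow> x \<noteq> y \<Longrightarrow> \<not> hit M n (S - {x, y})"
  shows "odd (card {x\<in>S. poshit M n (S - {x})}) \<longleftrightarrow> hit M (Suc n) S"
proof -
  \<comment> \<open>The added vector \<open>None\<close> is minus the unit vector of row
    \<open>n\<close>. To balance it a combination must be positive in row \<open>n\<close>, so
    positive hits of facets become ordinary hits and the facet count for \<open>Suc n\<close> rows
    applies to \<open>S\<close> with \<open>None\<close>.\<close>
  define M' where "M' = (\<lambda>x. case x of None \<Rightarrow> (\<lambda>r. if r = n then -1 else 0) | Some i \<Rightarrow> M i)"
  let ?T = "insert None (Some ` S)"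
  have hit_Some: "hit M' m (Some ` U) \<longleftrightarrow> hit M m U" for m U
  proof
    assume "hit M' m (Some ` U)"
    then obtain c where c: "\<forall>i\<in>Some`U. 0 \<le> c i" "\<exists>i\<in>Some`U. c i \<noteq> 0"
      "\<forall>r<m. (\<Sum>i\<in>Some`U. c i * M' i r) = 0" unfolding hit_def by blast
    then show "hit M m U" unfolding hit_def
      by (intro exI[of _ "\<lambda>i. c (Some i)"]) (auto simp: M'_def sum.reindex)
  next
    assume "hit M m U"
    then obtain c where c: "\<forall>i\<in>U. 0 \<le> c i" "\<exists>i\<in>U. c i \<noteq> 0"
      "\<forall>r<m. (\<Sum>i\<in>U. c i * M i r) = 0" unfolding hit_def by blast
    then show "hit M' m (Some ` U)" unfolding hit_def
      by (intro exI[of _ "\<lambda>i. c (the i)"]) (auto simp: M'_def sum.reindex)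
  qed
  have hit_None: "hit M' (Suc n) (insert None (Some ` U)) \<longleftrightarrow> poshit M n U \<or> hit M (Suc n) U"
    if "finite U" for U
  proof
    assume "hit M' (Suc n) (insert None (Some ` U))"
    then obtain c where c0: "\<forall>i\<in>insert None (Some ` U). 0 \<le> c i"
      "\<exists>i\<in>insert None (Some ` U). c i \<noteq> 0"
      "\<forall>r<Suc n. (\<Sum>i\<in>insert None (Some ` U). c i * M' i r) = 0" unfolding hit_def by blast
    have "(\<Sum>i\<in>insert None (Some ` U). c i * M' i r) =
        c None * M' None r + (\<Sum>i\<in>U. c (Some i) * M i r)" for r
      using that by (simp add: sum.reindex M'_def)
    with c0 have c: "c None \<ge> 0" "\<forall>i\<in>U. 0 \<le> c (Some i)"
      "c None \<noteq> 0 \<or> (\<exists>i\<in>U. c (Some i) \<noteq> 0)"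
      "\<forall>r<Suc n. c None * M' None r + (\<Sum>i\<in>U. c (Some i) * M i r) = 0"
      by auto
    show "poshit M n U \<or> hit M (Suc n) U"
    proof (cases "c None = 0")
      case True
      then show ?thesis using c unfolding hit_def by (intro disjI2 exI[of _ "\<lambda>i. c (Some i)"]) auto
    next
      case False
      have "(\<Sum>i\<in>U. c (Some i) * M i n) = c None" using c(4)[rule_format, of n] by (simp add: M'_def)
      moreover have "(\<Sum>i\<in>U. c (Some i) * M i r) = 0" if "r < n" for r
        using c(4)[rule_format, of r] that by (simp add: M'_def)
      ultimately show ?thesis using False c unfolding poshit_def
        by (intro disjI1 exI[of _ "\<lambda>i. c (Some i)"]) auto
    qed
  next
    assume "poshit M n U \<or> hit M (Suc n) U"
    then show "hit M' (Suc n) (insert None (Some ` U))"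
    proof
      assume "poshit M n U"
      then obtain c where c: "\<forall>i\<in>U. 0 \<le> c i" "\<forall>r<n. (\<Sum>i\<in>U. c i * M i r) = 0" "(\<Sum>i\<in>U. c i * M i n) > 0"
        unfolding poshit_def by blast
      then show ?thesis using that unfolding hit_def
        by (intro exI[of _ "case_option (\<Sum>i\<in>U. c i * M i n) c"])
          (auto simp: sum.reindex M'_def less_Suc_eq)
    next
      assume "hit M (Suc n) U"
      then have "hit M' (Suc n) (Some ` U)" by (simp add: hit_Some)
      then show ?thesis using that by (elim hit_mono[rotated 2]) auto
    qed
  qed
  have poshit_hit: "hit M n U" if "poshit M n U" for U
  proof -
    from that obtain c where c: "\<forall>i\<in>U. 0 \<le> c i" "\<forall>r<n. (\<Sum>i\<in>U. c i * M i r) = 0"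
      "(\<Sum>i\<in>U. c i * M i n) > 0" unfolding poshit_def by blast
    moreover have "\<exists>i\<in>U. c i \<noteq> 0"
    proof (rule ccontr)
      assume "\<not> ?thesis"
      then have "(\<Sum>i\<in>U. c i * M i n) = 0" by (intro sum.neutral) auto
      then show False using c by simp
    qed
    ultimately show ?thesis unfolding hit_def by blast
  qed
  have remN: "?T - {None} = Some ` S" by auto
  have remS: "?T - {Some x} = insert None (Some ` (S - {x}))" for x by auto
  have "even (card {x\<in>?T. hit M' (Suc n) (?T - {x})})"
  proof (rule even_card_hit_facets)
    show "card ?T = Suc n + 2" using fin cardS by (simp add: card_image)
    fix x y assume xy: "x \<in> ?T" "y \<in> ?T" "x \<noteq> y"
    have 1: "\<not> hit M' (Suc n) (?T - {None, Some x})" if "x \<in> S" for x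
    proof -
      have "?T - {None, Some x} = Some ` (S - {x})" by auto
      then show ?thesis using g1[OF that] by (simp add: hit_Some)
    qed
    have 2: "\<not> hit M' (Suc n) (?T - {Some x, Some y})" if "x \<in> S" "y \<in> S" "x \<noteq> y" for x y
    proof -
      have *: "?T - {Some x, Some y} = insert None (Some ` (S - {x, y}))" by auto
      have "\<not> hit M (Suc n) (S - {x, y})"
        using g1[OF that(1)] hit_mono[of "S - {x}" "S - {x, y}" M "Suc n"] fin by auto
      then show ?thesis unfolding * using fin g2[OF that] poshit_hit by (subst hit_None) auto
    qed
    show "\<not> hit M' (Suc n) (?T - {x, y})"
      using xy 1 2 by (auto simp: insert_commute)
  qed (use fin in auto)
  also have "{x\<in>?T. hit M' (Suc n) (?T - {x})} =
    (if hit M (Suc n) S then {None} else {}) \<union> Some ` {x\<in>S. poshit M n (S - {x})}"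
  proof -
    have "hit M' (Suc n) (?T - {Some x}) \<longleftrightarrow> poshit M n (S - {x})" if "x \<in> S" for x
      unfolding remS using fin g1[OF that] by (subst hit_None) auto
    moreover have "hit M' (Suc n) (?T - {None}) \<longleftrightarrow> hit M (Suc n) S" unfolding remN hit_Some ..
    ultimately show ?thesis by auto
  qed
  also have "card \<dots> = (if hit M (Suc n) S then 1 else 0) + card {x\<in>S. poshit M n (S - {x})}"
    using fin by (subst card_Un_disjoint) (auto simp: card_image)
  finally show ?thesis by (auto split: if_splits)
qed

text \<open>Two solutions with opposite signs in row \<open>n\<close> could be mixed into one that
  vanishes there as well, so genericity admits exactly one of the signs.\<close>

lemma hit_iff_poshit_neq:
  assumes g2: "\<not> hit M (Suc n) S"
  shows "hit M n S \<longleftrightarrow> poshit M n S \<noteq> poshit (\<lambda>i r. - M i r) n S"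
proof -
  have nz: "\<exists>i\<in>S. c i \<noteq> 0" if "(\<Sum>i\<in>S. c i * M i n) \<noteq> 0" for c
  proof (rule ccontr)
    assume "\<not> ?thesis"
    then have "(\<Sum>i\<in>S. c i * M i n) = 0" by (intro sum.neutral) auto
    then show False using that by simp
  qed
  have unneg: "poshit (\<lambda>i r. - M i r) n S \<longleftrightarrow>
    (\<exists>c. (\<forall>i\<in>S. 0 \<le> c i) \<and> (\<forall>r<n. (\<Sum>i\<in>S. c i * M i r) = 0) \<and> (\<Sum>i\<in>S. c i * M i n) < 0)"
    unfolding poshit_def by (simp add: sum_negf)
  have "\<not> (poshit M n S \<and> poshit (\<lambda>i r. - M i r) n S)"
  proof
    assume "poshit M n S \<and> poshit (\<lambda>i r. - M i r) n S"
    then obtain a b where a: "\<forall>i\<in>S. 0 \<le> a i" "\<forall>r<n. (\<Sum>i\<in>S. a i * M i r) = 0" "(\<Sum>i\<in>S. a i * M i n) > 0"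
      and b: "\<forall>i\<in>S. 0 \<le> b i" "\<forall>r<n. (\<Sum>i\<in>S. b i * M i r) = 0" "(\<Sum>i\<in>S. b i * M i n) < 0"
      unfolding unneg unfolding poshit_def by blast
    define \<alpha> \<beta> where "\<alpha> = (\<Sum>i\<in>S. a i * M i n)" and "\<beta> = - (\<Sum>i\<in>S. b i * M i n)"
    have "\<alpha> > 0" "\<beta> > 0" using a b by (auto simp: \<alpha>_def \<beta>_def)
    have "\<exists>i\<in>S. a i \<noteq> 0" using nz[of a] a by auto
    then obtain i where i: "i \<in> S" "a i > 0" using a(1) by force
    have "hit M (Suc n) S" unfolding hit_def
    proof (intro exI conjI)
      show "\<forall>j\<in>S. 0 \<le> \<beta> * a j + \<alpha> * b j" using a b \<open>\<alpha> > 0\<close> \<open>\<beta> > 0\<close> by simp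
      have "\<beta> * a i + \<alpha> * b i > 0" using i b \<open>\<alpha> > 0\<close> \<open>\<beta> > 0\<close> by (simp add: add_pos_nonneg)
      then show "\<exists>j\<in>S. \<beta> * a j + \<alpha> * b j \<noteq> 0" using i by force
      have "(\<Sum>i\<in>S. (\<beta> * a i + \<alpha> * b i) * M i r) = \<beta> * (\<Sum>i\<in>S. a i * M i r) + \<alpha> * (\<Sum>i\<in>S. b i * M i r)" for r
        by (simp add: algebra_simps sum.distrib sum_distrib_left)
      then show "\<forall>r<Suc n. (\<Sum>i\<in>S. (\<beta> * a i + \<alpha> * b i) * M i r) = 0"
        using a(2) b(2) by (auto simp: less_Suc_eq \<alpha>_def \<beta>_def)
    qed
    then show False using g2 by simp
  qed
  moreover have "poshit M n S \<or> poshit (\<lambda>i r. - M i r) n S" if "hit M n S"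
  proof -
    from that obtain c where c: "\<forall>i\<in>S. 0 \<le> c i" "\<exists>i\<in>S. c i \<noteq> 0" "\<forall>r<n. (\<Sum>i\<in>S. c i * M i r) = 0"
      unfolding hit_def by blast
    have "(\<Sum>i\<in>S. c i * M i n) \<noteq> 0"
    proof
      assume "(\<Sum>i\<in>S. c i * M i n) = 0"
      then have "\<forall>r<Suc n. (\<Sum>i\<in>S. c i * M i r) = 0" using c(3) by (simp add: less_Suc_eq)
      then show False using g2 c(1,2) unfolding hit_def by blast
    qed
    then consider "(\<Sum>i\<in>S. c i * M i n) > 0" | "(\<Sum>i\<in>S. c i * M i n) < 0" by linarith
    then show ?thesis
    proof cases
      case 1
      then have "poshit M n S" unfolding poshit_def using c by blast
      then show ?thesis ..
    next
      case 2
      then have "poshit (\<lambda>i r. - M i r) n S" unfolding unneg using c by blast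
      then show ?thesis ..
    qed
  qed
  moreover have "hit M n S" if "poshit M n S \<or> poshit (\<lambda>i r. - M i r) n S"
  proof -
    from that obtain c where "\<forall>i\<in>S. 0 \<le> c i" "\<forall>r<n. (\<Sum>i\<in>S. c i * M i r) = 0"
      "(\<Sum>i\<in>S. c i * M i n) \<noteq> 0"
      unfolding unneg unfolding poshit_def by (elim disjE) (metis less_irrefl)+
    then show ?thesis using nz unfolding hit_def by blast
  qed
  ultimately show ?thesis by auto
qed

section \<open>Sums over pairs of disjoint sets modulo 2\<close>

text \<open>These simp rules would rewrite sums of bits into exclusive disjunctions.\<close>

declare add_bit_eq_xor [simp del] mult_bit_eq_and [simp del] bit_not_zero_iff [simp del]
  bit_not_one_iff [simp del]

lemma bit_add_self [simp]: "a + a = (0::bit)"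
  by (cases a) simp_all

text \<open>Integer sizes permit \<open>a - 1\<close> without case distinctions: for
  \<open>a = 0\<close> the set is empty, in agreement with the empty sum over removed
  vertices.\<close>

definition disjoint_pairs :: "'v set \<Rightarrow> int \<Rightarrow> int \<Rightarrow> ('v set \<times> 'v set) set" where
  "disjoint_pairs X a b =
     {(\<alpha>, \<beta>). \<alpha> \<subseteq> X \<and> \<beta> \<subseteq> X \<and> \<alpha> \<inter> \<beta> = {} \<and> int (card \<alpha>) = a \<and> int (card \<beta>) = b}"

lemma int_card_pred: "finite \<alpha> \<Longrightarrow> e \<in> \<alpha> \<Longrightarrow> int (card \<alpha> - Suc 0) = int (card \<alpha>) - 1"
  by (metis One_nat_def card_gt_0_iff empty_iff of_nat_1 of_nat_diff Suc_leI)

lemma finite_disjoint_pairs [simp]: "finite X \<Longrightarrow> finite (disjoint_pairs X a b)"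
  by (rule finite_subset[of _ "Pow X \<times> Pow X"]) (auto simp: disjoint_pairs_def)

lemma sum_disjoint_pairs_swap:
  "(\<Sum>(\<alpha>, \<beta>)\<in>disjoint_pairs X a b. G \<alpha> \<beta>) = (\<Sum>(\<alpha>, \<beta>)\<in>disjoint_pairs X b a. G \<beta> \<alpha>)"
  by (rule sum.reindex_bij_witness[of _ prod.swap prod.swap]) (auto simp: disjoint_pairs_def)

text \<open>A pair of sizes \<open>a - 1\<close> and \<open>b\<close> arises once for each vertex
  outside of it; modulo 2 only the parity of that number matters.\<close>

lemma sum_disjoint_pairs_remove_fst:
  fixes G :: "'v set \<Rightarrow> 'v set \<Rightarrow> bit"
  assumes "finite X"
  shows "(\<Sum>(\<alpha>, \<beta>)\<in>disjoint_pairs X a b. \<Sum>e\<in>\<alpha>. G (\<alpha> - {e}) \<beta>) =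
    of_int (int (card X) - a - b + 1) * (\<Sum>(\<alpha>, \<beta>)\<in>disjoint_pairs X (a - 1) b. G \<alpha> \<beta>)"
proof -
  have fin: "finite \<alpha>" if "\<alpha> \<subseteq> X" for \<alpha> using that assms finite_subset by blast
  have finD: "finite (fst p)" if "p \<in> disjoint_pairs X a b" for p
    using that fin by (auto simp: disjoint_pairs_def)
  have "(\<Sum>(\<alpha>, \<beta>)\<in>disjoint_pairs X a b. \<Sum>e\<in>\<alpha>. G (\<alpha> - {e}) \<beta>) =
      (\<Sum>((\<alpha>, \<beta>), e)\<in>Sigma (disjoint_pairs X a b) fst. G (\<alpha> - {e}) \<beta>)"
    using assms finD by (subst sum.Sigma[symmetric]) (auto intro!: sum.cong)
  also have "\<dots> = (\<Sum>((\<alpha>, \<beta>), e)\<in>Sigma (disjoint_pairs X (a - 1) b) (\<lambda>p. X - fst p - snd p). G \<alpha> \<beta>)"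
    by (rule sum.reindex_bij_witness[of _ "\<lambda>((\<alpha>, \<beta>), e). ((insert e \<alpha>, \<beta>), e)"
          "\<lambda>((\<alpha>, \<beta>), e). ((\<alpha> - {e}, \<beta>), e)"])
      (auto simp: disjoint_pairs_def fin int_card_pred card_insert_if insert_absorb )
  also have "\<dots> = (\<Sum>p\<in>disjoint_pairs X (a - 1) b. \<Sum>e\<in>X - fst p - snd p. case p of (\<alpha>, \<beta>) \<Rightarrow> G \<alpha> \<beta>)"
    by (subst sum.Sigma) (auto simp: assms intro!: sum.cong)
  also have "\<dots> = (\<Sum>p\<in>disjoint_pairs X (a - 1) b.
      of_int (int (card X) - a - b + 1) * (case p of (\<alpha>, \<beta>) \<Rightarrow> G \<alpha> \<beta>))"
  proof (rule sum.cong[OF refl])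
    fix p assume "p \<in> disjoint_pairs X (a - 1) b"
    then have p: "fst p \<subseteq> X" "snd p \<subseteq> X - fst p" "int (card (fst p)) = a - 1" "int (card (snd p)) = b"
      by (auto simp: disjoint_pairs_def)
    have "card (X - fst p - snd p) = card X - card (fst p) - card (snd p)"
      using p assms by (simp add: card_Diff_subset fin finite_subset[OF p(2)])
    moreover have "card (fst p) + card (snd p) \<le> card X"
    proof -
      have "fst p \<inter> snd p = {}" "finite (fst p)" "finite (snd p)"
        using p by (auto intro!: fin)
      then have "card (fst p) + card (snd p) = card (fst p \<union> snd p)" by (simp add: card_Un_disjoint)
      also have "\<dots> \<le> card X" using p assms by (intro card_mono) auto
      finally show ?thesis .
    qed
    ultimately have "int (card (X - fst p - snd p)) = int (card X) - a - b + 1" using p by linarith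
    then have "of_nat (card (X - fst p - snd p)) = (of_int (int (card X) - a - b + 1) :: bit)"
      by (metis of_int_of_nat_eq)
    then show "(\<Sum>e\<in>X - fst p - snd p. case p of (\<alpha>, \<beta>) \<Rightarrow> G \<alpha> \<beta>) =
        of_int (int (card X) - a - b + 1) * (case p of (\<alpha>, \<beta>) \<Rightarrow> G \<alpha> \<beta>)"
      by simp
  qed
  finally show ?thesis by (simp add: sum_distrib_left)
qed

lemma sum_disjoint_pairs_remove_snd:
  fixes G :: "'v set \<Rightarrow> 'v set \<Rightarrow> bit"
  assumes "finite X"
  shows "(\<Sum>(\<alpha>, \<beta>)\<in>disjoint_pairs X a b. \<Sum>e\<in>\<beta>. G \<alpha> (\<beta> - {e})) =
    of_int (int (card X) - a - b + 1) * (\<Sum>(\<alpha>, \<beta>)\<in>disjoint_pairs X a (b - 1). G \<alpha> \<beta>)"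
  by (subst (1 2) sum_disjoint_pairs_swap)
    (simp add: sum_disjoint_pairs_remove_fst[OF assms, of "\<lambda>\<alpha> \<beta>. G \<beta> \<alpha>"] algebra_simps)

lemma sum_disjoint_pairs_insert:
  fixes G :: "'v set \<Rightarrow> 'v set \<Rightarrow> bit"
  assumes "finite X" "y \<notin> X"
  shows "(\<Sum>(\<alpha>, \<beta>)\<in>disjoint_pairs (insert y X) a b. G \<alpha> \<beta>) =
    (\<Sum>(\<alpha>, \<beta>)\<in>disjoint_pairs X (a - 1) b. G (insert y \<alpha>) \<beta>) +
    (\<Sum>(\<alpha>, \<beta>)\<in>disjoint_pairs X a (b - 1). G \<alpha> (insert y \<beta>)) +
    (\<Sum>(\<alpha>, \<beta>)\<in>disjoint_pairs X a b. G \<alpha> \<beta>)"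
proof -
  let ?D = "disjoint_pairs (insert y X) a b"
  have fin: "finite \<alpha>" if "\<alpha> \<subseteq> insert y X" for \<alpha> using that assms finite_subset by blast
  have 1: "(\<Sum>(\<alpha>, \<beta>)\<in>{p\<in>?D. y \<in> fst p}. G \<alpha> \<beta>) = (\<Sum>(\<alpha>, \<beta>)\<in>disjoint_pairs X (a - 1) b. G (insert y \<alpha>) \<beta>)"
    by (rule sum.reindex_bij_witness[of _ "\<lambda>(\<alpha>, \<beta>). (insert y \<alpha>, \<beta>)" "\<lambda>(\<alpha>, \<beta>). (\<alpha> - {y}, \<beta>)"])
      (use assms(2) in \<open>auto simp: disjoint_pairs_def fin int_card_pred card_insert_if insert_absorb finite_subset[OF _ assms(1)] \<close>)
  have 2: "(\<Sum>(\<alpha>, \<beta>)\<in>{p\<in>?D. y \<notin> fst p \<and> y \<in> snd p}. G \<alpha> \<beta>) =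
      (\<Sum>(\<alpha>, \<beta>)\<in>disjoint_pairs X a (b - 1). G \<alpha> (insert y \<beta>))"
    by (rule sum.reindex_bij_witness[of _ "\<lambda>(\<alpha>, \<beta>). (\<alpha>, insert y \<beta>)" "\<lambda>(\<alpha>, \<beta>). (\<alpha>, \<beta> - {y})"])
      (use assms(2) in \<open>auto simp: disjoint_pairs_def fin int_card_pred card_insert_if insert_absorb finite_subset[OF _ assms(1)] \<close>)
  have 3: "{p\<in>?D. y \<notin> fst p \<and> y \<notin> snd p} = disjoint_pairs X a b"
    using assms(2) by (auto simp: disjoint_pairs_def)
  have "?D = {p\<in>?D. y \<in> fst p} \<union> ({p\<in>?D. y \<notin> fst p \<and> y \<in> snd p} \<union> {p\<in>?D. y \<notin> fst p \<and> y \<notin> snd p})"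
    by auto
  then have "(\<Sum>(\<alpha>, \<beta>)\<in>?D. G \<alpha> \<beta>) = (\<Sum>(\<alpha>, \<beta>)\<in>{p\<in>?D. y \<in> fst p} \<union>
      ({p\<in>?D. y \<notin> fst p \<and> y \<in> snd p} \<union> {p\<in>?D. y \<notin> fst p \<and> y \<notin> snd p}). G \<alpha> \<beta>)"
    by (rule arg_cong)
  also have "\<dots> = (\<Sum>(\<alpha>, \<beta>)\<in>{p\<in>?D. y \<in> fst p}. G \<alpha> \<beta>) +
      ((\<Sum>(\<alpha>, \<beta>)\<in>{p\<in>?D. y \<notin> fst p \<and> y \<in> snd p}. G \<alpha> \<beta>) +
       (\<Sum>(\<alpha>, \<beta>)\<in>{p\<in>?D. y \<notin> fst p \<and> y \<notin> snd p}. G \<alpha> \<beta>))"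
    using assms(1) by (subst sum.union_disjoint; (subst sum.union_disjoint)?) auto
  finally show ?thesis unfolding 1 2 3 by (simp only: add.assoc)
qed

text \<open>The mod 2 coboundary of the deleted join: a cell is a pair of disjoint faces, and its
  facets arise by dropping a vertex from either factor.\<close>

definition pair_coboundary :: "('v set \<Rightarrow> 'v set \<Rightarrow> bit) \<Rightarrow> 'v set \<Rightarrow> 'v set \<Rightarrow> bit" where
  "pair_coboundary C \<alpha> \<beta> = (\<Sum>e\<in>\<alpha>. C (\<alpha> - {e}) \<beta>) + (\<Sum>e\<in>\<beta>. C \<alpha> (\<beta> - {e}))"

text \<open>Dropping \<open>x\<close> returns the pair itself; the other facets still contain
  \<open>x\<close> and occur as often as there are free vertices.\<close>

lemma sum_pair_coboundary_insert:
  assumes "finite X" "x \<notin> X"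
  shows "(\<Sum>(\<alpha>, \<beta>)\<in>disjoint_pairs X a b. pair_coboundary C (insert x \<alpha>) \<beta>) =
    (\<Sum>(\<alpha>, \<beta>)\<in>disjoint_pairs X a b. C \<alpha> \<beta>) +
    of_int (int (card X) - a - b + 1) *
      ((\<Sum>(\<alpha>, \<beta>)\<in>disjoint_pairs X (a - 1) b. C (insert x \<alpha>) \<beta>) +
       (\<Sum>(\<alpha>, \<beta>)\<in>disjoint_pairs X a (b - 1). C (insert x \<alpha>) \<beta>))"
proof -
  have "pair_coboundary C (insert x \<alpha>) \<beta> = C \<alpha> \<beta> + ((\<Sum>e\<in>\<alpha>. C (insert x (\<alpha> - {e})) \<beta>) +
      (\<Sum>e\<in>\<beta>. C (insert x \<alpha>) (\<beta> - {e})))" if "(\<alpha>, \<beta>) \<in> disjoint_pairs X a b" for \<alpha> \<beta>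
  proof -
    have "\<alpha> \<subseteq> X" using that by (auto simp: disjoint_pairs_def)
    then have "finite \<alpha>" "x \<notin> \<alpha>" using assms finite_subset by auto
    then have "(\<Sum>e\<in>insert x \<alpha>. C (insert x \<alpha> - {e}) \<beta>) = C \<alpha> \<beta> + (\<Sum>e\<in>\<alpha>. C (insert x \<alpha> - {e}) \<beta>)"
      by simp
    also have "(\<Sum>e\<in>\<alpha>. C (insert x \<alpha> - {e}) \<beta>) = (\<Sum>e\<in>\<alpha>. C (insert x (\<alpha> - {e})) \<beta>)"
      using \<open>x \<notin> \<alpha>\<close> by (intro sum.cong arg_cong2[where f=C]) auto
    finally show ?thesis by (simp add: pair_coboundary_def add.assoc)
  qed
  then have "(\<Sum>(\<alpha>, \<beta>)\<in>disjoint_pairs X a b. pair_coboundary C (insert x \<alpha>) \<beta>) =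
    (\<Sum>(\<alpha>, \<beta>)\<in>disjoint_pairs X a b. C \<alpha> \<beta> + ((\<Sum>e\<in>\<alpha>. C (insert x (\<alpha> - {e})) \<beta>) +
      (\<Sum>e\<in>\<beta>. C (insert x \<alpha>) (\<beta> - {e}))))"
    by (intro sum.cong) auto
  also have "\<dots> = (\<Sum>(\<alpha>, \<beta>)\<in>disjoint_pairs X a b. C \<alpha> \<beta>) +
      ((\<Sum>(\<alpha>, \<beta>)\<in>disjoint_pairs X a b. \<Sum>e\<in>\<alpha>. C (insert x (\<alpha> - {e})) \<beta>) +
       (\<Sum>(\<alpha>, \<beta>)\<in>disjoint_pairs X a b. \<Sum>e\<in>\<beta>. C (insert x \<alpha>) (\<beta> - {e})))"
    by (simp add: sum.distrib split_def)
  finally show ?thesis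
    using sum_disjoint_pairs_remove_fst[OF assms(1), of "\<lambda>\<alpha>. C (insert x \<alpha>)" a b]
      sum_disjoint_pairs_remove_snd[OF assms(1), of "\<lambda>\<alpha>. C (insert x \<alpha>)" a b]
    by (simp add: distrib_left)
qed

text \<open>\<open>C_sym\<close> is the relation between consecutive cochains, demanded only where
  both faces belong to the complex. Here \<open>k\<close> and \<open>n\<close> count vertices, not
  dimensions: they will be \<open>k + 1\<close> and \<open>k + l + 2\<close>.\<close>

context
  fixes C :: "'v set \<Rightarrow> 'v set \<Rightarrow> bit" and V :: "'v set" and k n :: nat
  assumes finV: "finite V"
    and C_empty: "C {} {} = 1"
    and C_sym: "\<And>\<alpha> \<beta>. \<alpha> \<subseteq> V \<Longrightarrow> \<beta> \<subseteq> V \<Longrightarrow> \<alpha> \<inter> \<beta> = {} \<Longrightarrow> card \<alpha> \<le> k \<Longrightarrow> card \<beta> \<le> k \<Longrightarrow>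
      1 \<le> card \<alpha> + card \<beta> \<Longrightarrow> card \<alpha> + card \<beta> \<le> n \<Longrightarrow> C \<alpha> \<beta> + C \<beta> \<alpha> = pair_coboundary C \<alpha> \<beta>"
begin

lemma sum_symmetrized:
  assumes "insert x X \<subseteq> V" "x \<notin> X" "Suc a \<le> k" "b \<le> k" "Suc a + b \<le> n"
  shows "(\<Sum>(\<alpha>, \<beta>)\<in>disjoint_pairs X a b. C (insert x \<alpha>) \<beta>) +
      (\<Sum>(\<alpha>, \<beta>)\<in>disjoint_pairs X b a. C \<alpha> (insert x \<beta>)) =
    (\<Sum>(\<alpha>, \<beta>)\<in>disjoint_pairs X a b. pair_coboundary C (insert x \<alpha>) \<beta>)"
proof -
  have fin: "finite \<alpha>" if "\<alpha> \<subseteq> V" for \<alpha> using that finV finite_subset by blast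
  have "(\<Sum>(\<alpha>, \<beta>)\<in>disjoint_pairs X a b. C (insert x \<alpha>) \<beta>) +
      (\<Sum>(\<alpha>, \<beta>)\<in>disjoint_pairs X b a. C \<alpha> (insert x \<beta>)) =
      (\<Sum>(\<alpha>, \<beta>)\<in>disjoint_pairs X a b. C (insert x \<alpha>) \<beta> + C \<beta> (insert x \<alpha>))"
    by (subst (2) sum_disjoint_pairs_swap) (simp add: sum.distrib split_def)
  also have "\<dots> = (\<Sum>(\<alpha>, \<beta>)\<in>disjoint_pairs X a b. pair_coboundary C (insert x \<alpha>) \<beta>)"
  proof (intro sum.cong refl, clarify)
    fix \<alpha> \<beta> assume "(\<alpha>, \<beta>) \<in> disjoint_pairs X a b"
    then have ab: "\<alpha> \<subseteq> X" "\<beta> \<subseteq> X" "\<alpha> \<inter> \<beta> = {}" "card \<alpha> = a" "card \<beta> = b"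
      by (auto simp: disjoint_pairs_def)
    then have "card (insert x \<alpha>) = Suc a" using assms fin[of \<alpha>] by (subst card_insert_disjoint) auto
    then show "C (insert x \<alpha>) \<beta> + C \<beta> (insert x \<alpha>) = pair_coboundary C (insert x \<alpha>) \<beta>"
      using ab assms by (intro C_sym) auto
  qed
  finally show ?thesis .
qed

text \<open>A pair of sizes \<open>m - 1\<close> and \<open>m\<close> leaves two vertices of
  \<open>X\<close> free, so facets that keep \<open>x\<close> occur twice and cancel. Only those
  without \<open>x\<close> survive.\<close>

lemma sum_symmetrized_balanced:
  assumes "insert x X \<subseteq> V" "x \<notin> X" "card X = 2 * m + 1" "Suc m \<le> k" "2 * m + 1 \<le> n"
  shows "(\<Sum>(\<alpha>, \<beta>)\<in>disjoint_pairs X m m. C (insert x \<alpha>) \<beta>) +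
      (\<Sum>(\<alpha>, \<beta>)\<in>disjoint_pairs X m m. C \<alpha> (insert x \<beta>)) = (\<Sum>(\<alpha>, \<beta>)\<in>disjoint_pairs X m m. C \<alpha> \<beta>)"
proof -
  have fin: "finite X" using assms(1) finite_subset[OF _ finV, of X] by simp
  have 2: "int (card X) - int m - int m + 1 = 2" using assms(3) by simp
  have "(\<Sum>(\<alpha>, \<beta>)\<in>disjoint_pairs X m m. C (insert x \<alpha>) \<beta>) +
      (\<Sum>(\<alpha>, \<beta>)\<in>disjoint_pairs X m m. C \<alpha> (insert x \<beta>)) =
      (\<Sum>(\<alpha>, \<beta>)\<in>disjoint_pairs X m m. pair_coboundary C (insert x \<alpha>) \<beta>)"
    using assms by (intro sum_symmetrized) auto
  then show ?thesis
    by (simp only: sum_pair_coboundary_insert[OF fin assms(2)] 2) simp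
qed

text \<open>When the first sum is split by the position of \<open>y\<close> and the second is
  expanded, two partial sums occur twice. What is left are the balanced pairs with \<open>y\<close>
  added on one side or the other.\<close>

lemma sum_unbalanced:
  assumes "insert y Y \<subseteq> V" "y \<notin> Y" "card Y = 2 * m + 1" "Suc m \<le> k" "2 * m + 1 \<le> n"
  shows "(\<Sum>(\<alpha>, \<beta>)\<in>disjoint_pairs (insert y Y) m (m + 1). C \<alpha> \<beta>) +
      (\<Sum>(\<alpha>, \<beta>)\<in>disjoint_pairs Y m (m + 1). pair_coboundary C (insert y \<alpha>) \<beta>) =
    (\<Sum>(\<alpha>, \<beta>)\<in>disjoint_pairs Y m m. C \<alpha> \<beta>)"
proof -
  have fin: "finite Y" using assms(1) finite_subset[OF _ finV, of Y] by simp
  have comb: "(p + q + r) + (r + (p + s)) = s + q" for p q r s :: bit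
    by (cases p; cases q; cases r; cases s) simp_all
  have 1: "int (card Y) - int m - int (m + 1) + 1 = 1" "int (m + 1) - 1 = int m" using assms(3) by simp_all
  show ?thesis
    unfolding sum_symmetrized_balanced[OF assms, symmetric] sum_disjoint_pairs_insert[OF fin assms(2)]
      sum_pair_coboundary_insert[OF fin assms(2)] 1 of_int_1 mult_1_left
    by (rule comb)
qed

text \<open>The induction descends two dimensions of the deleted join at once. The part of the cycle
  through \<open>x\<close> and the part avoiding \<open>x\<close> are each turned into coboundaries,
  and \<open>sum_unbalanced\<close> merges the results into the chain of the smaller
  \<open>m\<close> on \<open>Y\<close>.\<close>

lemma sum_balanced_eq_1:
  assumes "X \<subseteq> V" "card X = 2 * m + 1" "m \<le> k" "2 * m \<le> n"
  shows "(\<Sum>(\<alpha>, \<beta>)\<in>disjoint_pairs X m m. C \<alpha> \<beta>) = 1"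
  using assms
proof (induction m arbitrary: X)
  case 0
  have "finite \<alpha>" if "\<alpha> \<subseteq> X" for \<alpha> using that 0(1) finV by (meson finite_subset)
  then have "disjoint_pairs X (int 0) (int 0) = {({}, {})}" by (auto simp: disjoint_pairs_def)
  then show ?case using C_empty by simp
next
  case (Suc m)
  obtain x X1 where X: "X = insert x X1" "x \<notin> X1" "card X1 = 2 * m + 2"
    using Suc.prems(2) card_Suc_eq[of X "2 * m + 2"] by auto
  obtain y Y where X1: "X1 = insert y Y" "y \<notin> Y" "card Y = 2 * m + 1"
    using X(3) card_Suc_eq[of X1 "2 * m + 1"] by auto
  have fin: "finite X1" "finite Y" using X X1 Suc.prems(1) finite_subset[OF _ finV, of X1] by auto
  \<comment> \<open>Without \<open>x\<close>, a pair of sets of size \<open>m + 1\<close> exhausts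
    \<open>X1\<close>; hence every such pair contains \<open>y\<close>.\<close>
  have c: "disjoint_pairs Y (m + 1) (m + 1) = {}"
  proof -
    have False if "(\<alpha>, \<beta>) \<in> disjoint_pairs Y (m + 1) (m + 1)" for \<alpha> \<beta>
    proof -
      have ab: "\<alpha> \<subseteq> Y" "\<beta> \<subseteq> Y" "\<alpha> \<inter> \<beta> = {}" "card \<alpha> = m + 1" "card \<beta> = m + 1"
        using that by (auto simp: disjoint_pairs_def)
      then have "card (\<alpha> \<union> \<beta>) = 2 * m + 2" using fin by (subst card_Un_disjoint) (auto intro: finite_subset)
      moreover have "card (\<alpha> \<union> \<beta>) \<le> card Y" using ab fin by (intro card_mono) auto
      ultimately show False using X1 by simp
    qed
    then show ?thesis by auto
  qed
  have Suc1: "int (m + 1) - 1 = int m" by simp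
  have two: "int (card X1) - int m - int (m + 1) + 1 = 2" using X(3) by simp
  have sym: "(\<Sum>(\<alpha>, \<beta>)\<in>disjoint_pairs Z m (m + 1). C (insert z \<alpha>) \<beta>) +
      (\<Sum>(\<alpha>, \<beta>)\<in>disjoint_pairs Z (m + 1) m. C \<alpha> (insert z \<beta>)) =
    (\<Sum>(\<alpha>, \<beta>)\<in>disjoint_pairs Z m (m + 1). pair_coboundary C (insert z \<alpha>) \<beta>)"
    if "insert z Z \<subseteq> V" "z \<notin> Z" for z Z
    using sum_symmetrized[OF that, of m "m + 1"] Suc.prems by (simp add: add.commute)
  have "(\<Sum>(\<alpha>, \<beta>)\<in>disjoint_pairs X (Suc m) (Suc m). C \<alpha> \<beta>) =
      (\<Sum>(\<alpha>, \<beta>)\<in>disjoint_pairs X1 m (m + 1). pair_coboundary C (insert x \<alpha>) \<beta>) +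
      (\<Sum>(\<alpha>, \<beta>)\<in>disjoint_pairs X1 (m + 1) (m + 1). C \<alpha> \<beta>)"
    using sym[of x X1] X Suc.prems(1)
    unfolding X(1) sum_disjoint_pairs_insert[OF fin(1) X(2)] Suc1 Suc_eq_plus1 by simp
  also have "(\<Sum>(\<alpha>, \<beta>)\<in>disjoint_pairs X1 (m + 1) (m + 1). C \<alpha> \<beta>) =
      (\<Sum>(\<alpha>, \<beta>)\<in>disjoint_pairs Y m (m + 1). pair_coboundary C (insert y \<alpha>) \<beta>)"
    using sym[of y Y] X X1 Suc.prems(1)
    unfolding X1(1) sum_disjoint_pairs_insert[OF fin(2) X1(2)] Suc1 c by simp
  also have "(\<Sum>(\<alpha>, \<beta>)\<in>disjoint_pairs X1 m (m + 1). pair_coboundary C (insert x \<alpha>) \<beta>) =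
      (\<Sum>(\<alpha>, \<beta>)\<in>disjoint_pairs X1 m (m + 1). C \<alpha> \<beta>)"
    unfolding sum_pair_coboundary_insert[OF fin(1) X(2)] two by simp
  also have "(\<Sum>(\<alpha>, \<beta>)\<in>disjoint_pairs X1 m (m + 1). C \<alpha> \<beta>) +
      (\<Sum>(\<alpha>, \<beta>)\<in>disjoint_pairs Y m (m + 1). pair_coboundary C (insert y \<alpha>) \<beta>) =
      (\<Sum>(\<alpha>, \<beta>)\<in>disjoint_pairs Y m m. C \<alpha> \<beta>)"
    unfolding X1(1) using X X1 Suc.prems by (intro sum_unbalanced) auto
  also have "\<dots> = 1" using X X1 Suc.prems by (intro Suc.IH) auto
  finally show ?case .
qed

text \<open>The cocycle condition, summed over pairs that exhaust the \<open>n + 1\<close> vertices,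
  trades sizes \<open>(a, b - 1)\<close> for \<open>(a - 1, b)\<close> without changing the sum.
  This is repeated until the sizes differ by at most one.\<close>

lemma sum_top_eq_1:
  assumes cardV: "card V = n + 1" and lk: "l \<le> k" and n: "n = k + l"
    and top: "\<And>\<alpha> \<beta>. \<alpha> \<subseteq> V \<Longrightarrow> \<beta> \<subseteq> V \<Longrightarrow> \<alpha> \<inter> \<beta> = {} \<Longrightarrow> card \<alpha> \<le> k \<Longrightarrow> card \<beta> \<le> k \<Longrightarrow>
      card \<alpha> + card \<beta> = n + 1 \<Longrightarrow> pair_coboundary C \<alpha> \<beta> = 0"
  shows "(\<Sum>(\<alpha>, \<beta>)\<in>disjoint_pairs V k l. C \<alpha> \<beta>) = 1"
proof -
  have shift: "(\<Sum>(\<alpha>, \<beta>)\<in>disjoint_pairs V (k - i) (l + i). C \<alpha> \<beta>) = (\<Sum>(\<alpha>, \<beta>)\<in>disjoint_pairs V k l. C \<alpha> \<beta>)"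
    if "i \<le> k - l" for i using that
  proof (induction i)
    case (Suc i)
    define a b where "a = k - i" and "b = l + Suc i"
    have ab: "a \<le> k" "b \<le> k" "a + b = n + 1" "a \<ge> 1" "b \<ge> 1"
      using Suc.prems lk n by (auto simp: a_def b_def)
    have "0 = (\<Sum>(\<alpha>, \<beta>)\<in>disjoint_pairs V a b. pair_coboundary C \<alpha> \<beta>)"
      by (rule sum.neutral[symmetric]) (use ab in \<open>auto simp: disjoint_pairs_def intro!: top\<close>)
    also have "\<dots> = (\<Sum>(\<alpha>, \<beta>)\<in>disjoint_pairs V a b. \<Sum>e\<in>\<alpha>. C (\<alpha> - {e}) \<beta>) +
        (\<Sum>(\<alpha>, \<beta>)\<in>disjoint_pairs V a b. \<Sum>e\<in>\<beta>. C \<alpha> (\<beta> - {e}))"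
      by (simp add: pair_coboundary_def sum.distrib split_def)
    also have "\<dots> = (\<Sum>(\<alpha>, \<beta>)\<in>disjoint_pairs V (int a - 1) b. C \<alpha> \<beta>) +
        (\<Sum>(\<alpha>, \<beta>)\<in>disjoint_pairs V a (int b - 1). C \<alpha> \<beta>)"
    proof -
      have "int (card V) - int a - int b + 1 = 1" using ab cardV by linarith
      then show ?thesis
        by (simp only: sum_disjoint_pairs_remove_fst[OF finV] sum_disjoint_pairs_remove_snd[OF finV]) simp
    qed
    also have "int a - 1 = int (k - Suc i)" using Suc.prems by (simp add: a_def)
    also have "int b - 1 = int (l + i)" by (simp add: b_def)
    finally have "(\<Sum>(\<alpha>, \<beta>)\<in>disjoint_pairs V (k - Suc i) (l + Suc i). C \<alpha> \<beta>) =
        (\<Sum>(\<alpha>, \<beta>)\<in>disjoint_pairs V (k - i) (l + i). C \<alpha> \<beta>)"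
      unfolding a_def b_def
      by (cases "\<Sum>(\<alpha>, \<beta>)\<in>disjoint_pairs V (k - Suc i) (l + Suc i). C \<alpha> \<beta>";
          cases "\<Sum>(\<alpha>, \<beta>)\<in>disjoint_pairs V (k - i) (l + i). C \<alpha> \<beta>") simp_all
    then show ?case using Suc by simp
  qed simp
  show ?thesis
  proof (cases "even n")
    case True
    then obtain m where m: "n = 2 * m" by (elim evenE)
    then have "k - (k - m) = m" "l + (k - m) = m" "k - m \<le> k - l" using n lk by auto
    then have "(\<Sum>(\<alpha>, \<beta>)\<in>disjoint_pairs V k l. C \<alpha> \<beta>) = (\<Sum>(\<alpha>, \<beta>)\<in>disjoint_pairs V m m. C \<alpha> \<beta>)"
      using shift[of "k - m"] by simp
    also have "\<dots> = 1" using m cardV n lk by (intro sum_balanced_eq_1) auto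
    finally show ?thesis .
  next
    case False
    then obtain m where m: "n = 2 * m + 1" by (elim oddE)
    then have mk: "k - (k - m) = m" "l + (k - m) = m + 1" "k - m \<le> k - l" "Suc m \<le> k"
      using n lk by auto
    \<comment> \<open>For odd \<open>n\<close> one more vertex is split off. The coboundary term in
      \<open>sum_unbalanced\<close> then runs over pairs that exhaust \<open>V\<close>, where the
      cocycle condition annihilates it.\<close>
    obtain y Y where Y: "V = insert y Y" "y \<notin> Y" "card Y = 2 * m + 1"
      using cardV m card_Suc_eq[of V "2 * m + 1"] by auto
    have "(\<Sum>(\<alpha>, \<beta>)\<in>disjoint_pairs Y m (m + 1). pair_coboundary C (insert y \<alpha>) \<beta>) = 0"
    proof (rule sum.neutral, clarify)
      fix \<alpha> \<beta> assume "(\<alpha>, \<beta>) \<in> disjoint_pairs Y m (m + 1)"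
      then have ab: "\<alpha> \<subseteq> Y" "\<beta> \<subseteq> Y" "\<alpha> \<inter> \<beta> = {}" "card \<alpha> = m" "card \<beta> = m + 1"
        by (auto simp: disjoint_pairs_def)
      then have "card (insert y \<alpha>) = Suc m" using Y finV finite_subset[of \<alpha> V]
        by (subst card_insert_disjoint) auto
      then show "pair_coboundary C (insert y \<alpha>) \<beta> = 0"
        using ab Y mk m by (intro top) auto
    qed
    moreover have "(\<Sum>(\<alpha>, \<beta>)\<in>disjoint_pairs V k l. C \<alpha> \<beta>) = (\<Sum>(\<alpha>, \<beta>)\<in>disjoint_pairs V m (m + 1). C \<alpha> \<beta>)"
      using shift[of "k - m"] mk by (simp add: add.commute)
    moreover have "(\<Sum>(\<alpha>, \<beta>)\<in>disjoint_pairs Y m m. C \<alpha> \<beta>) = 1"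
      using Y m mk by (intro sum_balanced_eq_1) auto
    ultimately show ?thesis
      using sum_unbalanced[of y Y m] Y m mk by simp
  qed
qed

end

section \<open>Boundary of a subdivided simplex\<close>

lemma affine_independent_coeffs_unique:
  fixes S :: "'a::real_vector set"
  assumes "finite S" "\<not> affine_dependent S" "sum u S = sum w S"
    "(\<Sum>v\<in>S. u v *\<^sub>R v) = (\<Sum>v\<in>S. w v *\<^sub>R v)" "v \<in> S"
  shows "u v = w v"
proof (rule ccontr)
  assume "u v \<noteq> w v"
  moreover have "sum (\<lambda>v. u v - w v) S = 0" using assms by (simp add: sum_subtractf)
  moreover have "(\<Sum>v\<in>S. (u v - w v) *\<^sub>R v) = 0"
    using assms by (simp add: scaleR_left_diff_distrib sum_subtractf)
  ultimately have "affine_dependent S"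
    unfolding affine_dependent_explicit_finite[OF assms(1)] using assms(5)
    by (intro exI[of _ "\<lambda>v. u v - w v"]) auto
  then show False using assms(2) by simp
qed

text \<open>The relative interior of a simplex. Every point of a complex lies in the interior of
  exactly one simplex, its carrier.\<close>

definition open_simplex :: "'a::real_vector set \<Rightarrow> 'a set" where
  "open_simplex S = {x. \<exists>u. (\<forall>v\<in>S. 0 < u v) \<and> sum u S = 1 \<and> (\<Sum>v\<in>S. u v *\<^sub>R v) = x}"

lemma open_simplex_subset: "finite S \<Longrightarrow> open_simplex S \<subseteq> convex hull S"
  by (auto simp: open_simplex_def convex_hull_finite intro: less_imp_le)

lemma convex_hull_open_simplex:
  assumes "finite S" "x \<in> convex hull S"
  shows "\<exists>R. R \<subseteq> S \<and> R \<noteq> {} \<and> x \<in> open_simplex R"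
proof -
  obtain u where u: "\<forall>v\<in>S. 0 \<le> u v" "sum u S = 1" "(\<Sum>v\<in>S. u v *\<^sub>R v) = x"
    using assms by (auto simp: convex_hull_finite)
  define R where "R = {v\<in>S. u v \<noteq> 0}"
  have "sum u R = sum u S" unfolding R_def using assms(1) by (intro sum.mono_neutral_left) auto
  moreover have "(\<Sum>v\<in>R. u v *\<^sub>R v) = (\<Sum>v\<in>S. u v *\<^sub>R v)"
    unfolding R_def using assms(1) by (intro sum.mono_neutral_left) auto
  moreover have "\<forall>v\<in>R. 0 < u v" using u(1) by (force simp: R_def)
  ultimately have "x \<in> open_simplex R" unfolding open_simplex_def using u by auto
  moreover have "R \<noteq> {}" using \<open>sum u R = sum u S\<close> u(2) by auto
  ultimately show ?thesis by (intro exI[of _ R]) (auto simp: R_def)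
qed

lemma open_simplex_face:
  assumes "finite S" "\<not> affine_dependent S" "x \<in> open_simplex S" "R \<subseteq> S" "x \<in> convex hull R"
  shows "R = S"
proof -
  have "finite R" using assms finite_subset by metis
  obtain u where u: "\<forall>v\<in>S. 0 < u v" "sum u S = 1" "(\<Sum>v\<in>S. u v *\<^sub>R v) = x"
    using assms(3) by (auto simp: open_simplex_def)
  obtain w where w: "sum w R = 1" "(\<Sum>v\<in>R. w v *\<^sub>R v) = x"
    using assms(5) \<open>finite R\<close> by (auto simp: convex_hull_finite)
  define w' where "w' = (\<lambda>v. if v \<in> R then w v else 0)"
  have "sum w' S = sum w R"
    unfolding w'_def using assms by (intro sum.mono_neutral_cong_right) auto
  moreover have "(\<Sum>v\<in>S. w' v *\<^sub>R v) = (\<Sum>v\<in>R. w v *\<^sub>R v)"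
    unfolding w'_def using assms by (intro sum.mono_neutral_cong_right) auto
  ultimately have "u v = w' v" if "v \<in> S" for v
    using affine_independent_coeffs_unique[OF assms(1,2), of u w'] u w that by simp
  then have "v \<in> R" if "v \<in> S" for v
    using u(1) that by (metis less_irrefl w'_def)
  then show ?thesis using assms(4) by auto
qed

lemma geometric_complexD:
  assumes "geometric_complex K"
  shows "finite K"
    "\<sigma> \<in> K \<Longrightarrow> finite \<sigma>" "\<sigma> \<in> K \<Longrightarrow> \<sigma> \<noteq> {}" "\<sigma> \<in> K \<Longrightarrow> \<not> affine_dependent \<sigma>"
    "\<sigma> \<in> K \<Longrightarrow> \<tau> \<subseteq> \<sigma> \<Longrightarrow> \<tau> \<noteq> {} \<Longrightarrow> \<tau> \<in> K"
    "\<sigma> \<in> K \<Longrightarrow> \<tau> \<in> K \<Longrightarrow> convex hull \<sigma> \<inter> convex hull \<tau> = convex hull (\<sigma> \<inter> \<tau>)"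
  using assms unfolding geometric_complex_def by blast+

lemma open_simplex_subset_face:
  assumes "geometric_complex K" "\<rho> \<in> K" "\<sigma> \<in> K" "x \<in> open_simplex \<rho>" "x \<in> convex hull \<sigma>"
  shows "\<rho> \<subseteq> \<sigma>"
proof -
  note K = geometric_complexD[OF assms(1)]
  have "x \<in> convex hull \<rho>" using open_simplex_subset[of \<rho>] K(2) assms by auto
  then have "x \<in> convex hull (\<rho> \<inter> \<sigma>)" using K(6)[of \<rho> \<sigma>] assms by auto
  then have "\<rho> \<inter> \<sigma> = \<rho>" using K assms by (intro open_simplex_face[of \<rho> x]) auto
  then show ?thesis by auto
qed

text \<open>Faces of a simplex are extreme: a coordinate outside \<open>\<beta>\<close> vanishes at
  \<open>x\<close>, where it is a strictly positive combination of its nonnegative values at the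
  vertices of \<open>\<sigma>\<close>, so it vanishes at each of them.\<close>

lemma convex_face_contains_vertices:
  assumes \<alpha>: "finite \<alpha>" "\<not> affine_dependent \<alpha>" and \<sigma>: "finite \<sigma>" "\<sigma> \<subseteq> convex hull \<alpha>"
    and x: "x \<in> open_simplex \<sigma>" "x \<in> convex hull \<beta>" and \<beta>: "\<beta> \<subseteq> \<alpha>"
  shows "\<sigma> \<subseteq> convex hull \<beta>"
proof
  fix v assume v: "v \<in> \<sigma>"
  have fin\<beta>: "finite \<beta>" using \<alpha>(1) \<beta> finite_subset by metis
  have "\<forall>v\<in>\<sigma>. \<exists>l. (\<forall>e\<in>\<alpha>. 0 \<le> l e) \<and> sum l \<alpha> = 1 \<and> (\<Sum>e\<in>\<alpha>. l e *\<^sub>R e) = v"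
    using \<sigma>(2) \<alpha>(1) by (auto simp: convex_hull_finite)
  then obtain L where L: "\<And>v e. v \<in> \<sigma> \<Longrightarrow> e \<in> \<alpha> \<Longrightarrow> 0 \<le> L v e" "\<And>v. v \<in> \<sigma> \<Longrightarrow> sum (L v) \<alpha> = 1"
    "\<And>v. v \<in> \<sigma> \<Longrightarrow> (\<Sum>e\<in>\<alpha>. L v e *\<^sub>R e) = v" by metis
  obtain u where u: "\<forall>v\<in>\<sigma>. 0 < u v" "sum u \<sigma> = 1" "(\<Sum>v\<in>\<sigma>. u v *\<^sub>R v) = x"
    using x(1) by (auto simp: open_simplex_def)
  obtain w where w: "sum w \<beta> = 1" "(\<Sum>e\<in>\<beta>. w e *\<^sub>R e) = x"
    using x(2) fin\<beta> by (auto simp: convex_hull_finite)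
  define w' where "w' = (\<lambda>e. if e \<in> \<beta> then w e else 0)"
  have w': "sum w' \<alpha> = sum w \<beta>" "(\<Sum>e\<in>\<alpha>. w' e *\<^sub>R e) = (\<Sum>e\<in>\<beta>. w e *\<^sub>R e)"
    unfolding w'_def using \<alpha> \<beta> by (intro sum.mono_neutral_cong_right; auto)+
  have "sum (\<lambda>e. \<Sum>v\<in>\<sigma>. u v * L v e) \<alpha> = (\<Sum>v\<in>\<sigma>. u v * sum (L v) \<alpha>)"
    by (subst sum.swap) (simp add: sum_distrib_left)
  also have "\<dots> = 1" using L(2) u(2) by simp
  finally have 1: "sum (\<lambda>e. \<Sum>v\<in>\<sigma>. u v * L v e) \<alpha> = sum w' \<alpha>" using w' w by simp
  have "(\<Sum>e\<in>\<alpha>. (\<Sum>v\<in>\<sigma>. u v * L v e) *\<^sub>R e) = (\<Sum>e\<in>\<alpha>. \<Sum>v\<in>\<sigma>. u v *\<^sub>R L v e *\<^sub>R e)"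
    by (simp add: scaleR_sum_left)
  also have "\<dots> = (\<Sum>v\<in>\<sigma>. u v *\<^sub>R (\<Sum>e\<in>\<alpha>. L v e *\<^sub>R e))"
    by (subst sum.swap) (simp add: scaleR_sum_right)
  also have "\<dots> = (\<Sum>v\<in>\<sigma>. u v *\<^sub>R v)" using L(3) by (intro sum.cong) auto
  also have "\<dots> = (\<Sum>e\<in>\<alpha>. w' e *\<^sub>R e)" using u w w' by simp
  finally have 2: "(\<Sum>e\<in>\<alpha>. (\<Sum>v\<in>\<sigma>. u v * L v e) *\<^sub>R e) = (\<Sum>e\<in>\<alpha>. w' e *\<^sub>R e)" .
  have zero: "L v e = 0" if e: "e \<in> \<alpha> - \<beta>" for e
  proof -
    have "(\<Sum>v\<in>\<sigma>. u v * L v e) = 0"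
      using affine_independent_coeffs_unique[OF \<alpha> 1 2] e by (simp add: w'_def)
    moreover have "\<forall>v\<in>\<sigma>. 0 \<le> u v * L v e" using u(1) L(1) e by (auto intro: mult_nonneg_nonneg less_imp_le)
    ultimately have "u v * L v e = 0" using \<sigma>(1) v by (subst (asm) sum_nonneg_eq_0_iff) auto
    then show ?thesis using u(1) v by auto
  qed
  have "sum (L v) \<beta> = sum (L v) \<alpha>" "(\<Sum>e\<in>\<beta>. L v e *\<^sub>R e) = (\<Sum>e\<in>\<alpha>. L v e *\<^sub>R e)"
    using \<alpha> \<beta> zero by (intro sum.mono_neutral_left; auto)+
  then show "v \<in> convex hull \<beta>"
    using L v \<beta> fin\<beta> by (auto simp: convex_hull_finite intro!: exI[of _ "L v"])
qed

text \<open>A subdivision also subdivides each face: the carrier of \<open>x\<close> in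
  \<open>A\<close> lies in some simplex of \<open>K\<close>, hence, by extremality, in the face that
  this simplex shares with \<open>\<alpha>\<close>.\<close>

lemma subdivision_carrier:
  assumes K: "geometric_complex K" and A: "subdivision A K" and \<alpha>: "\<alpha> \<in> K" and x: "x \<in> convex hull \<alpha>"
  obtains \<rho> where "\<rho> \<in> A" "\<rho> \<subseteq> convex hull \<alpha>" "x \<in> open_simplex \<rho>"
proof -
  note KD = geometric_complexD[OF K]
  have gA: "geometric_complex A" and bd: "body A = body K"
    and sub: "\<forall>\<sigma>\<in>A. \<exists>\<tau>\<in>K. convex hull \<sigma> \<subseteq> convex hull \<tau>"
    using A unfolding subdivision_def by auto
  note AD = geometric_complexD[OF gA]
  have "x \<in> body A" unfolding bd using \<alpha> x by (auto simp: body_def)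
  then obtain \<sigma> where \<sigma>: "\<sigma> \<in> A" "x \<in> convex hull \<sigma>" by (auto simp: body_def)
  then obtain \<rho> where \<rho>: "\<rho> \<subseteq> \<sigma>" "\<rho> \<noteq> {}" "x \<in> open_simplex \<rho>"
    using convex_hull_open_simplex AD(2) by metis
  then have "\<rho> \<in> A" using AD(5) \<sigma> by auto
  then obtain \<tau> where \<tau>: "\<tau> \<in> K" "convex hull \<rho> \<subseteq> convex hull \<tau>" using sub by auto
  have f\<rho>: "finite \<rho>" using AD(2) \<open>\<rho> \<in> A\<close> .
  have x\<tau>: "x \<in> convex hull (\<tau> \<inter> \<alpha>)"
    using KD(6)[OF \<tau>(1) \<alpha>] \<tau>(2) x open_simplex_subset[OF f\<rho>] \<rho>(3) by auto
  have "\<rho> \<subseteq> convex hull (\<tau> \<inter> \<alpha>)"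
  proof (rule convex_face_contains_vertices[OF KD(2)[OF \<tau>(1)] KD(4)[OF \<tau>(1)] f\<rho> _ \<rho>(3) x\<tau>])
    show "\<rho> \<subseteq> convex hull \<tau>" using hull_subset[of \<rho> convex] \<tau>(2) by (rule order_trans)
  qed auto
  also have "\<dots> \<subseteq> convex hull \<alpha>" by (intro hull_mono) auto
  finally show ?thesis using that \<open>\<rho> \<in> A\<close> \<rho>(3) by auto
qed

section \<open>Barycentric coordinates in one simplex\<close>

context
  fixes \<alpha> :: "'a::real_normed_vector set" and L :: "'a \<Rightarrow> 'a \<Rightarrow> real"
  assumes fin_\<alpha>: "finite \<alpha>" and indep_\<alpha>: "\<not> affine_dependent \<alpha>"
    and L_nonneg: "\<And>x e. x \<in> convex hull \<alpha> \<Longrightarrow> e \<in> \<alpha> \<Longrightarrow> 0 \<le> L x e"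
    and L_sum: "\<And>x. x \<in> convex hull \<alpha> \<Longrightarrow> sum (L x) \<alpha> = 1"
    and L_eq: "\<And>x. x \<in> convex hull \<alpha> \<Longrightarrow> (\<Sum>e\<in>\<alpha>. L x e *\<^sub>R e) = x"
begin

lemma coords_unique:
  assumes "sum c \<alpha> = 1" "(\<Sum>e\<in>\<alpha>. c e *\<^sub>R e) = x" "x \<in> convex hull \<alpha>" "e \<in> \<alpha>"
  shows "L x e = c e"
  using affine_independent_coeffs_unique[OF fin_\<alpha> indep_\<alpha>, of "L x" c e] assms L_sum L_eq by simp

lemma coords_vertex:
  assumes "e \<in> \<alpha>" "i \<in> \<alpha>"
  shows "L e i = (if i = e then 1 else 0)"
  using assms fin_\<alpha> hull_inc[of e \<alpha> convex]
  by (intro coords_unique) (auto simp: if_distrib[of "\<lambda>c. c *\<^sub>R _"] cong: if_cong)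

lemma coords_comb:
  assumes "finite X" "X \<subseteq> convex hull \<alpha>" "\<forall>v\<in>X. 0 \<le> u v" "sum u X = 1" "e \<in> \<alpha>"
  shows "L (\<Sum>v\<in>X. u v *\<^sub>R v) e = (\<Sum>v\<in>X. u v * L v e)"
proof (rule coords_unique)
  have "(\<Sum>e\<in>\<alpha>. \<Sum>v\<in>X. u v * L v e) = (\<Sum>v\<in>X. u v * sum (L v) \<alpha>)"
    by (subst sum.swap) (simp add: sum_distrib_left)
  also have "\<dots> = (\<Sum>v\<in>X. u v)" using L_sum assms(2) by (intro sum.cong) auto
  finally show "(\<Sum>e\<in>\<alpha>. \<Sum>v\<in>X. u v * L v e) = 1" using assms(4) by simp
  have "(\<Sum>e\<in>\<alpha>. (\<Sum>v\<in>X. u v * L v e) *\<^sub>R e) = (\<Sum>e\<in>\<alpha>. \<Sum>v\<in>X. u v *\<^sub>R L v e *\<^sub>R e)"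
    by (simp add: scaleR_sum_left)
  also have "\<dots> = (\<Sum>v\<in>X. u v *\<^sub>R (\<Sum>e\<in>\<alpha>. L v e *\<^sub>R e))"
    by (subst sum.swap) (simp add: scaleR_sum_right)
  also have "\<dots> = (\<Sum>v\<in>X. u v *\<^sub>R v)" using L_eq assms(2) by (intro sum.cong) auto
  finally show "(\<Sum>e\<in>\<alpha>. (\<Sum>v\<in>X. u v * L v e) *\<^sub>R e) = (\<Sum>v\<in>X. u v *\<^sub>R v)" .
  show "(\<Sum>v\<in>X. u v *\<^sub>R v) \<in> convex hull \<alpha>"
    using assms by (intro convex_sum convex_convex_hull) auto
qed (fact assms)

lemma coords_relation:
  assumes "X \<subseteq> convex hull \<alpha>" "\<forall>e\<in>\<alpha>. (\<Sum>v\<in>X. c v * L v e) = 0"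
  shows "sum c X = 0" "(\<Sum>v\<in>X. c v *\<^sub>R v) = 0"
proof -
  have "sum c X = (\<Sum>v\<in>X. c v * sum (L v) \<alpha>)" using L_sum assms(1) by (intro sum.cong) auto
  also have "\<dots> = (\<Sum>e\<in>\<alpha>. \<Sum>v\<in>X. c v * L v e)"
    by (subst sum.swap) (simp add: sum_distrib_left)
  finally show "sum c X = 0" using assms(2) by simp
  have "(\<Sum>v\<in>X. c v *\<^sub>R v) = (\<Sum>v\<in>X. c v *\<^sub>R (\<Sum>e\<in>\<alpha>. L v e *\<^sub>R e))"
    using L_eq assms(1) by (intro sum.cong) auto
  also have "\<dots> = (\<Sum>v\<in>X. \<Sum>e\<in>\<alpha>. (c v * L v e) *\<^sub>R e)" by (simp add: scaleR_sum_right)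
  also have "\<dots> = (\<Sum>e\<in>\<alpha>. \<Sum>v\<in>X. (c v * L v e) *\<^sub>R e)" by (rule sum.swap)
  also have "\<dots> = (\<Sum>e\<in>\<alpha>. (\<Sum>v\<in>X. c v * L v e) *\<^sub>R e)" by (simp add: scaleR_sum_left)
  finally show "(\<Sum>v\<in>X. c v *\<^sub>R v) = 0" using assms(2) by simp
qed

lemma coords_relation_trivial:
  assumes "finite X" "X \<subseteq> convex hull \<alpha>" "\<not> affine_dependent X"
    "\<forall>e\<in>\<alpha>. (\<Sum>v\<in>X. c v * L v e) = 0"
  shows "\<forall>v\<in>X. c v = 0"
  using coords_relation[OF assms(2,4)] assms(3)
  unfolding affine_dependent_explicit_finite[OF assms(1)] by blast

text \<open>\<open>P\<close> carries linear relations that all combinations of \<open>X\<close>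
  satisfy. If \<open>X\<close> were larger than \<open>R\<close>, some nontrivial combination would
  be killed by \<open>R\<close>, hence by all coordinates, against affine independence.\<close>

lemma card_le_of_functionals:
  assumes X: "finite X" "X \<subseteq> convex hull \<alpha>" "\<not> affine_dependent X"
    and R: "R \<subseteq> \<alpha>" and det: "\<And>y. \<forall>e\<in>R. y e = 0 \<Longrightarrow> P y \<Longrightarrow> \<forall>e\<in>\<alpha>. y e = (0::real)"
    and P: "\<And>c. P (\<lambda>e. \<Sum>v\<in>X. c v * L v e)"
  shows "card X \<le> card R"
proof (rule ccontr)
  assume "\<not> card X \<le> card R"
  then obtain c where c: "\<exists>v\<in>X. c v \<noteq> 0" "\<forall>e\<in>R. (\<Sum>v\<in>X. c v * L v e) = 0"
    using homogeneous_system_nontrivial[of R X "\<lambda>e v. L v e"] X(1) R fin_\<alpha> finite_subset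
    by (metis not_le)
  then show False using coords_relation_trivial[OF X, of c] det[OF c(2) P] by blast
qed

text \<open>The affine function with vertex values \<open>w\<close>; it will define the hyperplane
  through a simplex of codimension one.\<close>

definition lin :: "('a \<Rightarrow> real) \<Rightarrow> 'a \<Rightarrow> real" where
  "lin w x = (\<Sum>e\<in>\<alpha>. w e * L x e)"

lemma lin_comb:
  assumes "finite X" "X \<subseteq> convex hull \<alpha>" "\<forall>v\<in>X. 0 \<le> u v" "sum u X = 1"
  shows "lin w (\<Sum>v\<in>X. u v *\<^sub>R v) = (\<Sum>v\<in>X. u v * lin w v)"
proof -
  have "lin w (\<Sum>v\<in>X. u v *\<^sub>R v) = (\<Sum>e\<in>\<alpha>. \<Sum>v\<in>X. w e * (u v * L v e))"
    unfolding lin_def using coords_comb[OF assms] by (intro sum.cong) (auto simp: sum_distrib_left)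
  also have "\<dots> = (\<Sum>v\<in>X. u v * lin w v)"
    unfolding lin_def by (subst sum.swap) (simp add: sum_distrib_left mult_ac)
  finally show ?thesis .
qed

lemma lin_relation: "(\<Sum>e\<in>\<alpha>. w e * (\<Sum>v\<in>X. c v * L v e)) = (\<Sum>v\<in>X. c v * lin w v)"
  unfolding lin_def by (simp add: sum_distrib_left, subst sum.swap) (simp add: mult_ac)

lemma lin_vertex: "e \<in> \<alpha> \<Longrightarrow> lin w e = w e"
  unfolding lin_def using fin_\<alpha> by (simp add: coords_vertex if_distrib[of "\<lambda>c. _ * c"] cong: if_cong)

text \<open>On the hyperplane the coordinate \<open>i\<close> is determined by the others because
  \<open>w i \<noteq> 0\<close>, which saves one functional.\<close>

lemma card_le_hyperplane:
  assumes X: "finite X" "X \<subseteq> convex hull \<alpha>" "\<not> affine_dependent X"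
    and w: "\<forall>v\<in>X. lin w v = 0" "i \<in> \<alpha>" "w i \<noteq> 0"
  shows "card X \<le> card \<alpha> - 1"
proof -
  have "card X \<le> card (\<alpha> - {i})"
  proof (rule card_le_of_functionals[OF X, where P = "\<lambda>y. (\<Sum>e\<in>\<alpha>. w e * y e) = 0"])
    fix y :: "'a \<Rightarrow> real" assume y: "\<forall>e\<in>\<alpha> - {i}. y e = 0" "(\<Sum>e\<in>\<alpha>. w e * y e) = 0"
    have "(\<Sum>e\<in>\<alpha>. w e * y e) = w i * y i + (\<Sum>e\<in>\<alpha> - {i}. w e * y e)"
      using w(2) fin_\<alpha> by (simp add: sum.remove)
    also have "(\<Sum>e\<in>\<alpha> - {i}. w e * y e) = 0" using y(1) by (intro sum.neutral) auto
    finally show "\<forall>e\<in>\<alpha>. y e = 0" using y w by auto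
  next
    show "(\<Sum>e\<in>\<alpha>. w e * (\<Sum>v\<in>X. c v * L v e)) = 0" for c
      unfolding lin_relation using w(1) by (intro sum.neutral) auto
  qed auto
  then show ?thesis using w(2) fin_\<alpha> by simp
qed

lemma card_le_codim_2:
  assumes X: "finite X" "X \<subseteq> convex hull \<alpha>" "\<not> affine_dependent X"
    and w: "\<forall>v\<in>X. lin w v = 0" "i \<in> \<alpha>" "w i \<noteq> 0" and j: "j \<in> \<alpha>" "j \<noteq> i" "\<forall>v\<in>X. L v j = 0"
  shows "card X \<le> card \<alpha> - 2"
proof -
  have "card X \<le> card (\<alpha> - {i, j})"
  proof (rule card_le_of_functionals[OF X, where P = "\<lambda>y. (\<Sum>e\<in>\<alpha>. w e * y e) = 0 \<and> y j = 0"])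
    fix y :: "'a \<Rightarrow> real" assume y: "\<forall>e\<in>\<alpha> - {i, j}. y e = 0" "(\<Sum>e\<in>\<alpha>. w e * y e) = 0 \<and> y j = 0"
    have "(\<Sum>e\<in>\<alpha>. w e * y e) = w i * y i + (\<Sum>e\<in>\<alpha> - {i}. w e * y e)"
      using w(2) fin_\<alpha> by (simp add: sum.remove)
    also have "(\<Sum>e\<in>\<alpha> - {i}. w e * y e) = 0" using y by (intro sum.neutral) auto
    finally show "\<forall>e\<in>\<alpha>. y e = 0" using y w by auto
  next
    show "(\<Sum>e\<in>\<alpha>. w e * (\<Sum>v\<in>X. c v * L v e)) = 0 \<and> (\<Sum>v\<in>X. c v * L v j) = 0" for c
      unfolding lin_relation using w(1) j by (auto intro!: sum.neutral)
  qed auto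
  moreover have "card (\<alpha> - {i, j}) = card \<alpha> - 2" using w j fin_\<alpha> by (simp add: card_Diff_subset)
  ultimately show ?thesis by simp
qed

lemma card_le_simplex:
  assumes X: "finite X" "X \<subseteq> convex hull \<alpha>" "\<not> affine_dependent X"
  shows "card X \<le> card \<alpha>"
  by (rule card_le_of_functionals[OF X, where P = "\<lambda>_. True"]) auto

section \<open>Cofaces of a codimension-one simplex in a triangulated simplex\<close>

context
  fixes T :: "'a set set" and \<rho> :: "'a set"
  assumes fin_T: "finite T" and T: "\<And>\<sigma>. \<sigma> \<in> T \<Longrightarrow> finite \<sigma>" "\<And>\<sigma>. \<sigma> \<in> T \<Longrightarrow> \<not> affine_dependent \<sigma>"
      "\<And>\<sigma>. \<sigma> \<in> T \<Longrightarrow> \<sigma> \<subseteq> convex hull \<alpha>"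
    and T_Int: "\<And>\<sigma> \<tau>. \<sigma> \<in> T \<Longrightarrow> \<tau> \<in> T \<Longrightarrow> convex hull \<sigma> \<inter> convex hull \<tau> = convex hull (\<sigma> \<inter> \<tau>)"
    and T_cover: "convex hull \<alpha> \<subseteq> (\<Union>\<sigma>\<in>T. convex hull \<sigma>)"
    and \<rho>: "\<rho> \<in> T" "\<rho> \<noteq> {}" "card \<alpha> = Suc (card \<rho>)"
begin

definition barycenter :: 'a where "barycenter = (\<Sum>v\<in>\<rho>. (1 / card \<rho>) *\<^sub>R v)"

lemma card_\<rho>_pos: "0 < card \<rho>" using \<rho> T(1) by (simp add: card_gt_0_iff)

lemma barycenter_open: "barycenter \<in> open_simplex \<rho>"
  unfolding open_simplex_def barycenter_def using card_\<rho>_pos by (auto intro!: exI[of _ "\<lambda>_. 1 / card \<rho>"])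

text \<open>Points on the way from \<open>e\<close> to the barycenter of \<open>\<rho>\<close>
  accumulate there, and infinitely many lie in one simplex of the finite triangulation. Being closed
  it contains the barycenter, hence \<open>\<rho>\<close>, and it has a vertex on the side of
  \<open>e\<close>.\<close>

lemma coface_exists:
  assumes w: "\<forall>v\<in>\<rho>. lin w v = 0" and e: "e \<in> \<alpha>" "0 < w e"
  shows "\<exists>\<sigma>\<in>T. card \<sigma> = card \<alpha> \<and> \<rho> \<subseteq> \<sigma> \<and> (\<exists>a\<in>\<sigma>. 0 < lin w a)"
proof -
  let ?b = barycenter
  define x where "x = (\<lambda>n::nat. (1 - 1 / real (n + 2)) *\<^sub>R ?b + (1 / real (n + 2)) *\<^sub>R e)"
  have f\<rho>: "finite \<rho>" using T(1) \<rho>(1) .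
  have b: "?b \<in> convex hull \<rho>" using barycenter_open open_simplex_subset[OF f\<rho>] by auto
  have b\<alpha>: "?b \<in> convex hull \<alpha>"
    using b T(3)[OF \<rho>(1)] by (meson convex_convex_hull hull_minimal subsetD)
  have e\<alpha>: "e \<in> convex hull \<alpha>" using e(1) by (rule hull_inc)
  have x\<alpha>: "x n \<in> convex hull \<alpha>" for n
    unfolding x_def using b\<alpha> e\<alpha> convex_convex_hull[of \<alpha>] by (intro convexD) auto
  have lin_b: "lin w ?b = 0"
    unfolding barycenter_def using card_\<rho>_pos T(3)[OF \<rho>(1)] f\<rho> w
    by (subst lin_comb) (auto intro!: sum.neutral)
  have lin_x: "lin w (x n) = w e / (n + 2)" for n
  proof -
    have Lx: "L (x n) i = (1 - 1 / real (n + 2)) * L ?b i + (1 / real (n + 2)) * L e i" if "i \<in> \<alpha>" for i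
    proof (rule coords_unique[OF _ _ x\<alpha> that])
      show "(\<Sum>i\<in>\<alpha>. (1 - 1 / real (n + 2)) * L ?b i + (1 / real (n + 2)) * L e i) = 1"
        by (simp add: sum.distrib L_sum[OF b\<alpha>] L_sum[OF e\<alpha>] flip: sum_distrib_left sum_divide_distrib)
      have "(\<Sum>i\<in>\<alpha>. ((1 - 1 / real (n + 2)) * L ?b i + (1 / real (n + 2)) * L e i) *\<^sub>R i) =
          (1 - 1 / real (n + 2)) *\<^sub>R (\<Sum>i\<in>\<alpha>. L ?b i *\<^sub>R i) + (1 / real (n + 2)) *\<^sub>R (\<Sum>i\<in>\<alpha>. L e i *\<^sub>R i)"
        unfolding scaleR_sum_right scaleR_scaleR sum.distrib[symmetric] scaleR_add_left[symmetric] ..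
      then show "(\<Sum>i\<in>\<alpha>. ((1 - 1 / real (n + 2)) * L ?b i + (1 / real (n + 2)) * L e i) *\<^sub>R i) = x n"
        unfolding L_eq[OF b\<alpha>] L_eq[OF e\<alpha>] x_def .
    qed
    have "lin w (x n) = (\<Sum>i\<in>\<alpha>. (1 - 1 / real (n + 2)) * (w i * L ?b i) + (1 / real (n + 2)) * (w i * L e i))"
      unfolding lin_def by (intro sum.cong refl, simp only: Lx) (simp only: distrib_left mult_ac)
    also have "\<dots> = (1 - 1 / real (n + 2)) * lin w ?b + (1 / real (n + 2)) * lin w e"
      unfolding lin_def sum_distrib_left sum.distrib ..
    finally show ?thesis by (simp add: lin_b lin_vertex[OF e(1)])
  qed
  have "\<forall>n\<in>UNIV. \<exists>\<sigma>\<in>T. x n \<in> convex hull \<sigma>" using x\<alpha> T_cover by blast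
  from pigeonhole_infinite_rel[OF infinite_UNIV_nat fin_T this]
  obtain \<sigma> where \<sigma>: "\<sigma> \<in> T" "infinite {n. x n \<in> convex hull \<sigma>}" by auto
  have "x \<longlonglongrightarrow> ?b"
  proof -
    have "(\<lambda>n. 1 / real (n + 2)) \<longlonglongrightarrow> 0" by real_asymp
    then have "x \<longlonglongrightarrow> (1 - 0) *\<^sub>R ?b + 0 *\<^sub>R e"
      unfolding x_def by (intro tendsto_intros)
    then show ?thesis by simp
  qed
  have cl: "closed (convex hull \<sigma>)"
    by (rule compact_imp_closed, rule finite_imp_compact_convex_hull) (rule T(1)[OF \<sigma>(1)])
  have "?b \<in> convex hull \<sigma>"
  proof (rule ccontr)
    assume "?b \<notin> convex hull \<sigma>"
    then have "\<forall>\<^sub>F n in sequentially. x n \<in> - (convex hull \<sigma>)"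
      using topological_tendstoD[OF \<open>x \<longlonglongrightarrow> ?b\<close> open_Compl[OF cl]] by (meson ComplI)
    then obtain N where "\<forall>n\<ge>N. x n \<notin> convex hull \<sigma>" by (auto simp: eventually_sequentially)
    then have "{n. x n \<in> convex hull \<sigma>} \<subseteq> {..<N}" by (auto simp: not_le[symmetric])
    then show False using \<sigma>(2) finite_subset by blast
  qed
  then have "?b \<in> convex hull (\<rho> \<inter> \<sigma>)" using b T_Int[OF \<rho>(1) \<sigma>(1)] by blast
  then have "\<rho> \<inter> \<sigma> = \<rho>"
    using f\<rho> T(2)[OF \<rho>(1)] barycenter_open by (intro open_simplex_face[of \<rho> ?b]) auto
  then have sub: "\<rho> \<subseteq> \<sigma>" by auto
  obtain n where "x n \<in> convex hull \<sigma>" using \<sigma>(2) by (metis (mono_tags) finite.emptyI Collect_empty_eq)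
  then obtain u where u: "\<forall>v\<in>\<sigma>. 0 \<le> u v" "sum u \<sigma> = 1" "(\<Sum>v\<in>\<sigma>. u v *\<^sub>R v) = x n"
    using T(1)[OF \<sigma>(1)] by (auto simp: convex_hull_finite)
  have "(\<Sum>v\<in>\<sigma>. u v * lin w v) = lin w (x n)"
    using lin_comb[OF T(1)[OF \<sigma>(1)] T(3)[OF \<sigma>(1)] u(1,2)] u(3) by simp
  also have "\<dots> > 0" using e by (simp add: lin_x)
  finally have "\<exists>a\<in>\<sigma>. 0 < lin w a"
    using u(1) by (metis (no_types, lifting) mult_nonneg_nonpos not_le sum_nonpos)
  then obtain a where a: "a \<in> \<sigma>" "0 < lin w a" by blast
  then have "a \<notin> \<rho>" using w by auto
  then have "card (insert a \<rho>) = card \<alpha>" using \<rho> f\<rho> by simp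
  moreover have "card (insert a \<rho>) \<le> card \<sigma>" using a sub T(1)[OF \<sigma>(1)] by (intro card_mono) auto
  moreover have "card \<sigma> \<le> card \<alpha>" using T \<sigma> by (intro card_le_simplex) auto
  ultimately show ?thesis using a sub \<sigma> by (intro bexI[of _ \<sigma>]) auto
qed

text \<open>Two cofaces on the same side would overlap near the barycenter of \<open>\<rho>\<close>
  in a point off the hyperplane, whereas they intersect in the hull of their common vertices, which
  is \<open>\<rho>\<close>.\<close>

lemma coface_unique:
  assumes w: "\<forall>v\<in>\<rho>. lin w v = 0"
    and \<sigma>: "\<sigma> \<in> T" "card \<sigma> = card \<alpha>" "\<rho> \<subseteq> \<sigma>" "a \<in> \<sigma>" "0 < lin w a"
    and \<tau>: "\<tau> \<in> T" "card \<tau> = card \<alpha>" "\<rho> \<subseteq> \<tau>" "a' \<in> \<tau>" "0 < lin w a'"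
  shows "\<sigma> = \<tau>"
proof (rule ccontr)
  assume "\<sigma> \<noteq> \<tau>"
  have f\<rho>: "finite \<rho>" using T(1) \<rho>(1) .
  have a\<rho>: "a \<notin> \<rho>" "a' \<notin> \<rho>" using w \<sigma> \<tau> by auto
  have \<sigma>_eq: "\<sigma> = insert a \<rho>"
    using \<sigma> a\<rho> \<rho> f\<rho> T(1)[OF \<sigma>(1)] by (intro card_subset_eq[symmetric]) auto
  have \<tau>_eq: "\<tau> = insert a' \<rho>"
    using \<tau> a\<rho> \<rho> f\<rho> T(1)[OF \<tau>(1)] by (intro card_subset_eq[symmetric]) auto
  have aa': "a \<noteq> a'" using \<sigma>_eq \<tau>_eq \<open>\<sigma> \<noteq> \<tau>\<close> by auto
  define X where "X = insert a (insert a' \<rho>)"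
  have X: "finite X" "X \<subseteq> convex hull \<alpha>" "card X = card \<alpha> + 1"
    using f\<rho> a\<rho> aa' \<rho> T(3)[OF \<sigma>(1)] T(3)[OF \<tau>(1)] \<sigma> \<tau> by (auto simp: X_def)
  have sumX: "(\<Sum>v\<in>X. f v) = f a + (f a' + (\<Sum>v\<in>\<rho>. f v))" for f :: "'a \<Rightarrow> 'b::comm_monoid_add"
    using f\<rho> a\<rho> aa' by (simp add: X_def)
  \<comment> \<open>\<open>X\<close> has one point more than there are coordinates. The resulting
    relation exchanges a small step towards \<open>a'\<close> for a step towards \<open>a\<close>
    and a shift within \<open>\<rho>\<close>.\<close>
  obtain c0 where c0: "\<exists>v\<in>X. c0 v \<noteq> 0" "\<forall>e\<in>\<alpha>. (\<Sum>v\<in>X. c0 v * L v e) = 0"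
    using homogeneous_system_nontrivial[of \<alpha> X "\<lambda>e v. L v e"] X fin_\<alpha> by auto
  define c where "c = (\<lambda>v. (if c0 a \<ge> 0 then 1 else -1) * c0 v)"
  have c: "\<exists>v\<in>X. c v \<noteq> 0" "\<forall>e\<in>\<alpha>. (\<Sum>v\<in>X. c v * L v e) = 0" "c a \<ge> 0"
    using c0 by (auto simp: c_def sum_negf)
  have "0 = (\<Sum>e\<in>\<alpha>. w e * (\<Sum>v\<in>X. c v * L v e))" using c(2) by simp
  also have "\<dots> = (\<Sum>v\<in>X. c v * lin w v)" by (rule lin_relation)
  also have "\<dots> = c a * lin w a + c a' * lin w a'"
    unfolding sumX using w by (simp add: sum.neutral)
  finally have ca': "c a * lin w a + c a' * lin w a' = 0" by simp
  have "c a \<noteq> 0"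
  proof
    assume "c a = 0"
    moreover from this have "c a' = 0" using ca' \<tau> by simp
    ultimately have "\<forall>e\<in>\<alpha>. (\<Sum>v\<in>\<rho>. c v * L v e) = 0" using c(2) by (simp add: sumX)
    then have "\<forall>v\<in>\<rho>. c v = 0" by (rule coords_relation_trivial[OF f\<rho> T(3)[OF \<rho>(1)] T(2)[OF \<rho>(1)]])
    then show False using c(1) \<open>c a = 0\<close> \<open>c a' = 0\<close> by (auto simp: X_def)
  qed
  then have ca: "c a > 0" using c by simp
  then have "c a' * lin w a' < 0" using ca' mult_pos_pos[OF ca \<sigma>(5)] by linarith
  then have ca'_neg: "c a' < 0" using \<tau>(5) by (simp add: mult_less_0_iff)
  note rel0 = coords_relation[OF X(2) c(2)]
  define m where "m = real (card \<rho>)"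
  have m: "m > 0" using card_\<rho>_pos by (simp add: m_def)
  \<comment> \<open>Small enough for the shifted weights \<open>1 / m + \<epsilon> * c v\<close> on
    \<open>\<rho>\<close> to stay nonnegative.\<close>
  define \<epsilon> where "\<epsilon> = 1 / (m * (1 + (\<Sum>v\<in>\<rho>. \<bar>c v\<bar>)))"
  have S0: "0 \<le> (\<Sum>v\<in>\<rho>. \<bar>c v\<bar>)" by (simp add: sum_nonneg)
  have \<epsilon>: "\<epsilon> > 0" using m S0 by (simp add: \<epsilon>_def add_pos_nonneg)
  have \<epsilon>c: "0 \<le> 1 / m + \<epsilon> * c v" if "v \<in> \<rho>" for v
  proof -
    have "\<bar>c v\<bar> \<le> (\<Sum>v\<in>\<rho>. \<bar>c v\<bar>)" using f\<rho> that by (intro member_le_sum) auto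
    then have "\<bar>c v\<bar> \<le> 1 + (\<Sum>v\<in>\<rho>. \<bar>c v\<bar>)" by simp
    then have "\<epsilon> * \<bar>c v\<bar> \<le> \<epsilon> * (1 + (\<Sum>v\<in>\<rho>. \<bar>c v\<bar>))" using \<epsilon> by (intro mult_left_mono) auto
    also have "\<dots> = 1 / m"
    proof -
      have "1 + (\<Sum>v\<in>\<rho>. \<bar>c v\<bar>) \<noteq> 0" using S0 by linarith
      then show ?thesis by (simp add: \<epsilon>_def)
    qed
    finally have "\<epsilon> * \<bar>c v\<bar> \<le> 1 / m" .
    moreover have "\<epsilon> * - c v \<le> \<epsilon> * \<bar>c v\<bar>" using \<epsilon> by (intro mult_left_mono) auto
    ultimately show ?thesis by simp
  qed
  \<comment> \<open>The total weight of \<open>1 / m\<close> on each vertex of \<open>\<rho>\<close>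
    and \<open>- \<epsilon> * c a'\<close> on \<open>a'\<close>. Adding \<open>\<epsilon>\<close>
    times the relation removes \<open>a'\<close> and brings in \<open>a\<close> with the same total,
    so \<open>u\<close> and \<open>u'\<close> describe the same point.\<close>
  define s where "s = 1 + \<epsilon> * (- c a')"
  have \<epsilon>a': "\<epsilon> * c a' < 0" using mult_pos_neg[OF \<epsilon> ca'_neg] .
  then have s: "s > 0" by (simp add: s_def)
  define u where "u = (\<lambda>v. (if v = a' then \<epsilon> * (- c a') else 1 / m) / s)"
  define u' where "u' = (\<lambda>v. (if v = a then \<epsilon> * c a else 1 / m + \<epsilon> * c v) / s)"
  have sum_\<tau>: "(\<Sum>v\<in>\<tau>. f v) = f a' + (\<Sum>v\<in>\<rho>. f v)" and sum_\<sigma>: "(\<Sum>v\<in>\<sigma>. f v) = f a + (\<Sum>v\<in>\<rho>. f v)"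
    for f :: "'a \<Rightarrow> 'b::comm_monoid_add"
    using f\<rho> a\<rho> by (auto simp: \<tau>_eq \<sigma>_eq)
  have u_\<rho>: "(\<Sum>v\<in>\<rho>. g (u v) v) = (\<Sum>v\<in>\<rho>. g (1 / m / s) v)"
    and u'_\<rho>: "(\<Sum>v\<in>\<rho>. g (u' v) v) = (\<Sum>v\<in>\<rho>. g ((1 / m + \<epsilon> * c v) / s) v)"
    for g :: "real \<Rightarrow> 'a \<Rightarrow> 'b::comm_monoid_add"
    using a\<rho> by (auto simp: u_def u'_def intro!: sum.cong)
  have u: "\<forall>v\<in>\<tau>. 0 \<le> u v" "sum u \<tau> = 1"
  proof -
    show "\<forall>v\<in>\<tau>. 0 \<le> u v" using \<epsilon>a' m s by (auto simp: u_def divide_le_0_iff)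
    have "sum u \<tau> = u a' + 1 / s" using u_\<rho>[of "\<lambda>r _. r"] m by (simp add: sum_\<tau> m_def)
    also have "\<dots> = (\<epsilon> * (- c a') + 1) / s" by (simp add: u_def add_divide_distrib diff_divide_distrib)
    also have "\<epsilon> * (- c a') + 1 = s" by (simp add: s_def)
    also have "s / s = 1" using s by simp
    finally show "sum u \<tau> = 1" .
  qed
  have u': "\<forall>v\<in>\<sigma>. 0 \<le> u' v" "sum u' \<sigma> = 1" "(\<Sum>v\<in>\<sigma>. u' v *\<^sub>R v) = (\<Sum>v\<in>\<tau>. u v *\<^sub>R v)"
  proof -
    show "\<forall>v\<in>\<sigma>. 0 \<le> u' v" using \<epsilon> ca m s \<epsilon>c by (auto simp: u'_def \<sigma>_eq)
    have csum: "(\<Sum>v\<in>\<rho>. c v) = - c a - c a'" using rel0(1) by (simp add: sumX)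
    have "sum u' \<sigma> = u' a + (\<Sum>v\<in>\<rho>. (1 / m + \<epsilon> * c v) / s)" using u'_\<rho>[of "\<lambda>r _. r"] by (simp add: sum_\<sigma>)
    also have "(\<Sum>v\<in>\<rho>. (1 / m + \<epsilon> * c v) / s) = (1 + \<epsilon> * (\<Sum>v\<in>\<rho>. c v)) / s"
      using m by (simp add: sum.distrib m_def sum_distrib_left flip: sum_divide_distrib)
    also have "u' a + \<dots> = (\<epsilon> * c a + (1 + \<epsilon> * (- c a - c a'))) / s"
      by (simp add: u'_def csum add_divide_distrib[symmetric])
    also have "\<epsilon> * c a + (1 + \<epsilon> * (- c a - c a')) = s" by (simp add: s_def right_diff_distrib)
    also have "s / s = 1" using s by simp
    finally show "sum u' \<sigma> = 1" .
    have cvec: "(\<Sum>v\<in>\<rho>. c v *\<^sub>R v) = - (c a *\<^sub>R a) - c a' *\<^sub>R a'"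
      using rel0(2) by (simp add: sumX algebra_simps add_eq_0_iff)
    have "(\<Sum>v\<in>\<sigma>. u' v *\<^sub>R v) = u' a *\<^sub>R a + (\<Sum>v\<in>\<rho>. ((1 / m + \<epsilon> * c v) / s) *\<^sub>R v)"
      using u'_\<rho>[of "\<lambda>r v. r *\<^sub>R v"] by (simp add: sum_\<sigma>)
    also have "(\<Sum>v\<in>\<rho>. ((1 / m + \<epsilon> * c v) / s) *\<^sub>R v) =
        (\<Sum>v\<in>\<rho>. (1 / m / s) *\<^sub>R v) + (\<epsilon> / s) *\<^sub>R (\<Sum>v\<in>\<rho>. c v *\<^sub>R v)"
      by (simp add: add_divide_distrib scaleR_add_left sum.distrib scaleR_sum_right)
    also have "u' a *\<^sub>R a + \<dots> = u a' *\<^sub>R a' + (\<Sum>v\<in>\<rho>. (1 / m / s) *\<^sub>R v)"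
      by (simp add: cvec u'_def u_def scaleR_diff_right)
    also have "\<dots> = (\<Sum>v\<in>\<tau>. u v *\<^sub>R v)"
      using u_\<rho>[of "\<lambda>r v. r *\<^sub>R v"] by (simp add: sum_\<tau>)
    finally show "(\<Sum>v\<in>\<sigma>. u' v *\<^sub>R v) = (\<Sum>v\<in>\<tau>. u v *\<^sub>R v)" .
  qed
  let ?z = "\<Sum>v\<in>\<tau>. u v *\<^sub>R v"
  have "?z \<in> convex hull \<tau>" using u T(1)[OF \<tau>(1)] by (auto simp: convex_hull_finite)
  moreover have "?z \<in> convex hull \<sigma>" using u' T(1)[OF \<sigma>(1)] by (auto simp: convex_hull_finite)
  ultimately have "?z \<in> convex hull (\<sigma> \<inter> \<tau>)" using T_Int[OF \<sigma>(1) \<tau>(1)] by blast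
  also have "\<sigma> \<inter> \<tau> = \<rho>" using a\<rho> aa' by (auto simp: \<sigma>_eq \<tau>_eq)
  finally obtain t where t: "\<forall>v\<in>\<rho>. 0 \<le> t v" "sum t \<rho> = 1" "(\<Sum>v\<in>\<rho>. t v *\<^sub>R v) = ?z"
    using f\<rho> by (auto simp: convex_hull_finite)
  have "0 = lin w ?z"
    using lin_comb[OF f\<rho> T(3)[OF \<rho>(1)] t(1,2), of w] w t(3) by simp
  also have "\<dots> = u a' * lin w a'"
    using lin_comb[OF T(1,3)[OF \<tau>(1)] u, of w] T(1)[OF \<tau>(1)] w by (simp add: sum_\<tau> sum.neutral)
  also have "\<dots> > 0" using \<tau>(5) \<epsilon>a' s by (simp add: u_def divide_less_0_iff mult_neg_pos)
  finally show False by simp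
qed

lemma card_cofaces_side:
  assumes w: "\<forall>v\<in>\<rho>. lin w v = 0"
  shows "card {\<sigma>\<in>T. card \<sigma> = card \<alpha> \<and> \<rho> \<subseteq> \<sigma> \<and> (\<exists>a\<in>\<sigma>. 0 < lin w a)} = of_bool (\<exists>e\<in>\<alpha>. 0 < w e)"
proof (cases "\<exists>e\<in>\<alpha>. 0 < w e")
  case True
  then obtain \<sigma> where "\<sigma> \<in> T" "card \<sigma> = card \<alpha>" "\<rho> \<subseteq> \<sigma>" "\<exists>a\<in>\<sigma>. 0 < lin w a"
    using coface_exists[OF w] by blast
  then have "{\<sigma>\<in>T. card \<sigma> = card \<alpha> \<and> \<rho> \<subseteq> \<sigma> \<and> (\<exists>a\<in>\<sigma>. 0 < lin w a)} = {\<sigma>}"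
    using coface_unique[OF w] by blast
  then show ?thesis using True by simp
next
  case False
  have "lin w a \<le> 0" if "\<sigma> \<in> T" "a \<in> \<sigma>" for \<sigma> a
    unfolding lin_def using False that(2) T(3)[OF that(1)] L_nonneg
    by (intro sum_nonpos mult_nonpos_nonneg) (auto simp: not_less)
  then have "{\<sigma>\<in>T. card \<sigma> = card \<alpha> \<and> \<rho> \<subseteq> \<sigma> \<and> (\<exists>a\<in>\<sigma>. 0 < lin w a)} = {}" by (auto simp: not_less)
  then show ?thesis using False by (simp only: card.empty) simp
qed

text \<open>Take a functional that vanishes on \<open>\<rho>\<close>. If it has both signs on
  \<open>\<alpha>\<close>, there is a coface on each side and \<open>\<rho>\<close> lies in no
  facet. If it has one sign, there is one coface, and terms of one sign that sum to zero must all
  vanish, which puts \<open>\<rho>\<close> into a facet, by dimension only one.\<close>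

lemma parity_cofaces:
  "even (card {\<sigma>\<in>T. card \<sigma> = card \<alpha> \<and> \<rho> \<subseteq> \<sigma>}) \<longleftrightarrow> even (card {e\<in>\<alpha>. \<rho> \<subseteq> convex hull (\<alpha> - {e})})"
proof -
  have f\<rho>: "finite \<rho>" using T(1) \<rho>(1) .
  obtain w where w: "\<exists>e\<in>\<alpha>. w e \<noteq> 0" "\<forall>v\<in>\<rho>. lin w v = 0"
    using homogeneous_system_nontrivial[of \<rho> \<alpha> L] f\<rho> fin_\<alpha> \<rho>(3) unfolding lin_def by auto
  let ?S = "\<lambda>w. {\<sigma>\<in>T. card \<sigma> = card \<alpha> \<and> \<rho> \<subseteq> \<sigma> \<and> (\<exists>a\<in>\<sigma>. 0 < lin w a)}"
  have neg: "lin (\<lambda>e. - w e) v = - lin w v" for v by (simp add: lin_def sum_negf)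
  have cofaces: "{\<sigma>\<in>T. card \<sigma> = card \<alpha> \<and> \<rho> \<subseteq> \<sigma>} = ?S w \<union> ?S (\<lambda>e. - w e)"
  proof -
    have "(\<exists>a\<in>\<sigma>. 0 < lin w a) \<or> (\<exists>a\<in>\<sigma>. lin w a < 0)" if \<sigma>: "\<sigma> \<in> T" "card \<sigma> = card \<alpha>" for \<sigma>
    proof (rule ccontr)
      assume "\<not> ?thesis"
      then have z: "\<forall>a\<in>\<sigma>. lin w a = 0" by (meson linorder_neqE_linordered_idom)
      obtain i where i: "i \<in> \<alpha>" "w i \<noteq> 0" using w(1) by blast
      have "card \<sigma> \<le> card \<alpha> - 1"
        by (rule card_le_hyperplane[OF T(1)[OF \<sigma>(1)] T(3)[OF \<sigma>(1)] T(2)[OF \<sigma>(1)] z i])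
      then show False using \<sigma>(2) \<rho>(3) by simp
    qed
    then show ?thesis unfolding neg neg_0_less_iff_less by blast
  qed
  moreover have "?S w \<inter> ?S (\<lambda>e. - w e) = {}"
  proof -
    have False if \<sigma>: "\<sigma> \<in> T" "card \<sigma> = card \<alpha>" "\<rho> \<subseteq> \<sigma>" "a \<in> \<sigma>" "0 < lin w a" "b \<in> \<sigma>" "lin w b < 0" for \<sigma> a b
    proof -
      have "a \<notin> \<rho>" "b \<notin> \<rho>" "a \<noteq> b" using w \<sigma> by auto
      then have "card (insert a (insert b \<rho>)) = card \<alpha> + 1" using f\<rho> \<rho> by simp
      moreover have "card (insert a (insert b \<rho>)) \<le> card \<sigma>" using \<sigma> T(1)[OF \<sigma>(1)] by (intro card_mono) auto
      ultimately show False using \<sigma> by simp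
    qed
    then show ?thesis unfolding neg neg_0_less_iff_less by blast
  qed
  moreover have "finite (?S v)" for v using fin_T by auto
  ultimately have "card {\<sigma>\<in>T. card \<sigma> = card \<alpha> \<and> \<rho> \<subseteq> \<sigma>} = card (?S w) + card (?S (\<lambda>e. - w e))"
    by (simp only: card_Un_disjoint)
  also have "card (?S w) = of_bool (\<exists>e\<in>\<alpha>. 0 < w e)" using w by (intro card_cofaces_side)
  also have "card (?S (\<lambda>e. - w e)) = of_bool (\<exists>e\<in>\<alpha>. 0 < - w e)"
    using w by (intro card_cofaces_side) (auto simp: neg)
  finally have count: "card {\<sigma>\<in>T. card \<sigma> = card \<alpha> \<and> \<rho> \<subseteq> \<sigma>} =
      of_bool (\<exists>e\<in>\<alpha>. 0 < w e) + of_bool (\<exists>e\<in>\<alpha>. w e < 0)" by simp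
  define E where "E = {e\<in>\<alpha>. \<rho> \<subseteq> convex hull (\<alpha> - {e})}"
  have E_iff: "e \<in> E \<longleftrightarrow> (\<forall>v\<in>\<rho>. L v e = 0)" if e: "e \<in> \<alpha>" for e
  proof
    assume "e \<in> E"
    then have sub: "\<rho> \<subseteq> convex hull (\<alpha> - {e})" by (simp add: E_def)
    show "\<forall>v\<in>\<rho>. L v e = 0"
    proof
      fix v assume v: "v \<in> \<rho>"
      then obtain u where u: "\<forall>i\<in>\<alpha> - {e}. 0 \<le> u i" "sum u (\<alpha> - {e}) = 1" "(\<Sum>i\<in>\<alpha> - {e}. u i *\<^sub>R i) = v"
        using sub fin_\<alpha> by (force simp: convex_hull_finite)
      have "L v e = (u(e := 0)) e"
        using u e fin_\<alpha> v T(3)[OF \<rho>(1)]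
        by (intro coords_unique) (auto simp: sum.remove[of \<alpha> e])
      then show "L v e = 0" by simp
    qed
  next
    assume z: "\<forall>v\<in>\<rho>. L v e = 0"
    have "v \<in> convex hull (\<alpha> - {e})" if v: "v \<in> \<rho>" for v
    proof -
      have v\<alpha>: "v \<in> convex hull \<alpha>" using v T(3)[OF \<rho>(1)] by auto
      have "sum (L v) (\<alpha> - {e}) = 1" "(\<Sum>i\<in>\<alpha> - {e}. L v i *\<^sub>R i) = v"
        using L_sum[OF v\<alpha>] L_eq[OF v\<alpha>] z v e fin_\<alpha> by (simp_all add: sum.remove[of \<alpha> e])
      then show ?thesis using L_nonneg[OF v\<alpha>] fin_\<alpha> by (auto simp: convex_hull_finite intro!: exI[of _ "L v"])
    qed
    then show "e \<in> E" using e by (auto simp: E_def)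
  qed
  have codim2: False if "i \<in> \<alpha>" "w i \<noteq> 0" "j \<in> E" "j \<noteq> i" for i j
  proof -
    have "j \<in> \<alpha>" using that by (simp add: E_def)
    then have "card \<rho> \<le> card \<alpha> - 2"
      using card_le_codim_2[OF f\<rho> T(3,2)[OF \<rho>(1)] w(2) that(1,2)] E_iff that by auto
    then show False using \<rho> card_\<rho>_pos by simp
  qed
  have "even (card {\<sigma>\<in>T. card \<sigma> = card \<alpha> \<and> \<rho> \<subseteq> \<sigma>}) \<longleftrightarrow> even (card E)"
  proof (cases "(\<exists>e\<in>\<alpha>. 0 < w e) \<and> (\<exists>e\<in>\<alpha>. w e < 0)")
    case True
    then have "E = {}" using codim2
      by (metis (no_types, lifting) all_not_in_conv less_asym less_irrefl)
    then show ?thesis using True count by simp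
  next
    case False
    obtain i where i: "i \<in> \<alpha>" "w i \<noteq> 0" using w(1) by auto
    have "L v i = 0" if v: "v \<in> \<rho>" for v
    proof -
      have v\<alpha>: "v \<in> convex hull \<alpha>" using v T(3)[OF \<rho>(1)] by auto
      have 0: "(\<Sum>e\<in>\<alpha>. w e * L v e) = 0" using w(2) v by (simp add: lin_def)
      have "(\<forall>e\<in>\<alpha>. 0 \<le> w e * L v e) \<or> (\<forall>e\<in>\<alpha>. 0 \<le> - (w e * L v e))"
        using False L_nonneg[OF v\<alpha>] by (metis mult_nonneg_nonneg mult_nonpos_nonneg not_less neg_0_le_iff_le)
      moreover have "(\<Sum>e\<in>\<alpha>. - (w e * L v e)) = 0" using 0 by (simp add: sum_negf)
      ultimately have "w i * L v i = 0"
        using 0 i fin_\<alpha> sum_nonneg_eq_0_iff[of \<alpha> "\<lambda>e. w e * L v e"]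
          sum_nonneg_eq_0_iff[of \<alpha> "\<lambda>e. - (w e * L v e)"] by auto
      then show ?thesis using i by simp
    qed
    then have "E = {i}" using E_iff i codim2 by blast
    moreover have "card {\<sigma>\<in>T. card \<sigma> = card \<alpha> \<and> \<rho> \<subseteq> \<sigma>} = 1"
      using count False i by (auto simp: neq_iff)
    ultimately show ?thesis by simp
  qed
  then show ?thesis by (simp only: E_def)
qed

end

end

text \<open>The empty simplex is admitted so that the boundary rule below holds for a vertex as well.\<close>

definition pieces :: "'a::real_vector set set \<Rightarrow> 'a set \<Rightarrow> 'a set set" where
  "pieces A \<alpha> = {\<sigma> \<in> insert {} A. \<sigma> \<subseteq> convex hull \<alpha> \<and> card \<sigma> = card \<alpha>}"

lemma pieces_empty: "geometric_complex A \<Longrightarrow> pieces A {} = {{}}"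
  unfolding pieces_def by auto

text \<open>Subdivision commutes with the boundary modulo 2: the two counts are the coefficient of
  \<open>\<rho>\<close> in the boundary of the subdivided \<open>\<alpha>\<close> and in the
  subdivided boundary of \<open>\<alpha>\<close>.\<close>

lemma parity_pieces_boundary:
  fixes K :: "'a::real_normed_vector set set"
  assumes K: "geometric_complex K" and A: "subdivision A K" and \<alpha>: "\<alpha> \<in> K"
    and card: "card \<alpha> = Suc (card \<rho>)"
  shows "even (card {\<sigma> \<in> pieces A \<alpha>. \<rho> \<subseteq> \<sigma>}) \<longleftrightarrow> even (card {e\<in>\<alpha>. \<rho> \<in> pieces A (\<alpha> - {e})})"
proof -
  note KD = geometric_complexD[OF K]
  have gA: "geometric_complex A" using A unfolding subdivision_def by auto
  note AD = geometric_complexD[OF gA]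
  have \<alpha>': "finite \<alpha>" "\<not> affine_dependent \<alpha>" "\<alpha> \<noteq> {}" using KD \<alpha> by auto
  have pieces_\<alpha>: "pieces A \<alpha> = {\<sigma> \<in> A. \<sigma> \<subseteq> convex hull \<alpha> \<and> card \<sigma> = card \<alpha>}"
    using \<alpha>' by (auto simp: pieces_def)
  have card_minus: "card (\<alpha> - {e}) = card \<rho>" if "e \<in> \<alpha>" for e using that card \<alpha>' by simp
  \<comment> \<open>The first case is that of a vertex \<open>\<alpha>\<close>, with the empty
    simplex as its facet. In the last one both counts are zero.\<close>
  consider "\<rho> = {}" | "\<rho> \<noteq> {}" "\<rho> \<in> A" "\<rho> \<subseteq> convex hull \<alpha>" | "\<rho> \<noteq> {}" "\<not> (\<rho> \<in> A \<and> \<rho> \<subseteq> convex hull \<alpha>)"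
    by blast
  then show ?thesis
  proof cases
    case 1
    then obtain v where v: "\<alpha> = {v}" using card by (auto simp: card_Suc_eq)
    obtain \<tau> where "\<tau> \<in> A" "\<tau> \<subseteq> convex hull \<alpha>" 
      using subdivision_carrier[OF K A \<alpha> hull_inc[of v \<alpha> convex]] v by auto
    then have "{v} \<in> A" using AD(3)[of \<tau>] v by (metis convex_hull_singleton subset_singletonD)
    then have "{\<sigma> \<in> pieces A \<alpha>. \<rho> \<subseteq> \<sigma>} = {{v}}"
      using v 1 by (auto simp: pieces_def subset_singleton_iff)
    moreover have "{e\<in>\<alpha>. \<rho> \<in> pieces A (\<alpha> - {e})} = {v}"
    proof -
      have "\<rho> \<in> pieces A (\<alpha> - {v})" unfolding v 1 by (simp add: pieces_empty[OF gA])
      then show ?thesis unfolding v by blast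
    qed
    ultimately show ?thesis by simp
  next
    case 2
    define T where "T = {\<sigma>\<in>A. \<sigma> \<subseteq> convex hull \<alpha>}"
    have "\<forall>x\<in>convex hull \<alpha>. \<exists>l. (\<forall>e\<in>\<alpha>. 0 \<le> l e) \<and> sum l \<alpha> = 1 \<and> (\<Sum>e\<in>\<alpha>. l e *\<^sub>R e) = x"
      using \<alpha>'(1) by (auto simp: convex_hull_finite)
    then obtain L where L: "\<And>x e. x \<in> convex hull \<alpha> \<Longrightarrow> e \<in> \<alpha> \<Longrightarrow> 0 \<le> L x e"
      "\<And>x. x \<in> convex hull \<alpha> \<Longrightarrow> sum (L x) \<alpha> = 1" "\<And>x. x \<in> convex hull \<alpha> \<Longrightarrow> (\<Sum>e\<in>\<alpha>. L x e *\<^sub>R e) = x"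
      by metis
    have cover: "convex hull \<alpha> \<subseteq> (\<Union>\<sigma>\<in>T. convex hull \<sigma>)"
    proof
      fix x assume "x \<in> convex hull \<alpha>"
      then obtain \<sigma> where \<sigma>: "\<sigma> \<in> A" "\<sigma> \<subseteq> convex hull \<alpha>" "x \<in> open_simplex \<sigma>"
        using subdivision_carrier[OF K A \<alpha>] by metis
      then have "x \<in> convex hull \<sigma>" using open_simplex_subset[of \<sigma>] AD(2) by auto
      then show "x \<in> (\<Union>\<sigma>\<in>T. convex hull \<sigma>)" using \<sigma> by (auto simp: T_def)
    qed
    have "even (card {\<sigma>\<in>T. card \<sigma> = card \<alpha> \<and> \<rho> \<subseteq> \<sigma>}) \<longleftrightarrow> even (card {e\<in>\<alpha>. \<rho> \<subseteq> convex hull (\<alpha> - {e})})"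
      by (rule parity_cofaces[OF \<alpha>'(1,2) L _ _ _ _ _ cover _ 2(1) card])
        (use AD 2 in \<open>auto simp: T_def\<close>)
    moreover have "{\<sigma>\<in>T. card \<sigma> = card \<alpha> \<and> \<rho> \<subseteq> \<sigma>} = {\<sigma> \<in> pieces A \<alpha>. \<rho> \<subseteq> \<sigma>}"
      unfolding pieces_\<alpha> T_def by auto
    moreover have "{e\<in>\<alpha>. \<rho> \<subseteq> convex hull (\<alpha> - {e})} = {e\<in>\<alpha>. \<rho> \<in> pieces A (\<alpha> - {e})}"
      using 2 card_minus by (auto simp: pieces_def)
    ultimately show ?thesis by simp
  next
    case 3
    have "{\<sigma> \<in> pieces A \<alpha>. \<rho> \<subseteq> \<sigma>} = {}"
      unfolding pieces_\<alpha> using 3 AD(5) by blast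
    moreover have "{e\<in>\<alpha>. \<rho> \<in> pieces A (\<alpha> - {e})} = {}"
    proof -
      have "convex hull (\<alpha> - {e}) \<subseteq> convex hull \<alpha>" for e by (rule hull_mono) auto
      then show ?thesis unfolding pieces_def using 3 by blast
    qed
    ultimately show ?thesis by (simp only: card.empty)
  qed
qed

section \<open>Cycles modulo 2\<close>

lemma of_nat_bit: "(of_nat n :: bit) = of_bool (odd n)"
  by (induction n) auto

lemma of_nat_bit_eq_0_iff: "of_nat n = (0::bit) \<longleftrightarrow> even n"
  by (simp add: of_nat_bit)

lemma of_nat_bit_eq_iff: "of_nat m = (of_nat n::bit) \<longleftrightarrow> (even m \<longleftrightarrow> even n)"
  by (simp add: of_nat_bit of_bool_eq_iff)

lemma sum_of_bool_bit: "finite S \<Longrightarrow> (\<Sum>x\<in>S. of_bool (P x)) = (of_nat (card {x\<in>S. P x}) :: bit)"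
  by (simp add: Collect_conj_eq Int_commute)

lemma sum_symmetric_off_diagonal:
  fixes G :: "'a \<Rightarrow> 'a \<Rightarrow> bit"
  assumes "finite V" "\<And>x y. G x y = G y x"
  shows "(\<Sum>x\<in>V. \<Sum>y\<in>V - {x}. G x y) = 0"
  using assms(1)
proof (induction V rule: finite_induct)
  case (insert z V)
  have "(\<Sum>x\<in>insert z V. \<Sum>y\<in>insert z V - {x}. G x y) =
      (\<Sum>y\<in>insert z V - {z}. G z y) + (\<Sum>x\<in>V. \<Sum>y\<in>insert z V - {x}. G x y)"
    using insert by simp
  also have "insert z V - {z} = V" using insert by auto
  also have "(\<Sum>x\<in>V. \<Sum>y\<in>insert z V - {x}. G x y) = (\<Sum>x\<in>V. G x z + (\<Sum>y\<in>V - {x}. G x y))"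
  proof (rule sum.cong[OF refl])
    fix x assume "x \<in> V"
    then have "insert z V - {x} = insert z (V - {x})" using insert by auto
    then show "(\<Sum>y\<in>insert z V - {x}. G x y) = G x z + (\<Sum>y\<in>V - {x}. G x y)"
      using insert by simp
  qed
  also have "\<dots> = (\<Sum>x\<in>V. G z x)" using insert.IH assms(2) by (simp add: sum.distrib)
  finally show ?case by simp
qed simp

text \<open>Double counting of incidences: the weight of \<open>\<rho>\<close> is its coefficient in
  the mod 2 boundary of the chain.\<close>

lemma sum_facets:
  fixes G :: "'a set \<Rightarrow> bit"
  assumes "finite \<C>" "\<And>\<sigma>. \<sigma> \<in> \<C> \<Longrightarrow> finite \<sigma> \<and> card \<sigma> = Suc k" and U: "finite U" "\<Union>\<C> \<subseteq> U"
  shows "(\<Sum>\<sigma>\<in>\<C>. \<Sum>x\<in>\<sigma>. G (\<sigma> - {x})) =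
    (\<Sum>\<rho>\<in>{\<rho>. \<rho> \<subseteq> U \<and> card \<rho> = k}. of_nat (card {\<sigma>\<in>\<C>. \<rho> \<subseteq> \<sigma>}) * G \<rho>)"
proof -
  let ?R = "{\<rho>. \<rho> \<subseteq> U \<and> card \<rho> = k}"
  have finR: "finite ?R" by (rule finite_subset[of _ "Pow U"]) (use U in auto)
  have "(\<Sum>\<rho>\<in>?R. of_nat (card {\<sigma>\<in>\<C>. \<rho> \<subseteq> \<sigma>}) * G \<rho>) = (\<Sum>\<rho>\<in>?R. \<Sum>\<sigma>\<in>\<C>. of_bool (\<rho> \<subseteq> \<sigma>) * G \<rho>)"
    by (simp only: sum_of_bool_bit[OF assms(1)] sum_distrib_right[symmetric])
  also have "\<dots> = (\<Sum>\<sigma>\<in>\<C>. \<Sum>\<rho>\<in>?R. of_bool (\<rho> \<subseteq> \<sigma>) * G \<rho>)" by (rule sum.swap)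
  also have "\<dots> = (\<Sum>\<sigma>\<in>\<C>. \<Sum>x\<in>\<sigma>. G (\<sigma> - {x}))"
  proof (rule sum.cong[OF refl])
    fix \<sigma> assume \<sigma>: "\<sigma> \<in> \<C>"
    then have s: "finite \<sigma>" "card \<sigma> = Suc k" using assms by auto
    have facets: "{\<rho>\<in>?R. \<rho> \<subseteq> \<sigma>} = (\<lambda>x. \<sigma> - {x}) ` \<sigma>"
    proof
      show "{\<rho>\<in>?R. \<rho> \<subseteq> \<sigma>} \<subseteq> (\<lambda>x. \<sigma> - {x}) ` \<sigma>"
      proof
        fix \<rho> assume "\<rho> \<in> {\<rho>\<in>?R. \<rho> \<subseteq> \<sigma>}"
        then have \<rho>: "\<rho> \<subseteq> \<sigma>" "card \<rho> = k" by auto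
        then have "card (\<sigma> - \<rho>) = 1" using s by (simp add: card_Diff_subset finite_subset)
        then obtain x where "\<sigma> - \<rho> = {x}" by (auto simp: card_Suc_eq)
        then have "\<rho> = \<sigma> - {x}" "x \<in> \<sigma>" using \<rho> by auto
        then show "\<rho> \<in> (\<lambda>x. \<sigma> - {x}) ` \<sigma>" by auto
      qed
      show "(\<lambda>x. \<sigma> - {x}) ` \<sigma> \<subseteq> {\<rho>\<in>?R. \<rho> \<subseteq> \<sigma>}" using \<sigma> s U(2) by auto
    qed
    have "(\<Sum>\<rho>\<in>?R. of_bool (\<rho> \<subseteq> \<sigma>) * G \<rho>) = (\<Sum>\<rho>\<in>{\<rho>\<in>?R. \<rho> \<subseteq> \<sigma>}. G \<rho>)"
      using finR by (intro sum.mono_neutral_cong_right) auto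
    also have "\<dots> = (\<Sum>x\<in>\<sigma>. G (\<sigma> - {x}))"
      unfolding facets by (rule sum.reindex_cong[where l="\<lambda>x. \<sigma> - {x}"]) (auto simp: inj_on_def)
    finally show "(\<Sum>\<rho>\<in>?R. of_bool (\<rho> \<subseteq> \<sigma>) * G \<rho>) = (\<Sum>x\<in>\<sigma>. G (\<sigma> - {x}))" .
  qed
  finally show ?thesis by simp
qed

definition mod2_cycle :: "nat \<Rightarrow> 'a set set \<Rightarrow> bool" where
  "mod2_cycle k \<C> \<longleftrightarrow> finite \<C> \<and> (\<forall>\<sigma>\<in>\<C>. finite \<sigma> \<and> card \<sigma> = Suc k) \<and>
     (\<forall>\<rho>. card \<rho> = k \<longrightarrow> even (card {\<sigma>\<in>\<C>. \<rho> \<subseteq> \<sigma>}))"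

lemma sum_facets_cycle:
  fixes G :: "'a set \<Rightarrow> bit"
  assumes "mod2_cycle k \<C>"
  shows "(\<Sum>\<sigma>\<in>\<C>. \<Sum>x\<in>\<sigma>. G (\<sigma> - {x})) = 0"
proof -
  have "(\<Sum>\<rho>\<in>{\<rho>. \<rho> \<subseteq> \<Union>\<C> \<and> card \<rho> = k}. of_nat (card {\<sigma>\<in>\<C>. \<rho> \<subseteq> \<sigma>}) * G \<rho>) = 0"
    by (rule sum.neutral) (use assms in \<open>auto simp: mod2_cycle_def of_nat_bit_eq_0_iff\<close>)
  moreover have "finite (\<Union>\<C>)" using assms by (auto simp: mod2_cycle_def)
  ultimately show ?thesis using sum_facets[of \<C> k "\<Union>\<C>" G] assms by (simp add: mod2_cycle_def)
qed

lemma card_simplex_le: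
  fixes \<alpha> :: "'a::real_normed_vector set"
  assumes "finite \<alpha>" "\<not> affine_dependent \<alpha>" "finite X" "X \<subseteq> convex hull \<alpha>" "\<not> affine_dependent X"
  shows "card X \<le> card \<alpha>"
proof -
  have "\<forall>x\<in>convex hull \<alpha>. \<exists>l. (\<forall>e\<in>\<alpha>. 0 \<le> l e) \<and> sum l \<alpha> = 1 \<and> (\<Sum>e\<in>\<alpha>. l e *\<^sub>R e) = x"
    using assms(1) by (auto simp: convex_hull_finite)
  then obtain L where L: "\<And>x e. x \<in> convex hull \<alpha> \<Longrightarrow> e \<in> \<alpha> \<Longrightarrow> 0 \<le> L x e"
    "\<And>x. x \<in> convex hull \<alpha> \<Longrightarrow> sum (L x) \<alpha> = 1" "\<And>x. x \<in> convex hull \<alpha> \<Longrightarrow> (\<Sum>e\<in>\<alpha>. L x e *\<^sub>R e) = x"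
    by metis
  show ?thesis by (rule card_le_simplex[OF assms(1,2) L assms(3,4,5)])
qed

definition simplex_boundary :: "'a set \<Rightarrow> 'a set set" where
  "simplex_boundary V = {s. s \<subset> V \<and> s \<noteq> {}}"

context
  fixes V :: "'a::real_normed_vector set" and A :: "'a set set" and k :: nat
  assumes V: "finite V" "\<not> affine_dependent V" "card V = k + 2"
    and K: "geometric_complex (simplex_boundary V)" and A: "subdivision A (simplex_boundary V)"
begin

lemma facet_in_simplex_boundary:
  assumes "e \<in> V"
  shows "V - {e} \<in> simplex_boundary V"
proof -
  have "card (V - {e}) = Suc k" using V assms by simp
  then have "V - {e} \<noteq> {}" by (metis card.empty nat.simps(3))
  then show ?thesis using assms by (auto simp: simplex_boundary_def)
qed

text \<open>A simplex of full dimension lies in only one facet: inside two of them it would lie in a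
  face with \<open>k\<close> vertices, too small for \<open>k + 1\<close> independent
  points.\<close>

lemma sum_top_simplices:
  "(\<Sum>\<sigma>\<in>{\<sigma>\<in>A. card \<sigma> = Suc k}. h \<sigma>) = (\<Sum>e\<in>V. \<Sum>\<sigma>\<in>pieces A (V - {e}). h \<sigma>)"
proof -
  have gA: "geometric_complex A" using A unfolding subdivision_def by auto
  note AD = geometric_complexD[OF gA]
  let ?T = "{\<sigma>\<in>A. card \<sigma> = Suc k}"
  have T_eq: "?T = (\<Union>e\<in>V. pieces A (V - {e}))"
  proof
    show "?T \<subseteq> (\<Union>e\<in>V. pieces A (V - {e}))"
    proof
      fix \<sigma> assume \<sigma>: "\<sigma> \<in> ?T"
      then obtain \<tau> where \<tau>: "\<tau> \<in> simplex_boundary V" "convex hull \<sigma> \<subseteq> convex hull \<tau>"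
        using A unfolding subdivision_def by auto
      then obtain e where e: "e \<in> V" "\<tau> \<subseteq> V - {e}" by (auto simp: simplex_boundary_def)
      have "\<sigma> \<subseteq> convex hull (V - {e})"
        using hull_subset[of \<sigma> convex] \<tau>(2) hull_mono[OF e(2), of convex] by blast
      then show "\<sigma> \<in> (\<Union>e\<in>V. pieces A (V - {e}))" using \<sigma> e V by (auto simp: pieces_def)
    qed
    show "(\<Union>e\<in>V. pieces A (V - {e})) \<subseteq> ?T" using V by (auto simp: pieces_def)
  qed
  have disj: "pieces A (V - {e}) \<inter> pieces A (V - {e'}) = {}" if e: "e \<in> V" "e' \<in> V" "e \<noteq> e'" for e e'
  proof -
    have False if "\<sigma> \<in> pieces A (V - {e})" "\<sigma> \<in> pieces A (V - {e'})" for \<sigma>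
    proof -
      have \<sigma>: "\<sigma> \<in> A" "card \<sigma> = Suc k"
        using that(1) e V by (auto simp: pieces_def)
      have "\<sigma> \<subseteq> convex hull (V - {e}) \<inter> convex hull (V - {e'})" using that by (auto simp: pieces_def)
      also have "\<dots> = convex hull ((V - {e}) \<inter> (V - {e'}))"
        by (rule geometric_complexD(6)[OF K]) (use facet_in_simplex_boundary e in auto)
      also have "(V - {e}) \<inter> (V - {e'}) = V - {e, e'}" by auto
      finally have "card \<sigma> \<le> card (V - {e, e'})"
        using V(1) affine_dependent_subset[of "V - {e, e'}" V] V(2) AD(2,4) \<sigma>(1)
        by (intro card_simplex_le) auto
      also have "\<dots> = k" using V e by (simp add: card_Diff_subset)
      finally show False using \<sigma> by simp
    qed
    then show ?thesis by auto
  qed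
  have finA: "finite (pieces A \<alpha>)" for \<alpha>
    by (rule finite_subset[of _ "insert {} A"]) (use AD(1) in \<open>auto simp: pieces_def\<close>)
  show ?thesis unfolding T_eq using V(1) finA disj by (intro sum.UNION_disjoint) auto
qed

text \<open>Boundary of a boundary: \<open>\<rho>\<close> is counted once for each ordered pair of
  removed vertices, and the two orders cancel.\<close>

lemma simplex_boundary_cycle: "mod2_cycle k {\<sigma>\<in>A. card \<sigma> = Suc k}"
proof -
  have gA: "geometric_complex A" using A unfolding subdivision_def by auto
  note AD = geometric_complexD[OF gA]
  let ?T = "{\<sigma>\<in>A. card \<sigma> = Suc k}"
  have finT: "finite ?T" using AD(1) by simp
  have finA: "finite (pieces A \<alpha>)" for \<alpha>
    by (rule finite_subset[of _ "insert {} A"]) (use AD(1) in \<open>auto simp: pieces_def\<close>)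
  have "even (card {\<sigma>\<in>?T. \<rho> \<subseteq> \<sigma>})" if \<rho>: "card \<rho> = k" for \<rho>
  proof -
    have "of_nat (card {\<sigma>\<in>?T. \<rho> \<subseteq> \<sigma>}) = (\<Sum>\<sigma>\<in>?T. of_bool (\<rho> \<subseteq> \<sigma>) :: bit)"
      by (rule sum_of_bool_bit[OF finT, symmetric])
    also have "\<dots> = (\<Sum>e\<in>V. of_nat (card {\<sigma>\<in>pieces A (V - {e}). \<rho> \<subseteq> \<sigma>}))"
      unfolding sum_top_simplices by (simp only: sum_of_bool_bit[OF finA])
    also have "\<dots> = (\<Sum>e\<in>V. of_nat (card {e'\<in>V - {e}. \<rho> \<in> pieces A (V - {e} - {e'})}))"
    proof (rule sum.cong[OF refl])
      fix e assume e: "e \<in> V"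
      show "of_nat (card {\<sigma>\<in>pieces A (V - {e}). \<rho> \<subseteq> \<sigma>}) =
          (of_nat (card {e'\<in>V - {e}. \<rho> \<in> pieces A (V - {e} - {e'})}) :: bit)"
        unfolding of_nat_bit_eq_iff
        by (rule parity_pieces_boundary[OF K A facet_in_simplex_boundary[OF e]]) (use V e \<rho> in simp)
    qed
    also have "\<dots> = (\<Sum>e\<in>V. \<Sum>e'\<in>V - {e}. of_bool (\<rho> \<in> pieces A (V - {e} - {e'})))"
      using V(1) by (simp only: sum_of_bool_bit finite_Diff)
    also have "\<dots> = 0"
      by (rule sum_symmetric_off_diagonal[OF V(1)]) (simp add: Diff_insert2[symmetric] insert_commute)
    finally show ?thesis by (simp only: of_nat_bit_eq_0_iff)
  qed
  then show ?thesis using AD by (auto simp: mod2_cycle_def)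
qed

end

section \<open>Cones, positive dependence and the change of the apex\<close>

lemma span_scale_cancel: "s *\<^sub>R x \<in> span B \<Longrightarrow> s \<noteq> 0 \<Longrightarrow> x \<in> span B" for x :: "'e::real_vector"
  using span_scale[of "s *\<^sub>R x" B "inverse s"] by simp

definition in_cone :: "'e::real_vector \<Rightarrow> ('i \<Rightarrow> 'e) \<Rightarrow> 'i set \<Rightarrow> bool" where
  "in_cone q v S \<longleftrightarrow> (\<exists>c. (\<forall>i\<in>S. 0 \<le> c i) \<and> (\<Sum>i\<in>S. c i *\<^sub>R v i) = q)"

text \<open>The coordinate-free form of \<open>hit\<close>. For the vectors of a join it will force
  the convex hulls of the two images to meet.\<close>

definition positively_dependent :: "('i \<Rightarrow> 'e::real_vector) \<Rightarrow> 'i set \<Rightarrow> bool" where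
  "positively_dependent v S \<longleftrightarrow>
     (\<exists>c. (\<forall>i\<in>S. 0 \<le> c i) \<and> (\<exists>i\<in>S. c i \<noteq> 0) \<and> (\<Sum>i\<in>S. c i *\<^sub>R v i) = 0)"

lemma ex_separating_functionals:
  "\<exists>\<phi>::nat \<Rightarrow> 'e::euclidean_space. \<forall>x. (\<forall>r<DIM('e). \<phi> r \<bullet> x = 0) \<longleftrightarrow> x = 0"
proof -
  obtain \<phi> :: "nat \<Rightarrow> 'e" where \<phi>: "bij_betw \<phi> {0..<DIM('e)} Basis"
    using ex_bij_betw_nat_finite[OF finite_Basis] by blast
  have "(\<forall>r<DIM('e). \<phi> r \<bullet> x = 0) \<longleftrightarrow> x = 0" for x
  proof
    assume *: "\<forall>r<DIM('e). \<phi> r \<bullet> x = 0"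
    have "x \<bullet> b = 0" if "b \<in> Basis" for b
      using \<phi> that * unfolding bij_betw_def by (metis atLeastLessThan_iff imageE inner_commute)
    then show "x = 0" by (simp add: euclidean_eq_iff[of x 0])
  qed simp
  then show ?thesis by blast
qed

lemma hit_iff_positively_dependent:
  assumes "\<forall>x. (\<forall>r<n. \<phi> r \<bullet> x = 0) \<longleftrightarrow> x = 0"
  shows "hit (\<lambda>i r. \<phi> r \<bullet> v i) n S \<longleftrightarrow> positively_dependent v S"
proof -
  have "(\<forall>r<n. (\<Sum>i\<in>S. c i * (\<phi> r \<bullet> v i)) = 0) \<longleftrightarrow> (\<Sum>i\<in>S. c i *\<^sub>R v i) = 0" for c
    using assms[rule_format, of "\<Sum>i\<in>S. c i *\<^sub>R v i"] by (simp add: inner_sum_right)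
  then show ?thesis unfolding hit_def positively_dependent_def by simp
qed

text \<open>The minus signs turn membership of an apex in a cone into a positive dependence, so that
  both apexes enter one facet count.\<close>

definition apex_pair :: "('i \<Rightarrow> 'e::real_vector) \<Rightarrow> 'e \<Rightarrow> 'e \<Rightarrow> 'i + bool \<Rightarrow> 'e" where
  "apex_pair v q q' = case_sum v (\<lambda>b. if b then - q' else - q)"

text \<open>The facet count for the \<open>DIM('e) + 2\<close> vectors \<open>v\<close> on
  \<open>S\<close>, \<open>- q\<close> and \<open>- q'\<close>. Omitting one apex leaves the cone
  condition for the other; omitting a vector leaves a term that depends only on a facet of
  \<open>S\<close>. The right-hand side is thus a coboundary, which disappears over cycles.\<close>

lemma parity_two_apexes:
  fixes v :: "'i \<Rightarrow> 'e::euclidean_space"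
  assumes fin: "finite S" and card: "card S = DIM('e)"
    and pd: "\<not> positively_dependent v S"
    and q: "\<And>x. x \<in> S \<Longrightarrow> q \<notin> span (v ` (S - {x}))"
    and q': "\<And>x. x \<in> S \<Longrightarrow> q' \<notin> span (v ` (S - {x}))"
      "\<And>x y. x \<in> S \<Longrightarrow> y \<in> S \<Longrightarrow> x \<noteq> y \<Longrightarrow> q' \<notin> span (insert q (v ` (S - {x, y})))"
  shows "of_bool (in_cone q v S) + of_bool (in_cone q' v S) =
    (\<Sum>x\<in>S. of_bool (positively_dependent (apex_pair v q q') (Inl ` (S - {x}) \<union> range Inr)) :: bit)"
proof -
  obtain \<phi> :: "nat \<Rightarrow> 'e" where \<phi>: "\<forall>x. (\<forall>r<DIM('e). \<phi> r \<bullet> x = 0) \<longleftrightarrow> x = 0"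
    using ex_separating_functionals by blast
  let ?w = "apex_pair v q q'"
  let ?T = "Inl ` S \<union> range Inr :: ('i + bool) set"
  have range_Inr: "range Inr = {Inr False, Inr True :: 'i + bool}" by (auto simp: UNIV_bool)
  have sums: "(\<Sum>i\<in>Inl ` U. f i) = (\<Sum>i\<in>U. f (Inl i))"
    for f :: "'i + bool \<Rightarrow> 'e" and U by (subst sum.reindex) auto
  have notin: "Inr b \<notin> Inl ` U" for b :: bool and U :: "'i set" by auto
  have pdI: "False" if "U \<subseteq> S" "\<forall>i\<in>U. 0 \<le> c i" "i \<in> U" "c i \<noteq> 0" "(\<Sum>i\<in>U. c i *\<^sub>R v i) = 0" for U i c
  proof -
    have "(\<Sum>i\<in>S. (if i \<in> U then c i else 0) *\<^sub>R v i) = (\<Sum>i\<in>U. c i *\<^sub>R v i)"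
      using fin that(1) by (intro sum.mono_neutral_cong_right) auto
    then have "positively_dependent v S" unfolding positively_dependent_def using that
      by (intro exI[of _ "\<lambda>i. if i \<in> U then c i else 0"] conjI) (simp, fastforce, simp)
    then show False using pd by simp
  qed
  have spanI: "x \<in> span (v ` U)" if "(\<Sum>i\<in>U. c i *\<^sub>R v i) = s *\<^sub>R x" "s \<noteq> 0" for c s x U
  proof -
    have "(\<Sum>i\<in>U. c i *\<^sub>R v i) \<in> span (v ` U)" by (intro span_sum span_scale span_base) auto
    then show ?thesis using that by (auto intro: span_scale_cancel)
  qed
  \<comment> \<open>As the vectors of \<open>S\<close> alone are positively independent, the apex
    has a nonzero coefficient, which can be normalised to one.\<close>
  have one: "positively_dependent ?w (insert (Inr b) (Inl ` U)) \<longleftrightarrow> in_cone (if b then q' else q) v U"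
    if "U \<subseteq> S" for b U
  proof
    have fU: "finite U" using that fin finite_subset by blast
    {
      assume "positively_dependent ?w (insert (Inr b) (Inl ` U))"
      then obtain c where c: "\<forall>i\<in>insert (Inr b) (Inl ` U). 0 \<le> c i" "\<exists>i\<in>insert (Inr b) (Inl ` U). c i \<noteq> 0"
        "(\<Sum>i\<in>insert (Inr b) (Inl ` U). c i *\<^sub>R ?w i) = 0" unfolding positively_dependent_def by blast
      have eq: "(\<Sum>i\<in>U. c (Inl i) *\<^sub>R v i) = c (Inr b) *\<^sub>R (if b then q' else q)"
        using c(3) fU notin by (simp add: sums apex_pair_def split: if_splits)
      have "c (Inr b) \<noteq> 0"
      proof
        assume 0: "c (Inr b) = 0"
        then obtain i where "i \<in> U" "c (Inl i) \<noteq> 0" using c(2) by auto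
        then show False using pdI[OF that, of "\<lambda>i. c (Inl i)" i] c(1) eq 0 by auto
      qed
      then have "c (Inr b) > 0" using c(1) by force
      moreover have "(\<Sum>i\<in>U. (c (Inl i) / c (Inr b)) *\<^sub>R v i) =
          (1 / c (Inr b)) *\<^sub>R (\<Sum>i\<in>U. c (Inl i) *\<^sub>R v i)"
        by (simp add: scaleR_sum_right)
      ultimately show "in_cone (if b then q' else q) v U" unfolding in_cone_def using c(1) eq
        by (intro exI[of _ "\<lambda>i. c (Inl i) / c (Inr b)"]) auto
    }
    {
      assume "in_cone (if b then q' else q) v U"
      then obtain c where c: "\<forall>i\<in>U. 0 \<le> c i" "(\<Sum>i\<in>U. c i *\<^sub>R v i) = (if b then q' else q)"
        unfolding in_cone_def by blast
      show "positively_dependent ?w (insert (Inr b) (Inl ` U))"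
        unfolding positively_dependent_def using c fU
        by (intro exI[of _ "case_sum c (\<lambda>_. 1)"]) (auto simp: sums apex_pair_def notin)
    }
  qed
  have none: "\<not> positively_dependent ?w (Inl ` S)"
    using pd unfolding positively_dependent_def
  proof (rule contrapos_nn)
    assume "\<exists>c. (\<forall>i\<in>Inl ` S. 0 \<le> c i) \<and> (\<exists>i\<in>Inl ` S. c i \<noteq> 0) \<and> (\<Sum>i\<in>Inl ` S. c i *\<^sub>R ?w i) = 0"
    then obtain c where "(\<forall>i\<in>Inl ` S. 0 \<le> c i) \<and> (\<exists>i\<in>Inl ` S. c i \<noteq> 0) \<and> (\<Sum>i\<in>Inl ` S. c i *\<^sub>R ?w i) = 0"
      by blast
    then show "\<exists>c. (\<forall>i\<in>S. 0 \<le> c i) \<and> (\<exists>i\<in>S. c i \<noteq> 0) \<and> (\<Sum>i\<in>S. c i *\<^sub>R v i) = 0"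
      by (intro exI[of _ "\<lambda>i. c (Inl i)"]) (auto simp: sums apex_pair_def)
  qed
  have one_gen: "\<not> positively_dependent ?w (insert (Inr b) (Inl ` (S - {x})))" if "x \<in> S" for b x
  proof
    assume "positively_dependent ?w (insert (Inr b) (Inl ` (S - {x})))"
    then obtain c where "(\<Sum>i\<in>S - {x}. c i *\<^sub>R v i) = (if b then q' else q)"
      unfolding one[OF Diff_subset] in_cone_def by blast
    then have "(if b then q' else q) \<in> span (v ` (S - {x}))" using spanI[of _ _ 1] by auto
    then show False using q[OF that] q'(1)[OF that] by (auto split: if_splits)
  qed
  have two_gen: "\<not> positively_dependent ?w (range Inr \<union> Inl ` (S - {x, y}))"
    if xy: "x \<in> S" "y \<in> S" "x \<noteq> y" for x y
  proof
    assume "positively_dependent ?w (range Inr \<union> Inl ` (S - {x, y}))"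
    then obtain c where c: "\<forall>i\<in>range Inr \<union> Inl ` (S - {x, y}). 0 \<le> c i"
      "\<exists>i\<in>range Inr \<union> Inl ` (S - {x, y}). c i \<noteq> 0"
      "(\<Sum>i\<in>range Inr \<union> Inl ` (S - {x, y}). c i *\<^sub>R ?w i) = 0" unfolding positively_dependent_def by blast
    have eq: "(\<Sum>i\<in>S - {x, y}. c (Inl i) *\<^sub>R v i) = c (Inr False) *\<^sub>R q + c (Inr True) *\<^sub>R q'"
      using c(3) fin notin unfolding range_Inr by (simp add: sums apex_pair_def algebra_simps)
    show False
    proof (cases "c (Inr True) = 0")
      case False
      let ?B = "insert q (v ` (S - {x, y}))"
      have "c (Inr True) *\<^sub>R q' = (\<Sum>i\<in>S - {x, y}. c (Inl i) *\<^sub>R v i) - c (Inr False) *\<^sub>R q"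
        using eq by simp
      also have "\<dots> \<in> span ?B"
        by (intro span_diff span_sum span_scale span_base) auto
      finally have "q' \<in> span ?B" using False by (rule span_scale_cancel)
      then show False using q'(2) xy by blast
    next
      case True
      show False
      proof (cases "c (Inr False) = 0")
        case False
        then have "q \<in> span (v ` (S - {x, y}))" using eq True by (intro spanI) auto
        moreover have "span (v ` (S - {x, y})) \<subseteq> span (v ` (S - {x}))" by (intro span_mono) auto
        ultimately show False using q[OF xy(1)] by auto
      next
        case F: True
        then obtain i where "i \<in> S - {x, y}" "c (Inl i) \<noteq> 0" using c(2) True unfolding range_Inr by auto
        then show False
          using pdI[of "S - {x, y}" "\<lambda>i. c (Inl i)" i] c(1) eq F True by auto
      qed
    qed
  qed
  have Inr_minus: "?T - {Inr b, Inl x} = insert (Inr (\<not> b)) (Inl ` (S - {x}))" for b x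
    unfolding range_Inr by (cases b) auto
  have "even (card {x\<in>?T. hit (\<lambda>i r. \<phi> r \<bullet> ?w i) DIM('e) (?T - {x})})"
  proof (rule even_card_hit_facets)
    show "card ?T = DIM('e) + 2"
      using fin card by (subst card_Un_disjoint) (auto simp: card_image range_Inr)
    fix x y assume xy: "x \<in> ?T" "y \<in> ?T" "x \<noteq> y"
    have 1: "?T - {Inr b, Inr (\<not> b)} = Inl ` S" for b
      unfolding range_Inr by (cases b) auto
    have 2: "?T - {Inl x, Inl y} = range Inr \<union> Inl ` (S - {x, y})" for x y by auto
    have "\<not> positively_dependent ?w (?T - {x, y})"
    proof (cases x)
      case (Inl a)
      then show ?thesis
      proof (cases y)
        case (Inl b)
        then show ?thesis using \<open>x = Inl a\<close> xy two_gen[of a b] 2 by auto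
      next
        case (Inr b)
        then show ?thesis using \<open>x = Inl a\<close> xy one_gen[of a "\<not> b"] Inr_minus[of b a]
          by (auto simp: insert_commute)
      qed
    next
      case (Inr b)
      then show ?thesis
      proof (cases y)
        case (Inl a)
        then show ?thesis using \<open>x = Inr b\<close> xy one_gen[of a "\<not> b"] Inr_minus[of b a] by auto
      next
        case (Inr b')
        then have "b' = (\<not> b)" using \<open>x = Inr b\<close> xy by auto
        then show ?thesis using \<open>x = Inr b\<close> Inr none 1[of b] by simp
      qed
    qed
    then show "\<not> hit (\<lambda>i r. \<phi> r \<bullet> ?w i) DIM('e) (?T - {x, y})"
      unfolding hit_iff_positively_dependent[OF \<phi>] .
  qed (use fin in auto)
  then have "(\<Sum>x\<in>?T. of_bool (positively_dependent ?w (?T - {x})) :: bit) = 0"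
    using fin unfolding hit_iff_positively_dependent[OF \<phi>]
    by (subst sum_of_bool_bit) (auto simp only: of_nat_bit_eq_0_iff finite_Un finite_imageI finite)
  also have "(\<Sum>x\<in>?T. of_bool (positively_dependent ?w (?T - {x})) :: bit) =
      (\<Sum>x\<in>S. of_bool (positively_dependent ?w (?T - {Inl x}))) +
      (\<Sum>x\<in>range Inr. of_bool (positively_dependent ?w (?T - {x})))"
  proof -
    have "(\<Sum>x\<in>Inl ` S. of_bool (positively_dependent ?w (?T - {x})) :: bit) =
        (\<Sum>x\<in>S. of_bool (positively_dependent ?w (?T - {Inl x})))"
      by (rule sum.reindex_cong[where l=Inl]) auto
    moreover have "Inl ` S \<inter> range Inr = ({} :: ('i + bool) set)" "finite (Inl ` S :: ('i + bool) set)"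
      "finite (range Inr :: ('i + bool) set)"
      using fin by auto
    ultimately show ?thesis by (simp only: sum.union_disjoint)
  qed
  also have "(\<Sum>x\<in>range Inr. of_bool (positively_dependent ?w (?T - {x})) :: bit) =
      of_bool (in_cone q v S) + of_bool (in_cone q' v S)"
  proof -
    have "?T - {Inr False} = insert (Inr True) (Inl ` S)" "?T - {Inr True} = insert (Inr False) (Inl ` S)"
      unfolding range_Inr by auto
    then show ?thesis using one[OF order_refl, of True] one[OF order_refl, of False]
      unfolding range_Inr by (simp add: add.commute)
  qed
  also have "(\<Sum>x\<in>S. of_bool (positively_dependent ?w (?T - {Inl x})) :: bit) =
      (\<Sum>x\<in>S. of_bool (positively_dependent ?w (Inl ` (S - {x}) \<union> range Inr)))"
  proof (intro sum.cong refl arg_cong[where f=of_bool] arg_cong[where f="positively_dependent ?w"])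
    show "?T - {Inl x} = Inl ` (S - {x}) \<union> range Inr" for x by auto
  qed
  finally have "(\<Sum>x\<in>S. of_bool (positively_dependent ?w (Inl ` (S - {x}) \<union> range Inr))) +
      (of_bool (in_cone q v S) + of_bool (in_cone q' v S)) = (0::bit)" .
  moreover have "a + b = 0 \<Longrightarrow> b = a" for a b :: bit by (cases a; cases b) auto
  ultimately show ?thesis by blast
qed

section \<open>Linking numbers as cone crossings\<close>

text \<open>Homogeneous coordinates turn the crossing of the cone over \<open>f\<close> with \<open>g\<close> into a membership in
  a convex cone: \<open>p = \<Sum> b\<^sub>w g w - \<Sum> a\<^sub>v f v\<close> with \<open>\<Sum> b - \<Sum> a = 1\<close> says that the ray from the
  apex \<open>p\<close> through a point of \<open>g \<tau>\<close> ends in a point of \<open>f \<sigma>\<close>. The Boolean tells the two factors of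
  the join apart.\<close>

definition join_vector :: "('a \<Rightarrow> 'b::real_vector) \<Rightarrow> ('a \<Rightarrow> 'b) \<Rightarrow> 'a \<times> bool \<Rightarrow> 'b \<times> real" where
  "join_vector f g = (\<lambda>(v, b). if b then (g v, 1) else (- f v, -1))"

definition join :: "'a set \<Rightarrow> 'a set \<Rightarrow> ('a \<times> bool) set" where
  "join \<sigma> \<tau> = (\<lambda>v. (v, False)) ` \<sigma> \<union> (\<lambda>v. (v, True)) ` \<tau>"

lemma finite_join [simp]: "finite \<sigma> \<Longrightarrow> finite \<tau> \<Longrightarrow> finite (join \<sigma> \<tau>)"
  by (simp add: join_def)

lemma mem_join [simp]: "(v, False) \<in> join \<sigma> \<tau> \<longleftrightarrow> v \<in> \<sigma>" "(v, True) \<in> join \<sigma> \<tau> \<longleftrightarrow> v \<in> \<tau>"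
  by (auto simp: join_def)

lemma Ball_join: "(\<forall>i\<in>join \<sigma> \<tau>. P i) \<longleftrightarrow> (\<forall>v\<in>\<sigma>. P (v, False)) \<and> (\<forall>v\<in>\<tau>. P (v, True))"
  by (auto simp: join_def)

lemma Bex_join: "(\<exists>i\<in>join \<sigma> \<tau>. P i) \<longleftrightarrow> (\<exists>v\<in>\<sigma>. P (v, False)) \<or> (\<exists>v\<in>\<tau>. P (v, True))"
  by (auto simp: join_def)

lemma sum_join:
  fixes h :: "'a \<times> bool \<Rightarrow> 'c::comm_monoid_add"
  assumes "finite \<sigma>" "finite \<tau>"
  shows "(\<Sum>i\<in>join \<sigma> \<tau>. h i) = (\<Sum>v\<in>\<sigma>. h (v, False)) + (\<Sum>v\<in>\<tau>. h (v, True))"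
  unfolding join_def using assms
  by (subst sum.union_disjoint) (auto simp: sum.reindex inj_on_def)

lemma card_join: "finite \<sigma> \<Longrightarrow> finite \<tau> \<Longrightarrow> card (join \<sigma> \<tau>) = card \<sigma> + card \<tau>"
  unfolding join_def by (subst card_Un_disjoint) (auto simp: card_image inj_on_def)

lemma join_minus:
  "join \<sigma> \<tau> - {(v, False)} = join (\<sigma> - {v}) \<tau>" "join \<sigma> \<tau> - {(v, True)} = join \<sigma> (\<tau> - {v})"
  by (auto simp: join_def)

lemma sum_join_vector:
  assumes "finite \<sigma>" "finite \<tau>"
  shows "(\<Sum>i\<in>join \<sigma> \<tau>. c i *\<^sub>R join_vector f g i) =
    ((\<Sum>v\<in>\<tau>. c (v, True) *\<^sub>R g v) - (\<Sum>v\<in>\<sigma>. c (v, False) *\<^sub>R f v),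
     (\<Sum>v\<in>\<tau>. c (v, True)) - (\<Sum>v\<in>\<sigma>. c (v, False)))"
  using assms
  by (subst sum_join) (auto simp: join_vector_def sum_negf sum_prod[symmetric] prod_eq_iff fst_sum snd_sum)

text \<open>The last coordinate makes the total weights on the two factors equal; division by them
  yields a common point of the two hulls.\<close>

lemma positively_dependent_join:
  fixes f g :: "'a \<Rightarrow> 'b::real_vector"
  assumes "finite \<sigma>" "finite \<tau>" "convex hull (f ` \<sigma>) \<inter> convex hull (g ` \<tau>) = {}"
  shows "\<not> positively_dependent (join_vector f g) (join \<sigma> \<tau>)"
proof
  assume "positively_dependent (join_vector f g) (join \<sigma> \<tau>)"
  then obtain c where c: "\<forall>v\<in>\<sigma>. 0 \<le> c (v, False)" "\<forall>v\<in>\<tau>. 0 \<le> c (v, True)"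
    "(\<exists>v\<in>\<sigma>. c (v, False) \<noteq> 0) \<or> (\<exists>v\<in>\<tau>. c (v, True) \<noteq> 0)"
    "(\<Sum>v\<in>\<tau>. c (v, True) *\<^sub>R g v) = (\<Sum>v\<in>\<sigma>. c (v, False) *\<^sub>R f v)"
    "(\<Sum>v\<in>\<tau>. c (v, True)) = (\<Sum>v\<in>\<sigma>. c (v, False))"
    unfolding positively_dependent_def sum_join_vector[OF assms(1,2)] Ball_join Bex_join
    by (auto simp: zero_prod_def)
  define s where "s = (\<Sum>v\<in>\<sigma>. c (v, False))"
  have "s \<noteq> 0"
  proof
    assume "s = 0"
    then have "\<forall>v\<in>\<sigma>. c (v, False) = 0" "\<forall>v\<in>\<tau>. c (v, True) = 0"
      using c assms(1,2) by (auto simp: s_def sum_nonneg_eq_0_iff)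
    then show False using c(3) by blast
  qed
  moreover have "s \<ge> 0" unfolding s_def using c(1) by (intro sum_nonneg) auto
  ultimately have s: "s > 0" by simp
  have "(\<Sum>v\<in>\<sigma>. (c (v, False) / s) *\<^sub>R f v) \<in> convex hull (f ` \<sigma>)"
    using c(1) s assms(1)
    by (intro convex_sum convex_convex_hull) (auto simp: hull_inc s_def simp flip: sum_divide_distrib)
  moreover have "(\<Sum>v\<in>\<tau>. (c (v, True) / s) *\<^sub>R g v) \<in> convex hull (g ` \<tau>)"
    using c(2,5) s assms(2)
    by (intro convex_sum convex_convex_hull) (auto simp: hull_inc s_def simp flip: sum_divide_distrib)
  moreover have "(\<Sum>v\<in>\<tau>. (c (v, True) / s) *\<^sub>R g v) = (\<Sum>v\<in>\<sigma>. (c (v, False) / s) *\<^sub>R f v)"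
    using arg_cong[OF c(4), of "\<lambda>x. (1 / s) *\<^sub>R x"] by (simp add: scaleR_sum_right)
  ultimately show False using assms(3) by auto
qed

lemma homogeneous_span_imp_affine_hull:
  fixes p :: "'b::real_vector"
  assumes "finite W" "(p, 1) \<in> span ((\<lambda>w. (w, 1::real)) ` W)"
  shows "p \<in> affine hull W"
proof -
  obtain u where "(p, 1) = (\<Sum>x\<in>(\<lambda>w. (w, 1::real)) ` W. u x *\<^sub>R x)"
    using assms by (auto simp: span_finite)
  also have "\<dots> = (\<Sum>w\<in>W. u (w, 1) *\<^sub>R (w, 1))" by (subst sum.reindex) (auto simp: inj_on_def)
  finally have "p = (\<Sum>w\<in>W. u (w, 1) *\<^sub>R w)" "1 = (\<Sum>w\<in>W. u (w, 1))"
    by (auto simp: prod_eq_iff fst_sum snd_sum)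
  then show ?thesis using assms(1) by (auto simp: affine_hull_finite intro!: exI[of _ "\<lambda>w. u (w, 1)"])
qed

lemma in_general_position_mono:
  assumes "in_general_position p V" "U \<subseteq> V"
  shows "in_general_position p U"
  using assms unfolding in_general_position_def by (meson order_trans)

text \<open>The point behind a join vector, without sign and height. Signs do not affect spans, so
  general position of an apex can be tested on these points.\<close>

definition vertex_image :: "('a \<Rightarrow> 'b) \<Rightarrow> ('a \<Rightarrow> 'b) \<Rightarrow> 'a \<times> bool \<Rightarrow> 'b" where
  "vertex_image f g = (\<lambda>(v, b). if b then g v else f v)"

lemma span_join_vector:
  "span (join_vector f g ` U) \<subseteq> span ((\<lambda>w. (w, 1::real)) ` vertex_image f g ` U)"
proof (rule span_minimal[OF image_subsetI subspace_span])
  fix i assume i: "i \<in> U"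
  let ?W = "(\<lambda>w. (w, 1::real)) ` vertex_image f g ` U"
  have h: "(vertex_image f g i, 1) \<in> span ?W" using i by (intro span_base) auto
  have "join_vector f g i = (vertex_image f g i, 1) \<or> join_vector f g i = - (vertex_image f g i, 1)"
    by (auto simp: join_vector_def vertex_image_def split: prod.splits)
  then show "join_vector f g i \<in> span ?W" using h span_neg by metis
qed

lemma not_in_span_join:
  fixes p :: "'b::euclidean_space"
  assumes "in_general_position p V" "finite U" "card U \<le> DIM('b)" "vertex_image f g ` U \<subseteq> V"
  shows "(p, 1) \<notin> span (join_vector f g ` U)"
proof
  assume "(p, 1) \<in> span (join_vector f g ` U)"
  then have "p \<in> affine hull (vertex_image f g ` U)"
    using span_join_vector[of f g U] assms(2) by (intro homogeneous_span_imp_affine_hull) auto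
  then show False using assms card_image_le[OF assms(2), of "vertex_image f g"]
    unfolding in_general_position_def by (meson finite_imageI order_trans)
qed

lemma not_in_span_join_apex:
  fixes p q :: "'b::euclidean_space"
  assumes "in_general_position q (insert p V)" "finite U" "card U < DIM('b)" "vertex_image f g ` U \<subseteq> V"
  shows "(q, 1) \<notin> span (insert (p, 1) (join_vector f g ` U))"
proof
  let ?W = "insert p (vertex_image f g ` U)"
  assume *: "(q, 1) \<in> span (insert (p, 1) (join_vector f g ` U))"
  have "span (insert (p, 1) (join_vector f g ` U)) \<subseteq> span ((\<lambda>w. (w, 1::real)) ` ?W)"
  proof (rule span_minimal[OF _ subspace_span])
    have "join_vector f g ` U \<subseteq> span ((\<lambda>w. (w, 1::real)) ` vertex_image f g ` U)"
      using span_superset[of "join_vector f g ` U"] span_join_vector[of f g U] by (rule order_trans)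
    also have "\<dots> \<subseteq> span ((\<lambda>w. (w, 1::real)) ` ?W)" by (intro span_mono) auto
    finally show "insert (p, 1) (join_vector f g ` U) \<subseteq> span ((\<lambda>w. (w, 1::real)) ` ?W)"
      by (auto intro: span_base)
  qed
  then have "q \<in> affine hull ?W" using * assms(2) by (intro homogeneous_span_imp_affine_hull) auto
  moreover have "card ?W \<le> DIM('b)"
    using card_insert_le_m1[of "DIM('b)" "vertex_image f g ` U" p]
      card_image_le[OF assms(2), of "vertex_image f g"] assms(3) by linarith
  ultimately show False using assms unfolding in_general_position_def
    by (meson finite_imageI finite_insert insert_mono)
qed

text \<open>Intersections of the cone with the second image, recorded by pairs of simplices and not
  by points, so that their parity is a double sum over two chains.\<close>

definition crossings :: "'b::real_vector \<Rightarrow> ('a \<Rightarrow> 'b) \<Rightarrow> 'a set set \<Rightarrow> ('a \<Rightarrow> 'b) \<Rightarrow> 'a set set \<Rightarrow>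
    ('a set \<times> 'a set) set" where
  "crossings p f \<C> g \<D> = {(\<sigma>, \<tau>). \<sigma> \<in> \<C> \<and> \<tau> \<in> \<D> \<and> in_cone (p, 1) (join_vector f g) (join \<sigma> \<tau>)}"

lemma of_nat_card_crossings:
  assumes "finite \<C>" "finite \<D>"
  shows "(of_nat (card (crossings p f \<C> g \<D>)) :: bit) =
    (\<Sum>\<sigma>\<in>\<C>. \<Sum>\<tau>\<in>\<D>. of_bool (in_cone (p, 1) (join_vector f g) (join \<sigma> \<tau>)))"
proof -
  have "crossings p f \<C> g \<D> =
      {x\<in>\<C> \<times> \<D>. in_cone (p, 1) (join_vector f g) (join (fst x) (snd x))}"
    by (auto simp: crossings_def)
  then show ?thesis
    using assms sum_of_bool_bit[of "\<C> \<times> \<D>" "\<lambda>x. in_cone (p, 1) (join_vector f g) (join (fst x) (snd x))"]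
    by (simp only: sum.cartesian_product finite_cartesian_product split_def)
qed

text \<open>The move from \<open>p\<close> to \<open>q\<close> changes the indicator of each pair by
  the coboundary of \<open>\<Omega>\<close>, which sums to zero over a product of cycles. Since both
  apexes enter one relation, \<open>q\<close> has to be generic relative to \<open>p\<close>
  too.\<close>

lemma parity_crossings_apex:
  fixes f g :: "'a \<Rightarrow> 'b::euclidean_space"
  assumes \<C>: "mod2_cycle k \<C>" and \<D>: "mod2_cycle l \<D>" and dim: "DIM('b) = k + l + 1"
    and disj: "\<And>\<sigma> \<tau>. \<sigma> \<in> \<C> \<Longrightarrow> \<tau> \<in> \<D> \<Longrightarrow> convex hull (f ` \<sigma>) \<inter> convex hull (g ` \<tau>) = {}"
    and p: "in_general_position p (f ` \<Union>\<C> \<union> g ` \<Union>\<D>)"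
    and q: "in_general_position q (insert p (f ` \<Union>\<C> \<union> g ` \<Union>\<D>))"
  shows "even (card (crossings p f \<C> g \<D>)) \<longleftrightarrow> even (card (crossings q f \<C> g \<D>))"
proof -
  let ?V = "f ` \<Union>\<C> \<union> g ` \<Union>\<D>" and ?v = "join_vector f g"
  define \<Omega> :: "'a set \<Rightarrow> 'a set \<Rightarrow> bit" where
    "\<Omega> \<sigma> \<tau> = of_bool (positively_dependent (apex_pair ?v (p, 1) (q, 1)) (Inl ` join \<sigma> \<tau> \<union> range Inr))" for \<sigma> \<tau>
  have fin: "finite \<C>" "finite \<D>" using \<C> \<D> by (auto simp: mod2_cycle_def)
  have q': "in_general_position q ?V" using in_general_position_mono[OF q] by auto
  have "of_bool (in_cone (p, 1) ?v (join \<sigma> \<tau>)) + of_bool (in_cone (q, 1) ?v (join \<sigma> \<tau>)) =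
      (\<Sum>x\<in>\<sigma>. \<Omega> (\<sigma> - {x}) \<tau>) + (\<Sum>y\<in>\<tau>. \<Omega> \<sigma> (\<tau> - {y}))"
    if \<sigma>\<tau>: "\<sigma> \<in> \<C>" "\<tau> \<in> \<D>" for \<sigma> \<tau>
  proof -
    have s: "finite \<sigma>" "finite \<tau>" "card \<sigma> = Suc k" "card \<tau> = Suc l"
      using \<sigma>\<tau> \<C> \<D> by (auto simp: mod2_cycle_def)
    have cj: "card (join \<sigma> \<tau>) = DIM('b \<times> real)" using s dim by (simp add: card_join)
    have sub: "vertex_image f g ` U \<subseteq> ?V" if "U \<subseteq> join \<sigma> \<tau>" for U
      using that \<sigma>\<tau> by (fastforce simp: vertex_image_def join_def)
    have fj: "finite (join \<sigma> \<tau>)" using s by simp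
    have "of_bool (in_cone (p, 1) ?v (join \<sigma> \<tau>)) + of_bool (in_cone (q, 1) ?v (join \<sigma> \<tau>)) =
      (\<Sum>i\<in>join \<sigma> \<tau>. of_bool (positively_dependent (apex_pair ?v (p, 1) (q, 1))
        (Inl ` (join \<sigma> \<tau> - {i}) \<union> range Inr)) :: bit)"
    proof (rule parity_two_apexes[OF fj cj])
      show "\<not> positively_dependent ?v (join \<sigma> \<tau>)"
        using s disj[OF \<sigma>\<tau>] by (intro positively_dependent_join)
      fix i assume i: "i \<in> join \<sigma> \<tau>"
      have c: "card (join \<sigma> \<tau> - {i}) \<le> DIM('b)" using cj i fj by simp
      show "(p, 1) \<notin> span (?v ` (join \<sigma> \<tau> - {i}))"
        by (rule not_in_span_join[OF p finite_Diff[OF fj] c sub[OF Diff_subset]])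
      show "(q, 1) \<notin> span (?v ` (join \<sigma> \<tau> - {i}))"
        by (rule not_in_span_join[OF q' finite_Diff[OF fj] c sub[OF Diff_subset]])
      fix j assume j: "j \<in> join \<sigma> \<tau>" "i \<noteq> j"
      then have c2: "card (join \<sigma> \<tau> - {i, j}) < DIM('b)" using cj i fj dim by (simp add: card_Diff_subset)
      show "(q, 1) \<notin> span (insert (p, 1) (?v ` (join \<sigma> \<tau> - {i, j})))"
        by (rule not_in_span_join_apex[OF q finite_Diff[OF fj] c2 sub[OF Diff_subset]])
    qed
    also have "\<dots> = (\<Sum>x\<in>\<sigma>. \<Omega> (\<sigma> - {x}) \<tau>) + (\<Sum>y\<in>\<tau>. \<Omega> \<sigma> (\<tau> - {y}))"
      unfolding sum_join[OF s(1,2)] join_minus \<Omega>_def ..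
    finally show ?thesis .
  qed
  then have "(\<Sum>\<sigma>\<in>\<C>. \<Sum>\<tau>\<in>\<D>. of_bool (in_cone (p, 1) ?v (join \<sigma> \<tau>)) + of_bool (in_cone (q, 1) ?v (join \<sigma> \<tau>))) =
      (\<Sum>\<sigma>\<in>\<C>. \<Sum>\<tau>\<in>\<D>. (\<Sum>x\<in>\<sigma>. \<Omega> (\<sigma> - {x}) \<tau>) + (\<Sum>y\<in>\<tau>. \<Omega> \<sigma> (\<tau> - {y})))"
    by (intro sum.cong) auto
  also have "\<dots> = (\<Sum>\<tau>\<in>\<D>. \<Sum>\<sigma>\<in>\<C>. \<Sum>x\<in>\<sigma>. \<Omega> (\<sigma> - {x}) \<tau>) + (\<Sum>\<sigma>\<in>\<C>. \<Sum>\<tau>\<in>\<D>. \<Sum>y\<in>\<tau>. \<Omega> \<sigma> (\<tau> - {y}))"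
    by (simp only: sum.distrib) (subst sum.swap, rule refl)
  also have "\<dots> = 0"
    using sum_facets_cycle[OF \<C>, of "\<lambda>\<sigma>. \<Omega> \<sigma> \<tau>" for \<tau>] sum_facets_cycle[OF \<D>, of "\<lambda>\<tau>. \<Omega> \<sigma> \<tau>" for \<sigma>] by simp
  finally have "(of_nat (card (crossings p f \<C> g \<D>)) :: bit) + of_nat (card (crossings q f \<C> g \<D>)) = 0"
    unfolding of_nat_card_crossings[OF fin] by (simp only: sum.distrib)
  then show ?thesis unfolding of_nat_bit
    by (cases "odd (card (crossings p f \<C> g \<D>))"; cases "odd (card (crossings q f \<C> g \<D>))") auto
qed

text \<open>Affine hulls of at most \<open>DIM('b)\<close> points are null sets, and finitely many
  of them do not cover the space.\<close>

lemma ex_general_position: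
  fixes V :: "'b::euclidean_space set"
  assumes "finite V"
  shows "\<exists>p. in_general_position p V"
proof -
  let ?N = "\<Union>W\<in>{W. W \<subseteq> V \<and> card W \<le> DIM('b)}. affine hull W"
  have "negligible ?N"
  proof (rule negligible_Union)
    show "finite ((\<lambda>W. affine hull W) ` {W. W \<subseteq> V \<and> card W \<le> DIM('b)})" using assms by simp
    fix T assume "T \<in> (\<lambda>W. affine hull W) ` {W. W \<subseteq> V \<and> card W \<le> DIM('b)}"
    then obtain W where W: "T = affine hull W" "W \<subseteq> V" "card W \<le> DIM('b)" by auto
    then have "finite W" using assms finite_subset by blast
    then have "interior T = {}" using empty_interior_affine_hull[of W] W by simp
    then show "negligible T"
      using W by (simp add: negligible_convex_interior affine_imp_convex)
  qed
  then obtain p where "p \<notin> ?N" using non_negligible_UNIV by (metis UNIV_eq_I)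
  then show ?thesis unfolding in_general_position_def by blast
qed

section \<open>Maps linear on simplices, and carriers\<close>

lemma convex_linear_comb:
  fixes f :: "'a::real_vector \<Rightarrow> 'b::real_vector"
  assumes C: "convex C"
    and lin: "\<And>x y t. x \<in> C \<Longrightarrow> y \<in> C \<Longrightarrow> t \<in> {0..1} \<Longrightarrow>
      f ((1 - t) *\<^sub>R x + t *\<^sub>R y) = (1 - t) *\<^sub>R f x + t *\<^sub>R f y"
    and "finite S" "S \<subseteq> C" "\<forall>v\<in>S. 0 \<le> u v" "sum u S = (1::real)"
  shows "f (\<Sum>v\<in>S. u v *\<^sub>R v) = (\<Sum>v\<in>S. u v *\<^sub>R f v)"
  using assms(3-6)
proof (induction S arbitrary: u rule: finite_induct)
  case (insert a S)
  have suma: "u a + sum u S = 1" using insert by simp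
  show ?case
  proof (cases "u a = 1")
    case True
    then have "\<forall>v\<in>S. u v = 0" using insert suma by (simp add: sum_nonneg_eq_0_iff)
    then have "(\<Sum>v\<in>S. u v *\<^sub>R v) = 0" "(\<Sum>v\<in>S. u v *\<^sub>R f v) = 0" by (auto intro: sum.neutral)
    then show ?thesis using insert True by simp
  next
    case False
    have s: "1 - u a > 0" "u a \<ge> 0" using insert suma False sum_nonneg[of S u] by auto
    let ?w = "\<lambda>v. u v / (1 - u a)"
    have w: "\<forall>v\<in>S. 0 \<le> ?w v" "sum ?w S = 1"
      using insert s suma by (auto simp flip: sum_divide_distrib)
    let ?x = "\<Sum>v\<in>S. ?w v *\<^sub>R v"
    have x: "?x \<in> C" using insert w C by (intro convex_sum) auto
    have scale: "(\<Sum>v\<in>S. u v *\<^sub>R h v) = (1 - u a) *\<^sub>R (\<Sum>v\<in>S. ?w v *\<^sub>R h v)" for h :: "_ \<Rightarrow> 'x::real_vector"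
      using s by (simp add: scaleR_sum_right)
    have "f (\<Sum>v\<in>insert a S. u v *\<^sub>R v) = f ((1 - u a) *\<^sub>R ?x + u a *\<^sub>R a)"
      using insert scale[of "\<lambda>v. v"] by (simp add: add.commute)
    also have "\<dots> = (1 - u a) *\<^sub>R f ?x + u a *\<^sub>R f a"
      using insert x s by (intro lin) auto
    also have "f ?x = (\<Sum>v\<in>S. ?w v *\<^sub>R f v)" using insert w by (intro insert.IH) auto
    finally show ?thesis using insert scale[of f] by (simp add: add.commute)
  qed
qed simp

lemma linear_on_simplices_comb:
  assumes "linear_on_simplices A f" "\<sigma> \<in> A" "finite \<sigma>" "\<forall>v\<in>\<sigma>. 0 \<le> u v" "sum u \<sigma> = 1"
  shows "f (\<Sum>v\<in>\<sigma>. u v *\<^sub>R v) = (\<Sum>v\<in>\<sigma>. u v *\<^sub>R f v)"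
  using assms unfolding linear_on_simplices_def
  by (intro convex_linear_comb[of "convex hull \<sigma>"]) (auto simp: hull_subset)

lemma image_convex_hull_linear:
  assumes "linear_on_simplices A f" "\<sigma> \<in> A" "finite \<sigma>"
  shows "f ` (convex hull \<sigma>) = convex hull (f ` \<sigma>)"
proof
  show "f ` (convex hull \<sigma>) \<subseteq> convex hull (f ` \<sigma>)"
  proof
    fix y assume "y \<in> f ` (convex hull \<sigma>)"
    then obtain u where u: "\<forall>v\<in>\<sigma>. 0 \<le> u v" "sum u \<sigma> = 1" "y = f (\<Sum>v\<in>\<sigma>. u v *\<^sub>R v)"
      using assms(3) by (auto simp: convex_hull_finite)
    then have "y = (\<Sum>v\<in>\<sigma>. u v *\<^sub>R f v)" using linear_on_simplices_comb[OF assms] by simp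
    also have "\<dots> \<in> convex hull (f ` \<sigma>)" using u assms(3)
      by (intro convex_sum convex_convex_hull) (auto simp: hull_inc)
    finally show "y \<in> convex hull (f ` \<sigma>)" .
  qed
  have "convex (f ` (convex hull \<sigma>))"
  proof (rule convexI)
    fix a b and s t :: real
    assume ab: "a \<in> f ` (convex hull \<sigma>)" "b \<in> f ` (convex hull \<sigma>)" and st: "0 \<le> s" "0 \<le> t" "s + t = 1"
    then obtain x y where xy: "x \<in> convex hull \<sigma>" "y \<in> convex hull \<sigma>" "a = f x" "b = f y" by auto
    have s1: "s = 1 - t" using st by simp
    have "f (s *\<^sub>R x + t *\<^sub>R y) = s *\<^sub>R a + t *\<^sub>R b"
      unfolding s1 xy(3,4) using assms(1,2) xy(1,2) st unfolding linear_on_simplices_def by force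
    moreover have "s *\<^sub>R x + t *\<^sub>R y \<in> convex hull \<sigma>"
      using xy st by (intro convexD[OF convex_convex_hull]) auto
    ultimately show "s *\<^sub>R a + t *\<^sub>R b \<in> f ` (convex hull \<sigma>)" by (metis imageI)
  qed
  then show "convex hull (f ` \<sigma>) \<subseteq> f ` (convex hull \<sigma>)"
    by (intro hull_minimal image_mono hull_subset)
qed

lemma open_simplex_carrier_unique:
  assumes "geometric_complex A" "\<rho> \<in> A" "\<sigma> \<in> A" "x \<in> open_simplex \<rho>" "x \<in> open_simplex \<sigma>"
  shows "\<rho> = \<sigma>"
proof
  note AD = geometric_complexD[OF assms(1)]
  show "\<rho> \<subseteq> \<sigma>"
    using open_simplex_subset_face[OF assms(1-4)] open_simplex_subset[OF AD(2)[OF assms(3)]] assms(5) by auto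
  show "\<sigma> \<subseteq> \<rho>"
    using open_simplex_subset_face[OF assms(1,3,2,5)] open_simplex_subset[OF AD(2)[OF assms(2)]] assms(4) by auto
qed

lemma convex_hull_subset_body: "\<sigma> \<in> K \<Longrightarrow> convex hull \<sigma> \<subseteq> body K"
  by (auto simp: body_def)

lemma body_carrier:
  assumes "geometric_complex A" "x \<in> body A"
  obtains \<sigma> where "\<sigma> \<in> A" "x \<in> open_simplex \<sigma>"
proof -
  note AD = geometric_complexD[OF assms(1)]
  obtain \<tau> where \<tau>: "\<tau> \<in> A" "x \<in> convex hull \<tau>" using assms(2) by (auto simp: body_def)
  then obtain \<sigma> where "\<sigma> \<subseteq> \<tau>" "\<sigma> \<noteq> {}" "x \<in> open_simplex \<sigma>"
    using convex_hull_open_simplex[OF AD(2)] by metis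
  then show ?thesis using that AD(5)[OF \<tau>(1)] by blast
qed

lemma card_subdivision_le:
  fixes K :: "'a::real_normed_vector set set"
  assumes K: "geometric_complex K" and A: "subdivision A K" and m: "\<forall>\<sigma>\<in>K. card \<sigma> \<le> m" and \<sigma>: "\<sigma> \<in> A"
  shows "card \<sigma> \<le> m"
proof -
  have gA: "geometric_complex A" using A by (simp add: subdivision_def)
  obtain \<tau> where \<tau>: "\<tau> \<in> K" "convex hull \<sigma> \<subseteq> convex hull \<tau>" using A \<sigma> by (auto simp: subdivision_def)
  have "\<sigma> \<subseteq> convex hull \<tau>" using hull_subset[of \<sigma> convex] \<tau>(2) by (rule order_trans)
  then have "card \<sigma> \<le> card \<tau>"
    using geometric_complexD(2,4)[OF K \<tau>(1)] geometric_complexD(2,4)[OF gA \<sigma>]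
    by (intro card_simplex_le)
  then show ?thesis using m \<tau> by auto
qed

text \<open>A vanishing coefficient would put \<open>(p, 1)\<close> into the span of at most
  \<open>DIM('b)\<close> join vectors.\<close>

lemma join_coefficient_nonzero:
  fixes f g :: "'a \<Rightarrow> 'b::euclidean_space"
  assumes p: "in_general_position p V" and U: "finite U" "card U \<le> DIM('b) + 1" "vertex_image f g ` U \<subseteq> V"
    and c: "(\<Sum>i\<in>U. c i *\<^sub>R join_vector f g i) = (p, 1)" and i: "i \<in> U"
  shows "c i \<noteq> 0"
proof
  assume "c i = 0"
  then have "(\<Sum>i\<in>U - {i}. c i *\<^sub>R join_vector f g i) = (p, 1)" using c U i by (simp add: sum.remove)
  moreover have "(\<Sum>i\<in>U - {i}. c i *\<^sub>R join_vector f g i) \<in> span (join_vector f g ` (U - {i}))"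
    by (intro span_sum span_scale span_base) auto
  moreover have "(p, 1) \<notin> span (join_vector f g ` (U - {i}))"
    by (rule not_in_span_join[OF p]) (use U i in auto)
  ultimately show False by simp
qed

text \<open>Two representations that differ at \<open>i\<close> have an affine combination whose
  coefficient at \<open>i\<close> vanishes; \<open>s\<close> is chosen for that.\<close>

lemma join_coefficients_unique:
  fixes f g :: "'a \<Rightarrow> 'b::euclidean_space"
  assumes p: "in_general_position p V" and U: "finite U" "card U \<le> DIM('b) + 1" "vertex_image f g ` U \<subseteq> V"
    and c: "(\<Sum>i\<in>U. c i *\<^sub>R join_vector f g i) = (p, 1)" and c': "(\<Sum>i\<in>U. c' i *\<^sub>R join_vector f g i) = (p, 1)"
    and i: "i \<in> U"
  shows "c i = c' i"
proof (rule ccontr)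
  assume ne: "c i \<noteq> c' i"
  define s where "s = c i / (c i - c' i)"
  have "(\<Sum>j\<in>U. (c j - s * (c j - c' j)) *\<^sub>R join_vector f g j) =
      (\<Sum>j\<in>U. c j *\<^sub>R join_vector f g j) -
      s *\<^sub>R ((\<Sum>j\<in>U. c j *\<^sub>R join_vector f g j) - (\<Sum>j\<in>U. c' j *\<^sub>R join_vector f g j))"
    unfolding scaleR_diff_right scaleR_sum_right sum_subtractf[symmetric]
    by (intro sum.cong refl) (simp add: algebra_simps)
  also have "\<dots> = (p, 1)" unfolding c c' by simp
  finally have "c i - s * (c i - c' i) \<noteq> 0" by (rule join_coefficient_nonzero[OF p U _ i])
  then show False using ne by (simp add: s_def)
qed

section \<open>Points of the cone intersection and crossing pairs of simplices\<close>

context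
  fixes K L A B :: "'a::real_normed_vector set set" and f g :: "'a \<Rightarrow> 'b::euclidean_space" and k l :: nat
  assumes K: "geometric_complex K" "\<forall>\<sigma>\<in>K. card \<sigma> \<le> Suc k" and L: "geometric_complex L" "\<forall>\<tau>\<in>L. card \<tau> \<le> Suc l"
    and A: "subdivision A K" "linear_on_simplices A f" and B: "subdivision B L" "linear_on_simplices B g"
    and dim: "DIM('b) = k + l + 1" and disj: "f ` body K \<inter> g ` body L = {}"
begin

text \<open>An intersection goes to the pair of carriers of \<open>x\<close> and \<open>y\<close>.
  The pair determines all coefficients, hence the point; and a pair with fewer than
  \<open>k + l + 2\<close> vertices is excluded by general position, so both carriers have full
  dimension.\<close>

lemma card_cone_intersections:
  assumes p: "in_general_position p (f ` \<Union>A \<union> g ` \<Union>B)"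
  shows "card (cone_intersections p K f L g) =
    card (crossings p f {\<sigma>\<in>A. card \<sigma> = Suc k} g {\<tau>\<in>B. card \<tau> = Suc l})"
proof -
  let ?V = "f ` \<Union>A \<union> g ` \<Union>B" and ?v = "join_vector f g"
  have gA: "geometric_complex A" and gB: "geometric_complex B" and bA: "body A = body K" and bB: "body B = body L"
    using A B by (auto simp: subdivision_def)
  note AD = geometric_complexD[OF gA] and BD = geometric_complexD[OF gB]
  have cA: "card \<sigma> \<le> Suc k" if "\<sigma> \<in> A" for \<sigma> using card_subdivision_le[OF K(1) A(1) K(2) that] .
  have cB: "card \<tau> \<le> Suc l" if "\<tau> \<in> B" for \<tau> using card_subdivision_le[OF L(1) B(1) L(2) that] .
  have cj: "finite (join \<sigma> \<tau>)" "card (join \<sigma> \<tau>) \<le> DIM('b) + 1" "vertex_image f g ` join \<sigma> \<tau> \<subseteq> ?V"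
    if "\<sigma> \<in> A" "\<tau> \<in> B" for \<sigma> \<tau>
  proof -
    show "finite (join \<sigma> \<tau>)" "card (join \<sigma> \<tau>) \<le> DIM('b) + 1"
      using AD(2)[OF that(1)] BD(2)[OF that(2)] cA[OF that(1)] cB[OF that(2)] dim by (auto simp: card_join)
    show "vertex_image f g ` join \<sigma> \<tau> \<subseteq> ?V"
      using that by (fastforce simp: vertex_image_def join_def)
  qed
  define \<Phi> where "\<Phi> = (\<lambda>(x, t::real, y). (THE \<sigma>. \<sigma> \<in> A \<and> x \<in> open_simplex \<sigma>, THE \<tau>. \<tau> \<in> B \<and> y \<in> open_simplex \<tau>))"
  have \<Phi>: "\<Phi> (x, t, y) = (\<sigma>, \<tau>)"
    if "\<sigma> \<in> A" "x \<in> open_simplex \<sigma>" "\<tau> \<in> B" "y \<in> open_simplex \<tau>" for x t y \<sigma> \<tau>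
  proof -
    have "(THE \<sigma>. \<sigma> \<in> A \<and> x \<in> open_simplex \<sigma>) = \<sigma>"
      by (rule the_equality) (use that open_simplex_carrier_unique[OF gA, of _ \<sigma> x] in blast)+
    moreover have "(THE \<tau>. \<tau> \<in> B \<and> y \<in> open_simplex \<tau>) = \<tau>"
      by (rule the_equality) (use that open_simplex_carrier_unique[OF gB, of _ \<tau> y] in blast)+
    ultimately show ?thesis by (simp add: \<Phi>_def)
  qed
  \<comment> \<open>Solving for the apex gives \<open>p = (1 / t) g y - ((1 - t) / t) f x\<close>,
    with weights of difference one, which is the relation in homogeneous coordinates. Here
    \<open>t\<close> is nonzero because the images are disjoint.\<close>
  have rep: "\<exists>\<sigma> \<tau> u w. \<sigma> \<in> A \<and> \<tau> \<in> B \<and> x \<in> open_simplex \<sigma> \<and> y \<in> open_simplex \<tau> \<and> 0 < t \<and> t < 1 \<and>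
      (\<forall>v\<in>\<sigma>. 0 < u v) \<and> sum u \<sigma> = 1 \<and> (\<Sum>v\<in>\<sigma>. u v *\<^sub>R v) = x \<and>
      (\<forall>v\<in>\<tau>. 0 < w v) \<and> sum w \<tau> = 1 \<and> (\<Sum>v\<in>\<tau>. w v *\<^sub>R v) = y \<and>
      (\<Sum>i\<in>join \<sigma> \<tau>. (if snd i then w (fst i) / t else u (fst i) * ((1 - t) / t)) *\<^sub>R ?v i) = (p, 1)"
    if xty: "(x, t, y) \<in> cone_intersections p K f L g" for x t y
  proof -
    have h: "x \<in> body A" "y \<in> body B" "0 \<le> t" "t < 1" "(1 - t) *\<^sub>R f x + t *\<^sub>R p = g y"
      using xty by (auto simp: cone_intersections_def bA bB)
    have t: "t > 0"
    proof (rule ccontr)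
      assume "\<not> t > 0"
      then have "f x = g y" using h by simp
      then show False using disj h(1,2) unfolding bA bB by blast
    qed
    obtain \<sigma> where \<sigma>: "\<sigma> \<in> A" "x \<in> open_simplex \<sigma>" using body_carrier[OF gA h(1)] .
    obtain \<tau> where \<tau>: "\<tau> \<in> B" "y \<in> open_simplex \<tau>" using body_carrier[OF gB h(2)] .
    obtain u where u: "\<forall>v\<in>\<sigma>. 0 < u v" "sum u \<sigma> = 1" "(\<Sum>v\<in>\<sigma>. u v *\<^sub>R v) = x"
      using \<sigma>(2) by (auto simp: open_simplex_def)
    obtain w where w: "\<forall>v\<in>\<tau>. 0 < w v" "sum w \<tau> = 1" "(\<Sum>v\<in>\<tau>. w v *\<^sub>R v) = y"
      using \<tau>(2) by (auto simp: open_simplex_def)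
    have fx: "(\<Sum>v\<in>\<sigma>. u v *\<^sub>R f v) = f x"
      using linear_on_simplices_comb[OF A(2) \<sigma>(1) AD(2)[OF \<sigma>(1)], of u] u by (simp add: less_imp_le)
    have gy: "(\<Sum>v\<in>\<tau>. w v *\<^sub>R g v) = g y"
      using linear_on_simplices_comb[OF B(2) \<tau>(1) BD(2)[OF \<tau>(1)], of w] w by (simp add: less_imp_le)
    have "(\<Sum>v\<in>\<tau>. (w v / t) *\<^sub>R g v) = (1 / t) *\<^sub>R (\<Sum>v\<in>\<tau>. w v *\<^sub>R g v)" by (simp add: scaleR_sum_right)
    moreover have "(\<Sum>v\<in>\<sigma>. (u v * ((1 - t) / t)) *\<^sub>R f v) = ((1 - t) / t) *\<^sub>R (\<Sum>v\<in>\<sigma>. u v *\<^sub>R f v)"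
      by (simp add: scaleR_sum_right mult.commute)
    moreover have "(1 / t) *\<^sub>R g y - ((1 - t) / t) *\<^sub>R f x = p"
      unfolding h(5)[symmetric] using t by (simp add: scaleR_add_right)
    moreover have "(\<Sum>v\<in>\<tau>. w v / t) - (\<Sum>v\<in>\<sigma>. u v * ((1 - t) / t)) = 1"
    proof -
      have "(\<Sum>v\<in>\<tau>. w v / t) = 1 / t" using w(2) by (simp flip: sum_divide_distrib)
      moreover have "(\<Sum>v\<in>\<sigma>. u v * ((1 - t) / t)) = (1 - t) / t"
        unfolding sum_distrib_right[symmetric] u(2) by simp
      moreover have "1 / t - (1 - t) / t = 1" using t by (simp add: field_simps)
      ultimately show ?thesis by (simp only:)
    qed
    ultimately have "(\<Sum>i\<in>join \<sigma> \<tau>. (if snd i then w (fst i) / t else u (fst i) * ((1 - t) / t)) *\<^sub>R ?v i) = (p, 1)"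
      using sum_join_vector[OF AD(2)[OF \<sigma>(1)] BD(2)[OF \<tau>(1)],
          of "\<lambda>i. if snd i then w (fst i) / t else u (fst i) * ((1 - t) / t)" f g]
      by (simp add: fx gy)
    then show ?thesis using \<sigma> \<tau> u w t h by blast
  qed
  have "bij_betw \<Phi> (cone_intersections p K f L g)
    (crossings p f {\<sigma>\<in>A. card \<sigma> = Suc k} g {\<tau>\<in>B. card \<tau> = Suc l})"
  proof (rule bij_betw_imageI)
    show "inj_on \<Phi> (cone_intersections p K f L g)"
    proof (rule inj_onI)
      fix z z' assume z: "z \<in> cone_intersections p K f L g" "z' \<in> cone_intersections p K f L g" "\<Phi> z = \<Phi> z'"
      obtain x t y x' t' y' where zz: "z = (x, t, y)" "z' = (x', t', y')" by (metis prod_cases3)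
      obtain \<sigma> \<tau> u w where 1: "\<sigma> \<in> A" "\<tau> \<in> B" "x \<in> open_simplex \<sigma>" "y \<in> open_simplex \<tau>" "0 < t" "t < 1"
        "sum u \<sigma> = 1" "(\<Sum>v\<in>\<sigma>. u v *\<^sub>R v) = x" "sum w \<tau> = 1" "(\<Sum>v\<in>\<tau>. w v *\<^sub>R v) = y"
        "(\<Sum>i\<in>join \<sigma> \<tau>. (if snd i then w (fst i) / t else u (fst i) * ((1 - t) / t)) *\<^sub>R ?v i) = (p, 1)"
        using rep[OF z(1)[unfolded zz]] by blast
      obtain \<sigma>' \<tau>' u' w' where 2: "\<sigma>' \<in> A" "\<tau>' \<in> B" "x' \<in> open_simplex \<sigma>'" "y' \<in> open_simplex \<tau>'" "0 < t'" "t' < 1"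
        "sum u' \<sigma>' = 1" "(\<Sum>v\<in>\<sigma>'. u' v *\<^sub>R v) = x'" "sum w' \<tau>' = 1" "(\<Sum>v\<in>\<tau>'. w' v *\<^sub>R v) = y'"
        "(\<Sum>i\<in>join \<sigma>' \<tau>'. (if snd i then w' (fst i) / t' else u' (fst i) * ((1 - t') / t')) *\<^sub>R ?v i) = (p, 1)"
        using rep[OF z(2)[unfolded zz]] by blast
      have eq: "\<sigma>' = \<sigma>" "\<tau>' = \<tau>"
        using z(3) \<Phi>[OF 1(1,3,2,4)] \<Phi>[OF 2(1,3,2,4)] unfolding zz by auto
      note uniq = join_coefficients_unique[OF p cj[OF 1(1,2)] 1(11) 2(11)[unfolded eq]]
      have w: "w v / t = w' v / t'" if "v \<in> \<tau>" for v using uniq[of "(v, True)"] that by simp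
      have u: "u v * ((1 - t) / t) = u' v * ((1 - t') / t')" if "v \<in> \<sigma>" for v
        using uniq[of "(v, False)"] that by simp
      have "1 / t = (\<Sum>v\<in>\<tau>. w v / t)" using 1(9) by (simp flip: sum_divide_distrib)
      also have "\<dots> = (\<Sum>v\<in>\<tau>. w' v / t')" using w by (intro sum.cong) auto
      also have "\<dots> = 1 / t'" using 2(9) eq by (simp flip: sum_divide_distrib)
      finally have tt: "t' = t" using 1(5) 2(5) by (simp add: field_simps)
      have "x' = x" using 1(5,6,8) 2(8) u tt eq by (auto intro!: sum.cong)
      moreover have "y' = y" using 1(5,10) 2(10) w tt eq by (auto intro!: sum.cong)
      ultimately show "z = z'" using zz tt by simp
    qed
    show "\<Phi> ` cone_intersections p K f L g =
        crossings p f {\<sigma>\<in>A. card \<sigma> = Suc k} g {\<tau>\<in>B. card \<tau> = Suc l}"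
    proof
      show "\<Phi> ` cone_intersections p K f L g \<subseteq> crossings p f {\<sigma>\<in>A. card \<sigma> = Suc k} g {\<tau>\<in>B. card \<tau> = Suc l}"
      proof
        fix q assume "q \<in> \<Phi> ` cone_intersections p K f L g"
        then obtain x t y where q: "q = \<Phi> (x, t, y)" and z: "(x, t, y) \<in> cone_intersections p K f L g" by auto
        obtain \<sigma> \<tau> u w where 1: "\<sigma> \<in> A" "\<tau> \<in> B" "x \<in> open_simplex \<sigma>" "y \<in> open_simplex \<tau>" "0 < t" "t < 1"
          "\<forall>v\<in>\<sigma>. 0 < u v" "\<forall>v\<in>\<tau>. 0 < w v"
          "(\<Sum>i\<in>join \<sigma> \<tau>. (if snd i then w (fst i) / t else u (fst i) * ((1 - t) / t)) *\<^sub>R ?v i) = (p, 1)"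
          using rep[OF z] by blast
        have cone: "in_cone (p, 1) ?v (join \<sigma> \<tau>)" unfolding in_cone_def
          by (rule exI[of _ "\<lambda>i. if snd i then w (fst i) / t else u (fst i) * ((1 - t) / t)"])
            (use 1 in \<open>auto simp: Ball_join less_imp_le\<close>)
        have "\<not> card (join \<sigma> \<tau>) \<le> DIM('b)"
        proof
          assume "card (join \<sigma> \<tau>) \<le> DIM('b)"
          then have "(p, 1) \<notin> span (?v ` join \<sigma> \<tau>)" using not_in_span_join[OF p] cj[OF 1(1,2)] by blast
          moreover have "(\<Sum>i\<in>join \<sigma> \<tau>. (if snd i then w (fst i) / t else u (fst i) * ((1 - t) / t)) *\<^sub>R ?v i)
              \<in> span (?v ` join \<sigma> \<tau>)" by (intro span_sum span_scale span_base) auto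
          ultimately show False using 1(9) by simp
        qed
        then have "card \<sigma> = Suc k" "card \<tau> = Suc l"
          using cA[OF 1(1)] cB[OF 1(2)] AD(2)[OF 1(1)] BD(2)[OF 1(2)] dim by (auto simp: card_join)
        then show "q \<in> crossings p f {\<sigma>\<in>A. card \<sigma> = Suc k} g {\<tau>\<in>B. card \<tau> = Suc l}"
          unfolding q \<Phi>[OF 1(1,3,2,4)] crossings_def using 1 cone by simp
      qed
      show "crossings p f {\<sigma>\<in>A. card \<sigma> = Suc k} g {\<tau>\<in>B. card \<tau> = Suc l} \<subseteq> \<Phi> ` cone_intersections p K f L g"
      proof
        fix q assume "q \<in> crossings p f {\<sigma>\<in>A. card \<sigma> = Suc k} g {\<tau>\<in>B. card \<tau> = Suc l}"
        then obtain \<sigma> \<tau> where q: "q = (\<sigma>, \<tau>)" and s: "\<sigma> \<in> A" "card \<sigma> = Suc k" "\<tau> \<in> B" "card \<tau> = Suc l"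
          and "in_cone (p, 1) ?v (join \<sigma> \<tau>)" by (auto simp: crossings_def)
        then obtain c where c: "\<forall>i\<in>join \<sigma> \<tau>. 0 \<le> c i" "(\<Sum>i\<in>join \<sigma> \<tau>. c i *\<^sub>R ?v i) = (p, 1)"
          by (auto simp: in_cone_def)
        have fs: "finite \<sigma>" "finite \<tau>" using AD(2) BD(2) s by auto
        have pos: "0 < c i" if "i \<in> join \<sigma> \<tau>" for i
          using join_coefficient_nonzero[OF p cj[OF s(1,3)] c(2) that] c(1) that by force
        have eq: "(\<Sum>v\<in>\<tau>. c (v, True) *\<^sub>R g v) - (\<Sum>v\<in>\<sigma>. c (v, False) *\<^sub>R f v) = p"
          "(\<Sum>v\<in>\<tau>. c (v, True)) - (\<Sum>v\<in>\<sigma>. c (v, False)) = 1"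
          using c(2) unfolding sum_join_vector[OF fs] by auto
        \<comment> \<open>Conversely the total weight \<open>a\<close> on \<open>\<sigma>\<close>
          must be \<open>(1 - t) / t\<close>, whence \<open>t = 1 / (1 + a)\<close>. It is positive
          since no coefficient vanishes.\<close>
        define a where "a = (\<Sum>v\<in>\<sigma>. c (v, False))"
        have b: "(\<Sum>v\<in>\<tau>. c (v, True)) = 1 + a" using eq(2) by (simp add: a_def)
        have "\<sigma> \<noteq> {}" using s(2) by auto
        then have a: "a > 0" unfolding a_def using fs pos by (intro sum_pos) auto
        define x y where "x = (\<Sum>v\<in>\<sigma>. (c (v, False) / a) *\<^sub>R v)" and "y = (\<Sum>v\<in>\<tau>. (c (v, True) / (1 + a)) *\<^sub>R v)"
        have u: "\<forall>v\<in>\<sigma>. 0 < c (v, False) / a" "(\<Sum>v\<in>\<sigma>. c (v, False) / a) = 1"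
          using a pos by (auto simp: a_def simp flip: sum_divide_distrib)
        have w: "\<forall>v\<in>\<tau>. 0 < c (v, True) / (1 + a)" "(\<Sum>v\<in>\<tau>. c (v, True) / (1 + a)) = 1"
          using a pos b by (auto simp flip: sum_divide_distrib)
        have xo: "x \<in> open_simplex \<sigma>" 
          unfolding open_simplex_def x_def using u by (intro CollectI exI[of _ "\<lambda>v. c (v, False) / a"]) simp
        have yo: "y \<in> open_simplex \<tau>" 
          unfolding open_simplex_def y_def using w by (intro CollectI exI[of _ "\<lambda>v. c (v, True) / (1 + a)"]) simp
        have "f x = (\<Sum>v\<in>\<sigma>. (c (v, False) / a) *\<^sub>R f v)"
          unfolding x_def using u by (intro linear_on_simplices_comb[OF A(2) s(1) fs(1)]) (auto simp: less_imp_le)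
        also have "\<dots> = (1 / a) *\<^sub>R (\<Sum>v\<in>\<sigma>. c (v, False) *\<^sub>R f v)" by (simp add: scaleR_sum_right)
        finally have fx: "(\<Sum>v\<in>\<sigma>. c (v, False) *\<^sub>R f v) = a *\<^sub>R f x" using a by simp
        have "g y = (\<Sum>v\<in>\<tau>. (c (v, True) / (1 + a)) *\<^sub>R g v)"
          unfolding y_def using w by (intro linear_on_simplices_comb[OF B(2) s(3) fs(2)]) (auto simp: less_imp_le)
        also have "\<dots> = (1 / (1 + a)) *\<^sub>R (\<Sum>v\<in>\<tau>. c (v, True) *\<^sub>R g v)" by (simp add: scaleR_sum_right)
        also have "(\<Sum>v\<in>\<tau>. c (v, True) *\<^sub>R g v) = p + a *\<^sub>R f x" using eq(1) fx by (simp add: algebra_simps)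
        finally have "g y = (1 / (1 + a)) *\<^sub>R (p + a *\<^sub>R f x)" .
        moreover have "1 - 1 / (1 + a) = a / (1 + a)" using a by (simp add: field_simps)
        ultimately have gy: "g y = (1 - 1 / (1 + a)) *\<^sub>R f x + (1 / (1 + a)) *\<^sub>R p"
          by (simp add: scaleR_add_right add.commute)
        have "x \<in> convex hull \<sigma>" using xo open_simplex_subset[OF fs(1)] by (rule subsetD[rotated])
        then have "x \<in> body K" using convex_hull_subset_body[OF s(1)] bA by auto
        moreover have "y \<in> convex hull \<tau>" using yo open_simplex_subset[OF fs(2)] by (rule subsetD[rotated])
        then have "y \<in> body L" using convex_hull_subset_body[OF s(3)] bB by auto
        ultimately have "(x, 1 / (1 + a), y) \<in> cone_intersections p K f L g"
          unfolding cone_intersections_def using a gy by simp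
        then show "q \<in> \<Phi> ` cone_intersections p K f L g"
          unfolding q using \<Phi>[OF s(1) xo s(3) yo, of "1 / (1 + a)"] by (metis imageI)
      qed
    qed
  qed
  then show ?thesis by (rule bij_betw_same_card)
qed

lemma even_crossings_apex:
  assumes cycles: "mod2_cycle k {\<sigma>\<in>A. card \<sigma> = Suc k}" "mod2_cycle l {\<tau>\<in>B. card \<tau> = Suc l}"
    and p: "in_general_position p (f ` \<Union>A \<union> g ` \<Union>B)" and q: "in_general_position q (insert p (f ` \<Union>A \<union> g ` \<Union>B))"
  shows "even (card (crossings p f {\<sigma>\<in>A. card \<sigma> = Suc k} g {\<tau>\<in>B. card \<tau> = Suc l})) \<longleftrightarrow>
    even (card (crossings q f {\<sigma>\<in>A. card \<sigma> = Suc k} g {\<tau>\<in>B. card \<tau> = Suc l}))"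
proof (rule parity_crossings_apex[OF cycles dim])
  have gA: "geometric_complex A" and gB: "geometric_complex B" and bA: "body A = body K" and bB: "body B = body L"
    using A B by (auto simp: subdivision_def)
  fix \<sigma> \<tau> assume "\<sigma> \<in> {\<sigma>\<in>A. card \<sigma> = Suc k}" "\<tau> \<in> {\<tau>\<in>B. card \<tau> = Suc l}"
  then have \<sigma>\<tau>: "\<sigma> \<in> A" "\<tau> \<in> B" by auto
  have "convex hull (f ` \<sigma>) \<subseteq> f ` body K"
    using image_convex_hull_linear[OF A(2) \<sigma>\<tau>(1) geometric_complexD(2)[OF gA \<sigma>\<tau>(1)]]
      image_mono[OF convex_hull_subset_body[OF \<sigma>\<tau>(1)], of f] bA by simp
  moreover have "convex hull (g ` \<tau>) \<subseteq> g ` body L"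
    using image_convex_hull_linear[OF B(2) \<sigma>\<tau>(2) geometric_complexD(2)[OF gB \<sigma>\<tau>(2)]]
      image_mono[OF convex_hull_subset_body[OF \<sigma>\<tau>(2)], of g] bB by simp
  ultimately show "convex hull (f ` \<sigma>) \<inter> convex hull (g ` \<tau>) = {}" using disj by blast
next
  show "in_general_position p (f ` \<Union>{\<sigma>\<in>A. card \<sigma> = Suc k} \<union> g ` \<Union>{\<tau>\<in>B. card \<tau> = Suc l})"
    by (rule in_general_position_mono[OF p]) auto
  show "in_general_position q (insert p (f ` \<Union>{\<sigma>\<in>A. card \<sigma> = Suc k} \<union> g ` \<Union>{\<tau>\<in>B. card \<tau> = Suc l}))"
    by (rule in_general_position_mono[OF q]) auto
qed

end

text \<open>The set of cone intersections does not refer to triangulations, so two choices of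
  triangulations can be compared through an apex that is in general position to both.\<close>

lemma linked_mod2_iff:
  fixes K L A B :: "'a::real_normed_vector set set" and f g :: "'a \<Rightarrow> 'b::euclidean_space"
  assumes K: "geometric_complex K" "\<forall>\<sigma>\<in>K. card \<sigma> \<le> Suc k" and L: "geometric_complex L" "\<forall>\<tau>\<in>L. card \<tau> \<le> Suc l"
    and A: "subdivision A K" "linear_on_simplices A f" and B: "subdivision B L" "linear_on_simplices B g"
    and dim: "DIM('b) = k + l + 1" and disj: "f ` body K \<inter> g ` body L = {}"
    and cycleK: "\<And>A. subdivision A K \<Longrightarrow> mod2_cycle k {\<sigma>\<in>A. card \<sigma> = Suc k}"
    and cycleL: "\<And>B. subdivision B L \<Longrightarrow> mod2_cycle l {\<tau>\<in>B. card \<tau> = Suc l}"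
    and p: "in_general_position p (f ` \<Union>A \<union> g ` \<Union>B)"
  shows "linked_mod2 K f L g \<longleftrightarrow>
    odd (card (crossings p f {\<sigma>\<in>A. card \<sigma> = Suc k} g {\<tau>\<in>B. card \<tau> = Suc l}))"
proof
  note count = card_cone_intersections[OF K L _ _ _ _ dim disj]
  assume "odd (card (crossings p f {\<sigma>\<in>A. card \<sigma> = Suc k} g {\<tau>\<in>B. card \<tau> = Suc l}))"
  then show "linked_mod2 K f L g" unfolding linked_mod2_def using count[OF A B p] A B p by metis
next
  assume "linked_mod2 K f L g"
  then obtain A' B' p' where A': "subdivision A' K" "linear_on_simplices A' f"
    and B': "subdivision B' L" "linear_on_simplices B' g"
    and p': "in_general_position p' (f ` \<Union>A' \<union> g ` \<Union>B')" and odd: "odd (card (cone_intersections p' K f L g))"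
    unfolding linked_mod2_def by blast
  have fin: "finite (\<Union>X)" if "subdivision X Y" for X Y :: "'a set set"
  proof -
    have "geometric_complex X" using that by (simp add: subdivision_def)
    note XD = geometric_complexD[OF this]
    show ?thesis using XD(1,2) by auto
  qed
  obtain q where q: "in_general_position q ({p, p'} \<union> (f ` \<Union>A \<union> g ` \<Union>B) \<union> (f ` \<Union>A' \<union> g ` \<Union>B'))"
    using ex_general_position[of "{p, p'} \<union> (f ` \<Union>A \<union> g ` \<Union>B) \<union> (f ` \<Union>A' \<union> g ` \<Union>B')"]
      fin[OF A(1)] fin[OF B(1)] fin[OF A'(1)] fin[OF B'(1)] by auto
  have q1: "in_general_position q (insert p (f ` \<Union>A \<union> g ` \<Union>B))"
    "in_general_position q (insert p' (f ` \<Union>A' \<union> g ` \<Union>B'))"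
    "in_general_position q (f ` \<Union>A \<union> g ` \<Union>B)" "in_general_position q (f ` \<Union>A' \<union> g ` \<Union>B')"
    by (rule in_general_position_mono[OF q]; blast)+
  note count = card_cone_intersections[OF K L _ _ _ _ dim disj]
  have "odd (card (cone_intersections q K f L g))"
    using odd even_crossings_apex[OF K L A' B' dim disj cycleK[OF A'(1)] cycleL[OF B'(1)] p' q1(2)]
    unfolding count[OF A' B' p'] count[OF A' B' q1(4)] by simp
  then show "odd (card (crossings p f {\<sigma>\<in>A. card \<sigma> = Suc k} g {\<tau>\<in>B. card \<tau> = Suc l}))"
    using even_crossings_apex[OF K L A B dim disj cycleK[OF A(1)] cycleL[OF B(1)] p q1(1)]
    unfolding count[OF A B q1(3)] by simp
qed

section \<open>The complex\<close>

abbreviation (input) lookup where "lookup \<equiv> Poly_Mapping.lookup"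


lemma lookup_scaleR: "lookup (r *\<^sub>R x) i = r *\<^sub>R lookup x i"
proof -
  have "finite {i. r *\<^sub>R lookup x i \<noteq> 0}"
    by (rule finite_subset[of _ "{i. lookup x i \<noteq> 0}"]) auto
  then show ?thesis by (simp add: scaleR_poly_mapping_def Abs_poly_mapping_inverse)
qed

lemma dist_lookup_le: "dist (lookup x i) (lookup y i) \<le> dist x y"
proof (cases "i \<in> Poly_Mapping.keys x \<union> Poly_Mapping.keys y")
  case True
  then show ?thesis unfolding dist_poly_mapping_def by (intro member_le_sum) auto
next
  case False
  then show ?thesis by (simp add: in_keys_iff)
qed

lemma continuous_on_lookup [continuous_intros]: "continuous_on S (\<lambda>x. lookup x i)"
  unfolding continuous_on_iff
proof (intro ballI allI impI)
  fix x and e :: real assume "0 < e"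
  then show "\<exists>d>0. \<forall>x'\<in>S. dist x' x < d \<longrightarrow> dist (lookup x' i) (lookup x i) < e"
    using le_less_trans[OF dist_lookup_le] by (intro exI[of _ e]) auto
qed

section \<open>Simplices on unit vectors\<close>

definition vert :: "nat \<Rightarrow> real_inf" where
  "vert i = Poly_Mapping.single i 1"

lemma inj_vert: "inj_on vert S"
  by (rule inj_onI) (metis lookup_single_eq lookup_single_not_eq vert_def zero_neq_one)

lemma card_vert_image [simp]: "card (vert ` s) = card s"
  by (simp add: card_image inj_vert)

lemma vert_image_Int: "vert ` s \<inter> vert ` t = vert ` (s \<inter> t)"
  by (rule image_Int[OF inj_vert, symmetric])

lemma vert_image_eq_iff [simp]: "vert ` s = vert ` t \<longleftrightarrow> s = t"
  by (rule inj_image_eq_iff[OF inj_vert])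

lemma lookup_vert_comb:
  assumes "finite s"
  shows "lookup (\<Sum>i\<in>s. c i *\<^sub>R vert i) j = (if j \<in> s then c j else 0)"
proof -
  have "lookup (\<Sum>i\<in>s. c i *\<^sub>R vert i) j = (\<Sum>i\<in>s. c i * (if i = j then 1 else 0))"
    unfolding lookup_sum by (intro sum.cong) (auto simp: lookup_scaleR vert_def lookup_single when_def)
  also have "\<dots> = (if j \<in> s then c j else 0)"
    using assms by (simp add: if_distrib[of "\<lambda>x. _ * x"] cong: if_cong)
  finally show ?thesis .
qed

text \<open>Barycentric coordinates are the entries of the sequence itself, so questions about faces
  become questions about supports.\<close>

lemma convex_hull_vert:
  assumes "finite s"
  shows "convex hull (vert ` s) =
    {x. (\<forall>i. 0 \<le> lookup x i) \<and> (\<forall>i. i \<notin> s \<longrightarrow> lookup x i = 0) \<and> (\<Sum>i\<in>s. lookup x i) = 1}" (is "_ = ?R")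
proof
  show "convex hull (vert ` s) \<subseteq> ?R"
  proof
    fix x assume "x \<in> convex hull (vert ` s)"
    then obtain u where u: "\<forall>v\<in>vert ` s. 0 \<le> u v" "sum u (vert ` s) = 1" "(\<Sum>v\<in>vert ` s. u v *\<^sub>R v) = x"
      using assms by (auto simp: convex_hull_finite)
    have "x = (\<Sum>i\<in>s. u (vert i) *\<^sub>R vert i)" using u(3) by (simp add: sum.reindex inj_vert)
    then have l: "lookup x i = (if i \<in> s then u (vert i) else 0)" for i
      using lookup_vert_comb[OF assms] by simp
    have "(\<Sum>i\<in>s. u (vert i)) = 1" using u(2) by (simp add: sum.reindex inj_vert)
    then show "x \<in> ?R" using u(1) l by auto
  qed
  show "?R \<subseteq> convex hull (vert ` s)"
  proof
    fix x assume x: "x \<in> ?R"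
    have "x = (\<Sum>i\<in>s. lookup x i *\<^sub>R vert i)"
      by (rule poly_mapping_eqI) (use x assms in \<open>auto simp: lookup_vert_comb\<close>)
    also have "\<dots> \<in> convex hull (vert ` s)"
      using x assms by (intro convex_sum convex_convex_hull) (auto simp: hull_inc)
    finally show "x \<in> convex hull (vert ` s)" .
  qed
qed

lemma affine_independent_vert:
  assumes "finite s"
  shows "\<not> affine_dependent (vert ` s)"
proof
  assume "affine_dependent (vert ` s)"
  then obtain u where u: "\<exists>v\<in>vert ` s. u v \<noteq> 0" "(\<Sum>v\<in>vert ` s. u v *\<^sub>R v) = 0"
    using assms by (subst (asm) affine_dependent_explicit_finite) auto
  have "(\<Sum>i\<in>s. u (vert i) *\<^sub>R vert i) = 0" using u(2) by (simp add: sum.reindex inj_vert)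
  then have "u (vert i) = 0" if "i \<in> s" for i
    using lookup_vert_comb[OF assms, of "\<lambda>i. u (vert i)" i] that by simp
  then show False using u(1) by auto
qed

lemma convex_hull_vert_Int:
  assumes "finite s" "finite t"
  shows "convex hull (vert ` s) \<inter> convex hull (vert ` t) = convex hull (vert ` (s \<inter> t))"
proof (rule set_eqI)
  fix x :: real_inf
  have fst: "finite (s \<inter> t)" using assms by simp
  have sums: "(\<Sum>i\<in>s. lookup x i) = (\<Sum>i\<in>s \<inter> t. lookup x i)" "(\<Sum>i\<in>t. lookup x i) = (\<Sum>i\<in>s \<inter> t. lookup x i)"
    if "\<forall>i. i \<notin> s \<inter> t \<longrightarrow> lookup x i = 0"
    using assms that by (intro sum.mono_neutral_right; auto)+
  show "x \<in> convex hull (vert ` s) \<inter> convex hull (vert ` t) \<longleftrightarrow> x \<in> convex hull (vert ` (s \<inter> t))"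
  proof (cases "\<forall>i. i \<notin> s \<inter> t \<longrightarrow> lookup x i = 0")
    case True
    then show ?thesis
      unfolding convex_hull_vert[OF assms(1)] convex_hull_vert[OF assms(2)] convex_hull_vert[OF fst]
      using sums[OF True] by auto
  next
    case False
    then show ?thesis
      unfolding convex_hull_vert[OF assms(1)] convex_hull_vert[OF assms(2)] convex_hull_vert[OF fst]
      by auto
  qed
qed

lemma geometric_complex_vert:
  assumes "finite \<F>" "\<And>s. s \<in> \<F> \<Longrightarrow> finite s \<and> s \<noteq> {}" "\<And>s t. s \<in> \<F> \<Longrightarrow> t \<subseteq> s \<Longrightarrow> t \<noteq> {} \<Longrightarrow> t \<in> \<F>"
  shows "geometric_complex ((`) vert ` \<F>)"
  unfolding geometric_complex_def
proof (intro conjI ballI allI impI)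
  show "finite ((`) vert ` \<F>)" using assms(1) by simp
  fix \<sigma> assume "\<sigma> \<in> (`) vert ` \<F>"
  then obtain s where s: "s \<in> \<F>" "\<sigma> = vert ` s" by auto
  then show "finite \<sigma>" "\<sigma> \<noteq> {}" "\<not> affine_dependent \<sigma>"
    using assms(2)[OF s(1)] affine_independent_vert by auto
  show "\<tau> \<in> (`) vert ` \<F>" if \<tau>: "\<tau> \<subseteq> \<sigma> \<and> \<tau> \<noteq> {}" for \<tau>
  proof -
    have "\<tau> \<subseteq> vert ` s" using \<tau> s(2) by simp
    then obtain t where t: "t \<subseteq> s" "\<tau> = vert ` t" by (rule subset_imageE)
    then show ?thesis using assms(3)[OF s(1) t(1)] \<tau> by auto
  qed
  fix \<tau> assume "\<tau> \<in> (`) vert ` \<F>"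
  then obtain t where t: "t \<in> \<F>" "\<tau> = vert ` t" by auto
  show "convex hull \<sigma> \<inter> convex hull \<tau> = convex hull (\<sigma> \<inter> \<tau>)"
    unfolding s t vert_image_Int using assms(2) s t by (intro convex_hull_vert_Int) auto
qed

lemma simplex_boundary_vert: "simplex_boundary (vert ` V) = (`) vert ` {s. s \<subset> V \<and> s \<noteq> {}}"
proof
  show "simplex_boundary (vert ` V) \<subseteq> (`) vert ` {s. s \<subset> V \<and> s \<noteq> {}}"
  proof
    fix \<sigma> assume \<sigma>: "\<sigma> \<in> simplex_boundary (vert ` V)"
    then obtain s where "s \<subseteq> V" "\<sigma> = vert ` s"
      using subset_imageE[of \<sigma> vert V] by (auto simp: simplex_boundary_def)
    then show "\<sigma> \<in> (`) vert ` {s. s \<subset> V \<and> s \<noteq> {}}" using \<sigma> by (auto simp: simplex_boundary_def)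
  qed
  show "(`) vert ` {s. s \<subset> V \<and> s \<noteq> {}} \<subseteq> simplex_boundary (vert ` V)"
    by (auto simp: simplex_boundary_def psubset_eq)
qed

lemma geometric_complex_boundary_vert:
  assumes "finite V"
  shows "geometric_complex (simplex_boundary (vert ` V))"
  unfolding simplex_boundary_vert
proof (rule geometric_complex_vert)
  show "finite {s. s \<subset> V \<and> s \<noteq> {}}"
    by (rule finite_subset[of _ "Pow V"]) (use assms in auto)
qed (use assms finite_subset[of _ V] in auto)

lemma body_boundary_vert:
  assumes "finite V" "card V \<ge> 2"
  shows "body (simplex_boundary (vert ` V)) =
    {x. (\<forall>i. 0 \<le> lookup x i) \<and> (\<forall>i. i \<notin> V \<longrightarrow> lookup x i = 0) \<and> (\<Sum>i\<in>V. lookup x i) = 1 \<and> (\<exists>i\<in>V. lookup x i = 0)}"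
    (is "_ = ?R")
proof
  have body: "body (simplex_boundary (vert ` V)) = (\<Union>s\<in>{s. s \<subset> V \<and> s \<noteq> {}}. convex hull (vert ` s))"
    unfolding body_def simplex_boundary_vert by auto
  show "body (simplex_boundary (vert ` V)) \<subseteq> ?R"
  proof
    fix x assume "x \<in> body (simplex_boundary (vert ` V))"
    then obtain s where s: "s \<subset> V" "x \<in> convex hull (vert ` s)" unfolding body by auto
    then have fs: "finite s" using assms(1) finite_subset by (metis psubset_imp_subset)
    have x: "\<forall>i. 0 \<le> lookup x i" "\<forall>i. i \<notin> s \<longrightarrow> lookup x i = 0" "(\<Sum>i\<in>s. lookup x i) = 1"
      using s(2) unfolding convex_hull_vert[OF fs] by auto
    have "(\<Sum>i\<in>s. lookup x i) = (\<Sum>i\<in>V. lookup x i)"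
      using x(2) s(1) assms(1) by (intro sum.mono_neutral_left) auto
    moreover obtain i where "i \<in> V" "i \<notin> s" using s(1) by blast
    ultimately show "x \<in> ?R" using x s(1) by auto
  qed
  show "?R \<subseteq> body (simplex_boundary (vert ` V))"
  proof
    fix x assume x: "x \<in> ?R"
    then obtain i where i: "i \<in> V" "lookup x i = 0" by auto
    have "(\<Sum>j\<in>V - {i}. lookup x j) = (\<Sum>j\<in>V. lookup x j)"
      using i assms(1) by (simp add: sum.remove)
    then have "x \<in> convex hull (vert ` (V - {i}))"
      using x i assms(1) by (subst convex_hull_vert) auto
    moreover have "V - {i} \<noteq> {}"
    proof
      assume "V - {i} = {}"
      then have "V \<subseteq> {i}" by auto
      then have "card V \<le> card {i}" by (intro card_mono) auto
      then show False using assms(2) by simp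
    qed
    ultimately show "x \<in> body (simplex_boundary (vert ` V))" unfolding body using i(1) by blast
  qed
qed

lemma body_boundary_vert_disjoint:
  assumes "finite V" "finite W" "V \<inter> W = {}"
  shows "body (simplex_boundary (vert ` V)) \<inter> body (simplex_boundary (vert ` W)) = {}"
proof -
  have "convex hull (vert ` s) \<inter> convex hull (vert ` t) = {}" if "s \<subset> V" "t \<subset> W" for s t
  proof -
    have "finite s" "finite t" "s \<inter> t = {}" using that assms by (auto intro: finite_subset)
    then show ?thesis by (simp add: convex_hull_vert_Int)
  qed
  then show ?thesis unfolding body_def simplex_boundary_vert by blast
qed

text \<open>The differences with the last barycentric coordinate identify the plane of the simplex with
  \<open>\<real>\<^bsup>n+1\<^esup>\<close>, the barycenter going to the origin; the boundary is then projected radially.\<close>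

lemma sphere_complex_boundary_vert:
  assumes V: "finite V" "card V = n + 2"
  shows "sphere_complex n (simplex_boundary (vert ` V))"
proof -
  obtain h where h: "bij_betw h {..Suc n} V"
    using ex_bij_betw_nat_finite[OF V(1)] V(2)
    by (metis Suc_eq_plus1 add_2_eq_Suc' atLeast0LessThan lessThan_Suc_atMost)
  let ?B = "body (simplex_boundary (vert ` V))"
  define y where "y x i = (if i \<le> n then lookup x (h i) - lookup x (h (Suc n)) else 0)" for x :: real_inf and i
  define N where "N x = sqrt (\<Sum>i\<le>n. (y x i)\<^sup>2)" for x
  define F where "F x = (\<lambda>i. y x i / N x)" for x
  have V2: "card V \<ge> 2" using V(2) by simp
  note B = body_boundary_vert[OF V(1) V2]
  have sumh: "(\<Sum>i\<in>V. g i) = (\<Sum>i\<le>Suc n. g (h i))" for g :: "nat \<Rightarrow> real"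
    by (rule sum.reindex_bij_betw[OF h, symmetric])
  have sum_x: "(\<Sum>i\<le>Suc n. lookup x (h i)) = 1" if "x \<in> ?B" for x using that sumh unfolding B by auto
  \<comment> \<open>The differences \<open>y\<close> recover the point: the coordinates sum to one,
    which fixes the common shift.\<close>
  have coord: "lookup x (h j) = (1 - (\<Sum>i\<le>n. y x i)) / real (n + 2) + y x j" if "x \<in> ?B" "j \<le> Suc n" for x j
  proof -
    have "1 = (\<Sum>i\<le>n. lookup x (h i)) + lookup x (h (Suc n))" using sum_x[OF that(1)] by simp
    also have "(\<Sum>i\<le>n. lookup x (h i)) = (\<Sum>i\<le>n. y x i + lookup x (h (Suc n)))"
      by (intro sum.cong) (auto simp: y_def)
    finally have "lookup x (h (Suc n)) * real (n + 2) = 1 - (\<Sum>i\<le>n. y x i)"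
      by (simp add: sum.distrib algebra_simps)
    then have last: "lookup x (h (Suc n)) = (1 - (\<Sum>i\<le>n. y x i)) / real (n + 2)"
      by (simp add: eq_divide_eq)
    show ?thesis
    proof (cases "j = Suc n")
      case True
      then show ?thesis using last by (simp add: y_def)
    next
      case False
      then have "lookup x (h j) = y x j + lookup x (h (Suc n))" using that(2) by (simp add: y_def)
      then show ?thesis using last by simp
    qed
  qed
  have zero: "\<exists>j\<le>Suc n. lookup x (h j) = 0" if x: "x \<in> ?B" for x
  proof -
    obtain i where "i \<in> V" "lookup x i = 0" using x unfolding B by auto
    then show ?thesis using h unfolding bij_betw_def by (metis atMost_iff imageE)
  qed
  have N_pos: "N x > 0" if x: "x \<in> ?B" for x
  proof (rule ccontr)
    assume "\<not> N x > 0"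
    then have "(\<Sum>i\<le>n. (y x i)\<^sup>2) = 0"
      unfolding N_def using sum_nonneg[of "{..n}" "\<lambda>i. (y x i)\<^sup>2"] by force
    then have "y x i = 0" for i
      by (cases "i \<le> n") (auto simp: sum_nonneg_eq_0_iff y_def)
    then have "lookup x (h j) = 1 / real (n + 2)" if "j \<le> Suc n" for j using coord[OF x that] by simp
    then show False using zero[OF x] by (metis add_is_0 divide_eq_0_iff of_nat_eq_0_iff zero_neq_one zero_neq_numeral)
  qed
  have sq: "(\<Sum>i\<le>n. (F x i)\<^sup>2) = 1" if "x \<in> ?B" for x
  proof -
    have "(N x)\<^sup>2 = (\<Sum>i\<le>n. (y x i)\<^sup>2)" unfolding N_def by (simp add: sum_nonneg)
    moreover have "(\<Sum>i\<le>n. (F x i)\<^sup>2) = (\<Sum>i\<le>n. (y x i)\<^sup>2) / (N x)\<^sup>2"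
      by (simp add: F_def power_divide sum_divide_distrib)
    moreover have "(N x)\<^sup>2 \<noteq> 0" using N_pos[OF that] by simp
    ultimately show ?thesis by simp
  qed
  have cont_y: "continuous_on ?B (\<lambda>x. y x i)" for i
    unfolding y_def by (cases "i \<le> n") (auto intro!: continuous_intros)
  have cont_F: "continuous_on ?B (\<lambda>x. F x i)" for i
  proof -
    have "continuous_on ?B N" unfolding N_def[abs_def] by (intro continuous_intros cont_y)
    then show ?thesis unfolding F_def using N_pos by (intro continuous_on_divide cont_y) force+
  qed
  have "homeomorphic_map (top_of_set ?B) (nsphere n) F"
  proof (rule continuous_imp_homeomorphic_map)
    show "continuous_map (top_of_set ?B) (nsphere n) F"
      unfolding nsphere continuous_map_in_subtopology continuous_map_componentwise_UNIV
      using cont_F sq by (auto simp: F_def y_def)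
    have "compact ?B"
      unfolding body_def simplex_boundary_vert using V(1)
      by (intro compact_UN finite_imageI) (auto intro!: finite_imp_compact_convex_hull intro: finite_subset)
    then show "compact_space (top_of_set ?B)" by (simp add: compact_space_subtopology)
    show "Hausdorff_space (nsphere n)"
      unfolding nsphere by (intro Hausdorff_space_subtopology) (simp add: Hausdorff_space_product_topology)
    show "inj_on F (topspace (top_of_set ?B))"
    proof (rule inj_onI)
      fix x x' assume xx: "x \<in> topspace (top_of_set ?B)" "x' \<in> topspace (top_of_set ?B)" and eq: "F x = F x'"
      then have x: "x \<in> ?B" "x' \<in> ?B" by auto
      define r where "r = N x' / N x"
      have r: "r > 0" using N_pos x by (simp add: r_def)
      have y': "y x' i = r * y x i" for i
        using fun_cong[OF eq, of i] N_pos[OF x(1)] N_pos[OF x(2)] by (simp add: F_def r_def field_simps)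
      let ?m = "1 / real (n + 2)"
      \<comment> \<open>Proportional differences mean that \<open>x'\<close> is the image of
        \<open>x\<close> under a homothety with ratio \<open>r\<close> about the barycenter. A
        vanishing coordinate of \<open>x\<close> then bounds \<open>r\<close> from above, one of
        \<open>x'\<close> bounds it from below.\<close>
      have lin: "lookup x' (h j) = ?m + r * (lookup x (h j) - ?m)" if "j \<le> Suc n" for j
        unfolding coord[OF x(1) that] coord[OF x(2) that] y'
        by (simp add: diff_divide_distrib right_diff_distrib distrib_left flip: sum_distrib_left)
      have m: "?m > 0" by simp
      have "r = 1"
      proof -
        obtain j where j: "j \<le> Suc n" "lookup x (h j) = 0" using zero[OF x(1)] by auto
        have "0 \<le> lookup x' (h j)" using x(2) unfolding B by auto
        then have "?m * r \<le> ?m * 1" using lin[OF j(1)] j(2) by (simp add: mult.commute)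
        then have 1: "r \<le> 1" using m by (simp only: mult_le_cancel_left_pos)
        obtain j' where j': "j' \<le> Suc n" "lookup x' (h j') = 0" using zero[OF x(2)] by auto
        have "0 \<le> r * lookup x (h j')" using x(1) r unfolding B by auto
        then have "?m * 1 \<le> ?m * r" using lin[OF j'(1)] j'(2) by (simp add: algebra_simps)
        then have "1 \<le> r" using m by (simp only: mult_le_cancel_left_pos)
        with 1 show ?thesis by simp
      qed
      then have eqh: "lookup x' (h j) = lookup x (h j)" if "j \<le> Suc n" for j using lin[OF that] by simp
      show "x = x'"
      proof (rule poly_mapping_eqI)
        fix i
        show "lookup x i = lookup x' i"
        proof (cases "i \<in> V")
          case True
          then obtain j where "j \<le> Suc n" "i = h j" using h unfolding bij_betw_def by auto
          then show ?thesis using eqh by simp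
        next
          case False
          then show ?thesis using x unfolding B by auto
        qed
      qed
    qed
    show "F ` topspace (top_of_set ?B) = topspace (nsphere n)"
    proof
      show "F ` topspace (top_of_set ?B) \<subseteq> topspace (nsphere n)"
        unfolding nsphere using sq by (auto simp: F_def y_def)
      show "topspace (nsphere n) \<subseteq> F ` topspace (top_of_set ?B)"
      proof
        fix z assume "z \<in> topspace (nsphere n)"
        then have z: "(\<Sum>i\<le>n. (z i)\<^sup>2) = 1" "\<forall>i>n. z i = 0" unfolding nsphere by auto
        \<comment> \<open>For a preimage, \<open>z\<close> with its zero entry at
          \<open>Suc n\<close> is shifted until the least entry vanishes and rescaled to total one;
          differences are merely divided by \<open>D\<close>.\<close>
        define m where "m = Min (z ` {..Suc n})"
        have m_le: "m \<le> z i" if "i \<le> Suc n" for i unfolding m_def using that by (intro Min_le) auto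
        obtain j where j: "j \<le> Suc n" "z j = m"
          using Min_in[of "z ` {..Suc n}"] unfolding m_def by fastforce
        define D where "D = (\<Sum>i\<le>Suc n. z i - m)"
        have D: "D > 0"
        proof (rule ccontr)
          assume "\<not> D > 0"
          moreover have "D \<ge> 0" unfolding D_def using m_le by (intro sum_nonneg) auto
          ultimately have "D = 0" by simp
          then have "\<forall>i\<in>{..Suc n}. z i - m = 0"
            unfolding D_def using m_le by (subst (asm) sum_nonneg_eq_0_iff) auto
          then have "\<forall>i\<le>Suc n. z i = m" by simp
          moreover have "z (Suc n) = 0" using z(2) by simp
          ultimately have "(\<Sum>i\<le>n. (z i)\<^sup>2) = 0" by (intro sum.neutral) auto
          then show False using z(1) by simp
        qed
        define x where "x = (\<Sum>i\<in>V. ((z (inv_into {..Suc n} h i) - m) / D) *\<^sub>R vert i)"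
        have xh: "lookup x (h i) = (z i - m) / D" if "i \<le> Suc n" for i
        proof -
          have "h i \<in> V" "inv_into {..Suc n} h (h i) = i"
            using h that by (auto simp: bij_betw_def)
          then show ?thesis unfolding x_def lookup_vert_comb[OF V(1)] by simp
        qed
        have "x \<in> ?B" unfolding B
        proof (intro CollectI conjI allI impI)
          show x0: "lookup x i = 0" if "i \<notin> V" for i unfolding x_def lookup_vert_comb[OF V(1)] using that by simp
          show "0 \<le> lookup x i" for i
          proof (cases "i \<in> V")
            case True
            then obtain j where "j \<le> Suc n" "i = h j" using h unfolding bij_betw_def by auto
            then show ?thesis using xh m_le D by simp
          qed (simp add: x0)
          have "(\<Sum>i\<in>V. lookup x i) = (\<Sum>i\<le>Suc n. (z i - m) / D)" unfolding sumh using xh by (intro sum.cong) auto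
          also have "\<dots> = 1" using D by (simp add: D_def flip: sum_divide_distrib)
          finally show "(\<Sum>i\<in>V. lookup x i) = 1" .
          have "h j \<in> V" using h j(1) by (auto simp: bij_betw_def)
          then show "\<exists>i\<in>V. lookup x i = 0" using xh[OF j(1)] j(2) by auto
        qed
        moreover have "F x = z"
        proof
          have yx: "y x i = z i / D" for i
            using z(2) xh[of i] xh[of "Suc n"] by (auto simp: y_def diff_divide_distrib)
          have "(\<Sum>i\<le>n. (y x i)\<^sup>2) = (1 / D)\<^sup>2"
            unfolding yx using z(1) by (simp add: power_divide flip: sum_divide_distrib)
          then have "N x = 1 / D" using D by (simp add: N_def real_sqrt_divide)
          then show "F x i = z i" for i using D by (simp add: F_def yx)
        qed
        ultimately show "z \<in> F ` topspace (top_of_set ?B)" by (metis imageI topspace_euclidean_subtopology)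
      qed
    qed
  qed
  then show ?thesis unfolding sphere_complex_def by (rule homeomorphic_map_imp_homeomorphic_space)
qed

section \<open>The linking complex and its embedding\<close>

definition linking_family :: "nat \<Rightarrow> nat \<Rightarrow> nat set set" where
  "linking_family k l = {s. s \<subseteq> {1..k + l + 3} \<and> s \<noteq> {} \<and> card s \<le> k + 1} \<union>
     {s. s \<subseteq> {0..k + l + 3} \<and> 0 \<in> s \<and> card s \<le> l + 1}"

definition linking_complex :: "nat \<Rightarrow> nat \<Rightarrow> real_inf set set" where
  "linking_complex k l = (`) vert ` linking_family k l"

lemma linking_family_subset: "s \<in> linking_family k l \<Longrightarrow> s \<subseteq> {0..k + l + 3}"
  by (auto simp: linking_family_def)

lemma linking_family_finite: "s \<in> linking_family k l \<Longrightarrow> finite s"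
  by (rule finite_subset[OF linking_family_subset finite_atLeastAtMost])

text \<open>The face opposite the apex of a simplex with \<open>l + 1\<close> vertices has to lie in
  the \<open>k\<close>-skeleton, which is ensured by \<open>l \<le> k\<close>.\<close>

lemma linking_family_down:
  assumes "l \<le> k" "s \<in> linking_family k l" "t \<subseteq> s" "t \<noteq> {}"
  shows "t \<in> linking_family k l"
proof -
  have ct: "card t \<le> card s" using assms linking_family_finite by (intro card_mono) auto
  show ?thesis
  proof (cases "0 \<in> t")
    case True
    then have "0 \<in> s" using assms(3) by auto
    then show ?thesis using assms ct True by (auto simp: linking_family_def)
  next
    case False
    have "t \<subseteq> {1..k + l + 3}"
    proof
      fix i assume i: "i \<in> t"
      then have "i \<noteq> 0" using False by (cases "i = 0") auto
      moreover have "i \<le> k + l + 3" using i assms(3) linking_family_subset[OF assms(2)] by auto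
      ultimately show "i \<in> {1..k + l + 3}" by simp
    qed
    moreover have "card s \<le> k + 1" using assms(1,2) by (auto simp: linking_family_def)
    ultimately show ?thesis using assms ct by (auto simp: linking_family_def)
  qed
qed

lemma k_complex_linking_complex:
  assumes "l \<le> k"
  shows "k_complex k (linking_complex k l)"
  unfolding k_complex_def
proof
  show "geometric_complex (linking_complex k l)"
    unfolding linking_complex_def
  proof (rule geometric_complex_vert)
    show "finite (linking_family k l)"
      by (rule finite_subset[of _ "Pow {0..k + l + 3}"]) (auto dest: linking_family_subset)
    show "finite s \<and> s \<noteq> {}" if "s \<in> linking_family k l" for s
      using linking_family_finite[OF that] that by (auto simp: linking_family_def)
    show "t \<in> linking_family k l" if "s \<in> linking_family k l" "t \<subseteq> s" "t \<noteq> {}" for s t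
      by (rule linking_family_down[OF assms that])
  qed
  show "\<forall>\<sigma>\<in>linking_complex k l. card \<sigma> \<le> k + 1"
    using assms by (auto simp: linking_complex_def linking_family_def)
qed

lemma simplex_boundary_subset_linking_complex:
  assumes "\<And>v. v \<in> V \<Longrightarrow> V - {v} \<in> linking_family k l" "l \<le> k"
  shows "simplex_boundary (vert ` V) \<subseteq> linking_complex k l"
proof -
  have "s \<in> linking_family k l" if s: "s \<subset> V" "s \<noteq> {}" for s
  proof -
    obtain v where v: "v \<in> V" "v \<notin> s" using s(1) by blast
    have "s \<subseteq> V - {v}" using s(1) v(2) by blast
    then show ?thesis by (rule linking_family_down[OF assms(2) assms(1)[OF v(1)] _ s(2)])
  qed
  then show ?thesis unfolding simplex_boundary_vert linking_complex_def by auto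
qed

lemma linking_complex_spheres:
  assumes "l \<le> k" "j \<subseteq> {1..k + l + 3}" "card j = k + 2"
  shows "simplex_boundary (vert ` j) \<subseteq> linking_complex k l"
    "simplex_boundary (vert ` insert 0 ({1..k + l + 3} - j)) \<subseteq> linking_complex k l"
proof -
  have fj: "finite j" by (rule finite_subset[OF assms(2) finite_atLeastAtMost])
  show "simplex_boundary (vert ` j) \<subseteq> linking_complex k l"
  proof (rule simplex_boundary_subset_linking_complex[OF _ assms(1)])
    fix v assume "v \<in> j"
    then have c: "card (j - {v}) = k + 1" using assms(3) fj by simp
    then have "j - {v} \<noteq> {}" by (metis add_is_0 card.empty one_neq_zero)
    then show "j - {v} \<in> linking_family k l" using c assms(2) by (auto simp: linking_family_def)
  qed
  have cc: "card ({1..k + l + 3} - j) = l + 1" using assms by (simp add: card_Diff_subset fj)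
  show "simplex_boundary (vert ` insert 0 ({1..k + l + 3} - j)) \<subseteq> linking_complex k l"
  proof (rule simplex_boundary_subset_linking_complex[OF _ assms(1)])
    fix v assume v: "v \<in> insert 0 ({1..k + l + 3} - j)"
    show "insert 0 ({1..k + l + 3} - j) - {v} \<in> linking_family k l"
    proof (cases "v = 0")
      case True
      then have "insert 0 ({1..k + l + 3} - j) - {v} = {1..k + l + 3} - j" by auto
      moreover have "{1..k + l + 3} - j \<noteq> {}" using cc by (metis add_is_0 card.empty one_neq_zero)
      ultimately show ?thesis using cc assms(1) by (auto simp: linking_family_def)
    next
      case False
      have "card (insert 0 ({1..k + l + 3} - j)) = l + 2" using cc by simp
      then have "card (insert 0 ({1..k + l + 3} - j) - {v}) = l + 1" using v by (subst card_Diff_singleton) auto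
      then show ?thesis using False by (auto simp: linking_family_def)
    qed
  qed
qed

text \<open>The vertices \<open>1, \<dots>, d + 2\<close> go to the vertices and the center of a \<open>d\<close>-simplex.\<close>

lemma ex_star_points:
  assumes "CARD('n::finite) = d"
  shows "\<exists>P :: nat \<Rightarrow> real ^ 'n. \<forall>D. (\<Sum>i=1..d + 2. D i) = 0 \<and> (\<Sum>i=1..d + 2. D i *\<^sub>R P i) = 0 \<longrightarrow>
    (\<forall>i\<in>{1..d + 1}. D i = D (d + 1)) \<and> D (d + 2) = - real (d + 1) * D (d + 1)"
proof -
  obtain b :: "nat \<Rightarrow> 'n" where b: "bij_betw b {1..d} UNIV"
    using assms finite_same_card_bij[of "{1..d}" "UNIV :: 'n set"] by auto
  \<comment> \<open>The unit vectors and minus their sum have the origin as barycenter. All affine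
    dependences are multiples of a single one, with equal coefficients at the \<open>d + 1\<close>
    vertices against the center.\<close>
  define P where "P = (\<lambda>i. if i \<le> d then axis (b i) 1 else if i = d + 1 then - (\<Sum>i=1..d. axis (b i) (1::real)) else 0)"
  have "(\<forall>i\<in>{1..d + 1}. D i = D (d + 1)) \<and> D (d + 2) = - real (d + 1) * D (d + 1)"
    if D: "(\<Sum>i=1..d + 2. D i) = 0" "(\<Sum>i=1..d + 2. D i *\<^sub>R P i) = 0" for D
  proof -
    have "0 = (\<Sum>i=1..d. D i *\<^sub>R P i) + D (d + 1) *\<^sub>R P (d + 1) + D (d + 2) *\<^sub>R P (d + 2)"
      using D(2) by (simp add: numeral_2_eq_2)
    also have "(\<Sum>i=1..d. D i *\<^sub>R P i) = (\<Sum>i=1..d. D i *\<^sub>R axis (b i) 1)"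
      by (intro sum.cong) (auto simp: P_def)
    also have "\<dots> + D (d + 1) *\<^sub>R P (d + 1) + D (d + 2) *\<^sub>R P (d + 2) = (\<Sum>i=1..d. (D i - D (d + 1)) *\<^sub>R axis (b i) 1)"
      by (simp add: P_def scaleR_left_diff_distrib sum_subtractf scaleR_sum_right)
    finally have 0: "(\<Sum>i=1..d. (D i - D (d + 1)) *\<^sub>R axis (b i) (1::real)) = 0" by simp
    have eq: "D i = D (d + 1)" if i: "i \<in> {1..d}" for i
    proof -
      have "0 = (\<Sum>m=1..d. (D m - D (d + 1)) *\<^sub>R axis (b m) (1::real)) $ b i" unfolding 0 by simp
      also have "\<dots> = (\<Sum>m=1..d. (D m - D (d + 1)) * (if m = i then 1 else 0))"
        unfolding sum_component using inj_on_eq_iff[OF bij_betw_imp_inj_on[OF b]] i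
        by (intro sum.cong refl) (auto simp: axis_def)
      also have "\<dots> = D i - D (d + 1)" using i by (simp add: if_distrib[of "\<lambda>x. _ * x"] cong: if_cong)
      finally show ?thesis by simp
    qed
    have "0 = (\<Sum>i=1..d. D i) + D (d + 1) + D (d + 2)" using D(1) by (simp add: numeral_2_eq_2)
    also have "(\<Sum>i=1..d. D i) = (\<Sum>i=1..d. D (d + 1))" using eq by (intro sum.cong) auto
    finally have "D (d + 2) = - real (d + 1) * D (d + 1)" by (simp add: algebra_simps)
    moreover have "D i = D (d + 1)" if "i \<in> {1..d + 1}" for i
      using eq[of i] that by (cases "i = d + 1") auto
    ultimately show ?thesis by blast
  qed
  then show ?thesis by blast
qed

text \<open>Points with equal images differ by an affine dependence \<open>D\<close>. If it involves
  the apex, the apex lies in the affine hull of at most \<open>d\<close> of the other points. If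
  not, it is a multiple of the star dependence, whose \<open>d + 1 = k + l + 2\<close> coefficients
  of one sign would need a single simplex to carry them, and simplices have at most
  \<open>k + 1\<close> vertices.\<close>

lemma linking_complex_embeds:
  assumes lk: "l \<le> k" and dim: "CARD('n::finite) = k + l + 1"
  shows "\<exists>g :: real_inf \<Rightarrow> real ^ 'n. PL_embedding (linking_complex k l) g"
proof -
  let ?F = "linking_complex k l" and ?d = "k + l + 1"
  obtain P0 :: "nat \<Rightarrow> real ^ 'n" where P0: "\<And>D. (\<Sum>i=1..?d + 2. D i) = 0 \<Longrightarrow> (\<Sum>i=1..?d + 2. D i *\<^sub>R P0 i) = 0 \<Longrightarrow>
    (\<forall>i\<in>{1..?d + 1}. D i = D (?d + 1)) \<and> D (?d + 2) = - real (?d + 1) * D (?d + 1)"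
    using ex_star_points[OF dim] by blast
  obtain p where p: "in_general_position p (P0 ` {1..?d + 2})"
    using ex_general_position[of "P0 ` {1..?d + 2}"] by auto
  define P where "P = P0(0 := p)"
  define g where "g x = (\<Sum>i=0..?d + 2. lookup x i *\<^sub>R P i)" for x :: real_inf
  have gF: "geometric_complex ?F" using k_complex_linking_complex[OF lk] by (simp add: k_complex_def)
  have "g ((1 - t) *\<^sub>R x + t *\<^sub>R y) = (1 - t) *\<^sub>R g x + t *\<^sub>R g y" for x y t
    unfolding g_def scaleR_sum_right sum.distrib[symmetric]
    by (intro sum.cong refl) (simp add: lookup_add lookup_scaleR scaleR_add_left)
  then have lin: "linear_on_simplices ?F g" unfolding linear_on_simplices_def by blast
  have "subdivision ?F ?F" unfolding subdivision_def using gF by blast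
  then have "PL_map ?F g" unfolding PL_map_def using lin by blast
  moreover have "inj_on g (body ?F)"
  proof (rule inj_onI)
    fix x y assume x: "x \<in> body ?F" and y: "y \<in> body ?F" and gxy: "g x = g y"
    obtain s where s: "s \<in> linking_family k l" "x \<in> convex hull (vert ` s)"
      using x by (auto simp: body_def linking_complex_def)
    obtain t where t: "t \<in> linking_family k l" "y \<in> convex hull (vert ` t)"
      using y by (auto simp: body_def linking_complex_def)
    have fs: "finite s" "finite t" using linking_family_finite s t by auto
    have sub: "s \<subseteq> {0..?d + 2}" "t \<subseteq> {0..?d + 2}"
      using linking_family_subset[OF s(1)] linking_family_subset[OF t(1)] by (auto simp: numeral_3_eq_3 numeral_2_eq_2)
    have cs: "card s \<le> k + 1" "card t \<le> k + 1" using s(1) t(1) lk by (auto simp: linking_family_def)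
    have lx: "\<forall>i. 0 \<le> lookup x i" "\<forall>i. i \<notin> s \<longrightarrow> lookup x i = 0" "(\<Sum>i\<in>s. lookup x i) = 1"
      using s(2) unfolding convex_hull_vert[OF fs(1)] by auto
    have ly: "\<forall>i. 0 \<le> lookup y i" "\<forall>i. i \<notin> t \<longrightarrow> lookup y i = 0" "(\<Sum>i\<in>t. lookup y i) = 1"
      using t(2) unfolding convex_hull_vert[OF fs(2)] by auto
    define D where "D i = lookup x i - lookup y i" for i
    have D0: "D i = 0" if "i \<notin> s \<union> t" for i using lx(2) ly(2) that by (simp add: D_def)
    have "(\<Sum>i\<in>s. lookup x i) = (\<Sum>i=0..?d + 2. lookup x i)" "(\<Sum>i\<in>t. lookup y i) = (\<Sum>i=0..?d + 2. lookup y i)"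
      using lx(2) ly(2) sub by (intro sum.mono_neutral_left; auto)+
    then have sumD: "(\<Sum>i=0..?d + 2. D i) = 0" using lx(3) ly(3) by (simp add: D_def sum_subtractf)
    have sumDP: "(\<Sum>i=0..?d + 2. D i *\<^sub>R P i) = 0"
      using gxy by (simp add: g_def D_def scaleR_left_diff_distrib sum_subtractf)
    have split: "(\<Sum>i=0..?d + 2. h i) = h 0 + (\<Sum>i=1..?d + 2. h i)" for h :: "nat \<Rightarrow> 'x::comm_monoid_add"
      by (subst sum.atLeast_Suc_atMost) auto
    have P_pos: "(\<Sum>i=1..?d + 2. D i *\<^sub>R P i) = (\<Sum>i=1..?d + 2. D i *\<^sub>R P0 i)"
      by (intro sum.cong) (auto simp: P_def)
    have "D 0 = 0"
    proof (rule ccontr)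
      assume ne: "D 0 \<noteq> 0"
      let ?U = "s \<union> t - {0}"
      \<comment> \<open>A simplex through the apex has at most \<open>l + 1\<close> vertices, so
        without the apex the union has at most \<open>(k + 1) + (l + 1) - 1 = d\<close>.\<close>
      have "0 \<in> s \<union> t" using ne D0 by blast
      moreover have "card u \<le> l + 1" if "u \<in> linking_family k l" "0 \<in> u" for u
        using that unfolding linking_family_def by (auto dest: subsetD)
      ultimately have "card s \<le> l + 1 \<or> card t \<le> l + 1" using s(1) t(1) by blast
      then have "card (s \<union> t) \<le> ?d + 1" using cs card_Un_le[of s t] by linarith
      then have cU: "card ?U \<le> ?d" using \<open>0 \<in> s \<union> t\<close> fs by simp
      have subU: "?U \<subseteq> {1..?d + 2}"
      proof
        fix i assume "i \<in> ?U"
        then have "i \<noteq> 0" "i \<in> {0..?d + 2}" using sub by auto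
        then show "i \<in> {1..?d + 2}" by simp
      qed
      have restrict: "(\<Sum>i=1..?d + 2. h i) = (\<Sum>i\<in>?U. h i)"
        if "\<And>i. i \<notin> s \<union> t \<Longrightarrow> h i = 0" for h :: "nat \<Rightarrow> 'x::comm_monoid_add"
        by (rule sum.mono_neutral_right) (use subU that in auto)
      have 1: "(\<Sum>i\<in>?U. - D i / D 0) = 1"
      proof -
        have "(\<Sum>i\<in>?U. D i) = - D 0" using sumD split[of D] restrict[of D] D0 by simp
        then show ?thesis using ne by (simp add: sum_negf flip: sum_divide_distrib)
      qed
      have "(\<Sum>i\<in>?U. D i *\<^sub>R P0 i) = - (D 0 *\<^sub>R p)"
        using sumDP split[of "\<lambda>i. D i *\<^sub>R P i"] restrict[of "\<lambda>i. D i *\<^sub>R P0 i"] D0 P_pos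
        by (simp add: P_def add_eq_0_iff)
      moreover have "(\<Sum>i\<in>?U. (- D i / D 0) *\<^sub>R P0 i) = (- 1 / D 0) *\<^sub>R (\<Sum>i\<in>?U. D i *\<^sub>R P0 i)"
        by (simp add: scaleR_sum_right sum_negf)
      ultimately have "p = (\<Sum>i\<in>?U. (- D i / D 0) *\<^sub>R P0 i)" using ne by simp
      then have "(p, 1) = (\<Sum>i\<in>?U. (- D i / D 0) *\<^sub>R (P0 i, 1::real))"
        using 1 by (simp add: prod_eq_iff fst_sum snd_sum)
      also have "\<dots> \<in> span ((\<lambda>w. (w, 1)) ` P0 ` ?U)"
        by (intro span_sum span_scale span_base) auto
      finally have "p \<in> affine hull (P0 ` ?U)"
        using fs by (intro homogeneous_span_imp_affine_hull) auto
      moreover have "card (P0 ` ?U) \<le> DIM(real ^ 'n)"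
        using card_image_le[of ?U P0] fs cU dim by simp
      moreover have "P0 ` ?U \<subseteq> P0 ` {1..?d + 2}" using subU by (rule image_mono)
      moreover have "finite (P0 ` ?U)" using fs by simp
      ultimately show False using p unfolding in_general_position_def by blast
    qed
    have D1: "(\<Sum>i=1..?d + 2. D i) = 0" using sumD \<open>D 0 = 0\<close> by (simp only: split add_0_left)
    have D2: "(\<Sum>i=1..?d + 2. D i *\<^sub>R P0 i) = 0"
      using sumDP \<open>D 0 = 0\<close> unfolding P_pos[symmetric] by (simp only: split scaleR_zero_left add_0_left)
    define c where "c = D (?d + 1)"
    note Dc = conjunct1[OF P0[OF D1 D2], folded c_def] conjunct2[OF P0[OF D1 D2], folded c_def]
    have "c = 0"
    proof (rule ccontr)
      assume "c \<noteq> 0"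
      then consider "c > 0" | "c < 0" by linarith
      then show False
      proof cases
        case 1
        have "{1..?d + 1} \<subseteq> s"
        proof
          fix i assume "i \<in> {1..?d + 1}"
          then have "D i > 0" using Dc(1) 1 by simp
          then have "lookup x i - lookup y i > 0" by (simp only: D_def)
          then show "i \<in> s" using lx(2) ly(1) by (metis diff_gt_0_iff_gt not_less)
        qed
        then have "card {1..?d + 1} \<le> card s" using fs by (intro card_mono) auto
        then show False using cs by simp
      next
        case 2
        have "{1..?d + 1} \<subseteq> t"
        proof
          fix i assume "i \<in> {1..?d + 1}"
          then have "D i < 0" using Dc(1) 2 by simp
          then have "lookup y i - lookup x i > 0" by (simp add: D_def)
          then show "i \<in> t" using ly(2) lx(1) by (metis diff_gt_0_iff_gt not_less)
        qed
        then have "card {1..?d + 1} \<le> card t" using fs by (intro card_mono) auto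
        then show False using cs by simp
      qed
    qed
    have "D i = 0" for i
    proof (cases "i \<in> {0..?d + 2}")
      case True
      then consider "i = 0" | "i \<in> {1..?d + 1}" | "i = ?d + 2" by fastforce
      then show ?thesis by cases (use \<open>D 0 = 0\<close> Dc \<open>c = 0\<close> in auto)
    next
      case False
      then show ?thesis using D0 sub by blast
    qed
    then show "x = y" by (intro poly_mapping_eqI) (simp add: D_def)
  qed
  ultimately show ?thesis unfolding PL_embedding_def by blast
qed

section \<open>The equivariant cochain of an almost embedding\<close>

lemma ex_nonorthogonal:
  fixes Z :: "'e::euclidean_space set"
  assumes "finite Z" "0 \<notin> Z"
  shows "\<exists>u. \<forall>z\<in>Z. u \<bullet> z \<noteq> 0"
proof -
  have "negligible (\<Union>z\<in>Z. {u. z \<bullet> u = 0})"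
  proof (rule negligible_Union)
    fix T assume "T \<in> (\<lambda>z. {u. z \<bullet> u = 0}) ` Z"
    then obtain z where "T = {u. z \<bullet> u = 0}" "z \<noteq> 0" using assms(2) by auto
    then show "negligible T" using negligible_hyperplane[of z 0] by simp
  qed (use assms(1) in simp)
  then obtain u where "u \<notin> (\<Union>z\<in>Z. {u. z \<bullet> u = 0})" using non_negligible_UNIV by (metis UNIV_eq_I)
  then show ?thesis by (intro exI[of _ u]) (simp add: inner_commute)
qed

text \<open>The functionals are found one by one. On the span of \<open>n + 1\<close> vectors the
  kernel of the first \<open>n\<close> is at most a line, since it meets the span of any
  \<open>n\<close> of these vectors trivially. The next functional only has to avoid vanishing on
  finitely many lines.\<close>

lemma generic_functionals:
  fixes X :: "'e::euclidean_space set"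
  assumes X: "finite X"
  shows "\<exists>\<phi> :: nat \<Rightarrow> 'e. \<forall>m\<le>n. \<forall>W x. W \<subseteq> X \<longrightarrow> card W \<le> m \<longrightarrow> x \<in> span W \<longrightarrow> (\<forall>r<m. \<phi> r \<bullet> x = 0) \<longrightarrow> x = 0"
proof (induction n)
  case 0
  have "x = 0" if "W \<subseteq> X" "card W = 0" "x \<in> span W" for W and x :: 'e
  proof -
    have "W = {}" using that(1,2) finite_subset[OF that(1) X] by simp
    then show ?thesis using that(3) by simp
  qed
  then show ?case by auto
next
  case (Suc n)
  then obtain \<phi> :: "nat \<Rightarrow> 'e" where \<phi>: "\<And>m W x. m \<le> n \<Longrightarrow> W \<subseteq> X \<Longrightarrow> card W \<le> m \<Longrightarrow> x \<in> span W \<Longrightarrow>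
    \<forall>r<m. \<phi> r \<bullet> x = 0 \<Longrightarrow> x = 0" by blast
  define Q where "Q W z \<longleftrightarrow> z \<in> span W \<and> z \<noteq> 0 \<and> (\<forall>r<n. \<phi> r \<bullet> z = 0)" for W z
  define \<W> where "\<W> = {W. W \<subseteq> X \<and> card W = Suc n \<and> (\<exists>z. Q W z)}"
  have "finite \<W>" by (rule finite_subset[of _ "Pow X"]) (use X in \<open>auto simp: \<W>_def\<close>)
  moreover have Qz: "Q W (SOME z. Q W z)" if "W \<in> \<W>" for W
    using that by (auto simp: \<W>_def intro: someI)
  ultimately obtain u where u: "\<forall>z\<in>(\<lambda>W. SOME z. Q W z) ` \<W>. u \<bullet> z \<noteq> 0"
    using ex_nonorthogonal[of "(\<lambda>W. SOME z. Q W z) ` \<W>"] by (force simp: Q_def)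
  have "x = 0" if m: "m \<le> Suc n" and W: "W \<subseteq> X" "card W \<le> m" and x: "x \<in> span W" "\<forall>r<m. (\<phi>(n := u)) r \<bullet> x = 0" for m W x
  proof (cases "m \<le> n")
    case True
    then show ?thesis using x by (intro \<phi>[OF True W x(1)]) auto
  next
    case False
    then have m: "m = Suc n" using m by simp
    have x0: "\<forall>r<n. \<phi> r \<bullet> x = 0" and ux: "u \<bullet> x = 0" using x(2) m by (auto simp: less_Suc_eq split: if_splits)
    show ?thesis
    proof (cases "card W \<le> n")
      case True
      then show ?thesis using \<phi>[OF order_refl W(1) True x(1) x0] by simp
    next
      case False
      then have cW: "card W = Suc n" using W m by simp
      have fW: "finite W" using finite_subset[OF W(1) X] .
      show ?thesis
      proof (rule ccontr)
        assume "x \<noteq> 0"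
        then have W\<W>: "W \<in> \<W>" using W cW x(1) x0 by (auto simp: \<W>_def Q_def)
        define z where "z = (SOME z. Q W z)"
        have z: "z \<in> span W" "z \<noteq> 0" "\<forall>r<n. \<phi> r \<bullet> z = 0" using Qz[OF W\<W>] by (auto simp: z_def Q_def)
        have uz: "u \<bullet> z \<noteq> 0" using u W\<W> by (auto simp: z_def)
        obtain a where a: "x = (\<Sum>w\<in>W. a w *\<^sub>R w)" using x(1) fW by (auto simp: span_finite)
        obtain b where b: "z = (\<Sum>w\<in>W. b w *\<^sub>R w)" using z(1) fW by (auto simp: span_finite)
        obtain w0 where w0: "w0 \<in> W" "b w0 \<noteq> 0"
        proof (rule ccontr)
          assume "\<not> thesis"
          then have "z = 0" unfolding b using that by (intro sum.neutral) auto
          then show False using z(2) by simp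
        qed
        \<comment> \<open>Chosen so that \<open>w0\<close> drops out of
          \<open>x - s *\<^sub>R z\<close>, which thus falls under the hypothesis for
          \<open>n\<close> vectors.\<close>
        define s where "s = a w0 / b w0"
        have "x - s *\<^sub>R z = (\<Sum>w\<in>W. (a w - s * b w) *\<^sub>R w)"
          unfolding a b by (simp add: scaleR_left_diff_distrib sum_subtractf scaleR_sum_right)
        also have "\<dots> = (\<Sum>w\<in>W - {w0}. (a w - s * b w) *\<^sub>R w)"
          using w0 fW by (simp add: sum.remove s_def)
        also have "\<dots> \<in> span (W - {w0})" by (intro span_sum span_scale span_base)
        finally have "x - s *\<^sub>R z \<in> span (W - {w0})" .
        moreover have "W - {w0} \<subseteq> X" "card (W - {w0}) \<le> n" using W(1) w0 fW cW by auto
        moreover have "\<forall>r<n. \<phi> r \<bullet> (x - s *\<^sub>R z) = 0" using x0 z(3) by (simp add: inner_diff_right)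
        ultimately have "x - s *\<^sub>R z = 0" using \<phi>[OF order_refl] by blast
        then have "x = s *\<^sub>R z" by simp
        then show False using ux uz \<open>x \<noteq> 0\<close> by auto
      qed
    qed
  qed
  then show ?case by (intro exI[of _ "\<phi>(n := u)"]) blast
qed

text \<open>In dimension \<open>d + 1\<close> the common kernel of \<open>d\<close> functionals
  contains a line. Genericity against the vectors \<open>(b, 0)\<close> keeps it from being
  horizontal, so it reaches height one.\<close>

lemma generic_apex:
  fixes \<phi> :: "nat \<Rightarrow> 'b::euclidean_space \<times> real"
  assumes gen: "\<And>x. x \<in> span ((\<lambda>b. (b, 0)) ` Basis) \<Longrightarrow> \<forall>r<DIM('b). \<phi> r \<bullet> x = 0 \<Longrightarrow> x = 0"
  obtains p where "\<forall>r<DIM('b). \<phi> r \<bullet> (p, 1) = 0"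
proof -
  have "card {..<DIM('b)} < card (Basis :: ('b \<times> real) set)" by simp
  then obtain w where w: "\<exists>b\<in>Basis. w b \<noteq> 0"
    "\<forall>r\<in>{..<DIM('b)}. (\<Sum>b\<in>(Basis :: ('b \<times> real) set). w b * (\<phi> r \<bullet> b)) = 0"
    using homogeneous_system_nontrivial[of "{..<DIM('b)}" "Basis :: ('b \<times> real) set" "\<lambda>r b. \<phi> r \<bullet> b"] by auto
  define q where "q = (\<Sum>b\<in>(Basis :: ('b \<times> real) set). w b *\<^sub>R b)"
  have q0: "\<forall>r<DIM('b). \<phi> r \<bullet> q = 0" using w(2) by (simp add: q_def inner_sum_right)
  have "q \<noteq> 0"
  proof
    assume "q = 0"
    then have "w b = 0" if "b \<in> Basis" for b
      using that inner_sum_left_Basis[of b w] by (simp add: q_def)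
    then show False using w(1) by auto
  qed
  have "snd q \<noteq> 0"
  proof
    assume "snd q = 0"
    then have "q = (\<Sum>b\<in>Basis. (fst q \<bullet> b) *\<^sub>R (b, 0))"
      by (simp add: prod_eq_iff fst_sum snd_sum euclidean_representation)
    also have "\<dots> \<in> span ((\<lambda>b. (b, 0)) ` Basis)" by (intro span_sum span_scale span_base) auto
    finally show False using gen q0 \<open>q \<noteq> 0\<close> by blast
  qed
  then have "(fst q /\<^sub>R snd q, 1) = (1 / snd q) *\<^sub>R q" by (simp add: prod_eq_iff divide_inverse)
  then have "\<forall>r<DIM('b). \<phi> r \<bullet> (fst q /\<^sub>R snd q, 1) = 0" using q0 by simp
  then show ?thesis by (rule that)
qed

text \<open>Subdivision as a mod 2 chain map, evaluated on an arbitrary cochain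
  \<open>G\<close>.\<close>

lemma sum_pieces_boundary:
  fixes K :: "'a::real_normed_vector set set" and G :: "'a set \<Rightarrow> bit"
  assumes K: "geometric_complex K" and A: "subdivision A K" and \<alpha>: "\<alpha> \<in> insert {} K"
  shows "(\<Sum>\<sigma>\<in>pieces A \<alpha>. \<Sum>x\<in>\<sigma>. G (\<sigma> - {x})) = (\<Sum>e\<in>\<alpha>. \<Sum>\<rho>\<in>pieces A (\<alpha> - {e}). G \<rho>)"
proof (cases "\<alpha> = {}")
  case True
  have "geometric_complex A" using A by (simp add: subdivision_def)
  then show ?thesis using True by (simp add: pieces_empty)
next
  case False
  then have \<alpha>K: "\<alpha> \<in> K" using \<alpha> by simp
  have gA: "geometric_complex A" using A by (simp add: subdivision_def)
  note AD = geometric_complexD[OF gA]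
  have f\<alpha>: "finite \<alpha>" using geometric_complexD(2)[OF K \<alpha>K] .
  obtain m where m: "card \<alpha> = Suc m" using False f\<alpha> by (metis card_0_eq not0_implies_Suc)
  have finP: "finite (pieces A \<beta>)" for \<beta>
    by (rule finite_subset[of _ "insert {} A"]) (use AD(1) in \<open>auto simp: pieces_def\<close>)
  let ?U = "\<Union>A"
  have fU: "finite ?U" using AD(1,2) by auto
  let ?R = "{\<rho>. \<rho> \<subseteq> ?U \<and> card \<rho> = m}"
  have fR: "finite ?R" by (rule finite_subset[of _ "Pow ?U"]) (use fU in auto)
  have "(\<Sum>\<sigma>\<in>pieces A \<alpha>. \<Sum>x\<in>\<sigma>. G (\<sigma> - {x})) = (\<Sum>\<rho>\<in>?R. of_nat (card {\<sigma>\<in>pieces A \<alpha>. \<rho> \<subseteq> \<sigma>}) * G \<rho>)"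
    using AD m by (intro sum_facets finP fU) (auto simp: pieces_def)
  also have "\<dots> = (\<Sum>\<rho>\<in>?R. of_nat (card {e\<in>\<alpha>. \<rho> \<in> pieces A (\<alpha> - {e})}) * G \<rho>)"
  proof (rule sum.cong[OF refl])
    fix \<rho> assume "\<rho> \<in> ?R"
    then have "card \<alpha> = Suc (card \<rho>)" using m by simp
    then have "of_nat (card {\<sigma>\<in>pieces A \<alpha>. \<rho> \<subseteq> \<sigma>}) = (of_nat (card {e\<in>\<alpha>. \<rho> \<in> pieces A (\<alpha> - {e})}) :: bit)"
      using parity_pieces_boundary[OF K A \<alpha>K] by (simp only: of_nat_bit_eq_iff)
    then show "of_nat (card {\<sigma>\<in>pieces A \<alpha>. \<rho> \<subseteq> \<sigma>}) * G \<rho> = of_nat (card {e\<in>\<alpha>. \<rho> \<in> pieces A (\<alpha> - {e})}) * G \<rho>"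
      by simp
  qed
  also have "\<dots> = (\<Sum>\<rho>\<in>?R. \<Sum>e\<in>\<alpha>. of_bool (\<rho> \<in> pieces A (\<alpha> - {e})) * G \<rho>)"
    by (simp only: sum_of_bool_bit[OF f\<alpha>, symmetric] sum_distrib_right)
  also have "\<dots> = (\<Sum>e\<in>\<alpha>. \<Sum>\<rho>\<in>?R. of_bool (\<rho> \<in> pieces A (\<alpha> - {e})) * G \<rho>)" by (rule sum.swap)
  also have "\<dots> = (\<Sum>e\<in>\<alpha>. \<Sum>\<rho>\<in>pieces A (\<alpha> - {e}). G \<rho>)"
  proof (rule sum.cong[OF refl])
    fix e assume "e \<in> \<alpha>"
    then have "pieces A (\<alpha> - {e}) \<subseteq> ?R" using m f\<alpha> by (auto simp: pieces_def)
    then show "(\<Sum>\<rho>\<in>?R. of_bool (\<rho> \<in> pieces A (\<alpha> - {e})) * G \<rho>) = (\<Sum>\<rho>\<in>pieces A (\<alpha> - {e}). G \<rho>)"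
      using fR by (intro sum.mono_neutral_cong_right) auto
  qed
  finally show ?thesis .
qed

lemma join_subset:
  assumes "U \<subseteq> join \<sigma> \<tau>"
  obtains \<sigma>' \<tau>' where "\<sigma>' \<subseteq> \<sigma>" "\<tau>' \<subseteq> \<tau>" "U = join \<sigma>' \<tau>'"
proof (rule that)
  show "{v. (v, False) \<in> U} \<subseteq> \<sigma>" "{v. (v, True) \<in> U} \<subseteq> \<tau>" using assms by auto
  show "U = join {v. (v, False) \<in> U} {v. (v, True) \<in> U}"
    by (auto simp: join_def image_iff) (metis (full_types))+
qed

section \<open>The cochain on joins of simplices of the subdivision\<close>

context
  fixes f :: "'a::real_normed_vector \<Rightarrow> 'b::euclidean_space" and \<phi> :: "nat \<Rightarrow> 'b \<times> real" and V :: "'b set" and p :: 'b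
  assumes generic: "\<forall>m\<le>DIM('b). \<forall>W x. W \<subseteq> (\<lambda>w. (w, 1)) ` V \<union> (\<lambda>b. (b, 0)) ` Basis \<longrightarrow> card W \<le> m \<longrightarrow>
      x \<in> span W \<longrightarrow> (\<forall>r<m. \<phi> r \<bullet> x = 0) \<longrightarrow> x = 0"
    and apex: "\<forall>r<DIM('b). \<phi> r \<bullet> (p, 1) = 0"
begin

lemma generic_span_eq_0:
  assumes "m \<le> DIM('b)" "W \<subseteq> (\<lambda>w. (w, 1)) ` V \<union> (\<lambda>b. (b, 0)) ` Basis" "card W \<le> m"
    "x \<in> span W" "\<forall>r<m. \<phi> r \<bullet> x = 0"
  shows "x = 0"
  using generic assms by blast

text \<open>The final functional is the height: on the kernel of the others, the line through
  \<open>(p, 1)\<close>, its positivity selects the ray of the apex.\<close>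

definition test_functional :: "nat \<Rightarrow> 'b \<times> real" where
  "test_functional r = (if r < DIM('b) then \<phi> r else (0, 1))"

definition jmat :: "'a \<times> bool \<Rightarrow> nat \<Rightarrow> real" where
  "jmat i r = test_functional r \<bullet> join_vector f f i"

lemma sum_jmat: "(\<Sum>i\<in>U. c i * jmat i r) = test_functional r \<bullet> (\<Sum>i\<in>U. c i *\<^sub>R join_vector f f i)"
  by (simp add: jmat_def inner_sum_right)

lemma rows_separate:
  assumes "\<forall>r<Suc DIM('b). test_functional r \<bullet> x = 0"
  shows "x = 0"
proof -
  have "test_functional DIM('b) \<bullet> x = 0" using assms by blast
  then have s: "snd x = 0" by (simp add: test_functional_def inner_prod_def)
  have "x = (\<Sum>b\<in>Basis. (fst x \<bullet> b) *\<^sub>R (b, 0))"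
    using s by (simp add: prod_eq_iff fst_sum snd_sum euclidean_representation)
  also have "\<dots> \<in> span ((\<lambda>b. (b, 0)) ` Basis)" by (intro span_sum span_scale span_base) auto
  finally have "x \<in> span ((\<lambda>b. (b, 0::real)) ` (Basis :: 'b set))" .
  moreover have "card ((\<lambda>b. (b, 0::real)) ` (Basis :: 'b set)) \<le> DIM('b)" by (rule card_image_le) simp
  moreover have "\<forall>r<DIM('b). \<phi> r \<bullet> x = 0" using assms by (auto simp: test_functional_def less_Suc_eq split: if_splits)
  ultimately show ?thesis by (intro generic_span_eq_0[OF order_refl]) auto
qed

lemma kernel_eq_apex_line:
  assumes "\<forall>r<DIM('b). \<phi> r \<bullet> x = 0"
  shows "x = snd x *\<^sub>R (p, 1)"
proof -
  have "\<forall>r<Suc DIM('b). test_functional r \<bullet> (x - snd x *\<^sub>R (p, 1)) = 0"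
  proof (intro allI impI)
    fix r assume r: "r < Suc DIM('b)"
    show "test_functional r \<bullet> (x - snd x *\<^sub>R (p, 1)) = 0"
    proof (cases "r < DIM('b)")
      case True
      then show ?thesis using assms apex by (simp only: test_functional_def if_True inner_diff_right inner_scaleR_right mult_zero_right diff_0_right)
    next
      case False
      then show ?thesis by (simp add: test_functional_def inner_prod_def)
    qed
  qed
  then have "x - snd x *\<^sub>R (p, 1) = 0" by (rule rows_separate)
  then show ?thesis by simp
qed

text \<open>This apex is dictated by the functionals. In the affine hull of \<open>d\<close> points
  of \<open>V\<close> it would give a nonzero vector \<open>(p, 1)\<close> that genericity
  forbids.\<close>

lemma apex_general_position: "finite V \<Longrightarrow> in_general_position p V"
  unfolding in_general_position_def
proof (intro allI impI notI, elim conjE)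
  fix W assume W: "W \<subseteq> V" "finite W" "card W \<le> DIM('b)" and "p \<in> affine hull W"
  then obtain u where u: "sum u W = 1" "(\<Sum>w\<in>W. u w *\<^sub>R w) = p" by (auto simp: affine_hull_finite)
  then have "(p, 1) = (\<Sum>w\<in>W. u w *\<^sub>R (w, 1::real))" by (simp add: prod_eq_iff fst_sum snd_sum)
  also have "\<dots> \<in> span ((\<lambda>w. (w, 1)) ` W)" by (intro span_sum span_scale span_base) auto
  finally have "(p, 1::real) \<in> span ((\<lambda>w. (w, 1)) ` W)" .
  moreover have "card ((\<lambda>w. (w, 1::real)) ` W) \<le> DIM('b)" using W card_image_le[of W] order_trans by blast
  ultimately have "(p, 1::real) = 0" using W(1) apex by (intro generic_span_eq_0[OF order_refl]) auto
  then show False by (simp add: zero_prod_def)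
qed

text \<open>For \<open>m \<le> d\<close> by genericity, for \<open>m = d + 1\<close> because the
  functionals separate points, a hit would be a true positive dependence and the two images would
  meet. The disjointness assumed here is what an almost embedding supplies.\<close>

lemma not_hit_join:
  assumes st: "finite \<sigma>" "finite \<tau>" "f ` \<sigma> \<union> f ` \<tau> \<subseteq> V" "convex hull (f ` \<sigma>) \<inter> convex hull (f ` \<tau>) = {}"
    and U: "U \<subseteq> join \<sigma> \<tau>" and m: "card U \<le> m \<and> m \<le> DIM('b) \<or> m = Suc DIM('b)"
  shows "\<not> hit jmat m U"
proof
  assume "hit jmat m U"
  then obtain c where c: "\<forall>i\<in>U. 0 \<le> c i" "\<exists>i\<in>U. c i \<noteq> 0" "\<forall>r<m. (\<Sum>i\<in>U. c i * jmat i r) = 0"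
    unfolding hit_def by blast
  let ?x = "\<Sum>i\<in>U. c i *\<^sub>R join_vector f f i"
  have r: "\<forall>r<m. test_functional r \<bullet> ?x = 0" using c(3) unfolding sum_jmat .
  have fU: "finite U" using finite_subset[OF U] st by simp
  have "?x = 0"
  proof (cases "m = Suc DIM('b)")
    case True
    then show ?thesis using r rows_separate by blast
  next
    case False
    then have m': "card U \<le> m" "m \<le> DIM('b)" using m by auto
    let ?W = "(\<lambda>w. (w, 1::real)) ` vertex_image f f ` U"
    have "?x \<in> span (join_vector f f ` U)" by (intro span_sum span_scale span_base) auto
    then have 1: "?x \<in> span ?W" using subsetD[OF span_join_vector[of f f U]] by simp
    have "vertex_image f f ` U \<subseteq> vertex_image f f ` join \<sigma> \<tau>" using U by (rule image_mono)
    also have "\<dots> \<subseteq> V" using st(3) by (auto simp: vertex_image_def join_def)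
    finally have 2: "?W \<subseteq> (\<lambda>w. (w, 1)) ` V \<union> (\<lambda>b. (b, 0)) ` Basis" by auto
    have 3: "card ?W \<le> m"
      using card_image_le[OF fU, of "vertex_image f f"]
        card_image_le[OF finite_imageI[OF fU, of "vertex_image f f"], of "\<lambda>w. (w, 1::real)"] m'(1) by linarith
    have "\<forall>r<m. \<phi> r \<bullet> ?x = 0"
    proof (intro allI impI)
      fix r' assume "r' < m"
      then show "\<phi> r' \<bullet> ?x = 0" using r[rule_format, of r'] m'(2) by (simp add: test_functional_def)
    qed
    then show ?thesis by (rule generic_span_eq_0[OF m'(2) 2 3 1])
  qed
  then have "positively_dependent (join_vector f f) U" unfolding positively_dependent_def using c by blast
  moreover obtain \<sigma>' \<tau>' where s': "\<sigma>' \<subseteq> \<sigma>" "\<tau>' \<subseteq> \<tau>" "U = join \<sigma>' \<tau>'" using join_subset[OF U] .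
  have "convex hull (f ` \<sigma>') \<subseteq> convex hull (f ` \<sigma>)" "convex hull (f ` \<tau>') \<subseteq> convex hull (f ` \<tau>)"
    using s' by (auto intro!: hull_mono)
  then have "\<not> positively_dependent (join_vector f f) (join \<sigma>' \<tau>')"
    using st s' finite_subset[OF s'(1)] finite_subset[OF s'(2)] by (intro positively_dependent_join) auto
  ultimately show False using s'(3) by simp
qed

text \<open>The cochains \<open>c\<^sub>i\<close> together, the index being one less than the number of vertices. The value 1 on the
  empty join makes the relation \<open>\<delta> c\<^bsub>i-1\<^esub> = c\<^sub>i + T c\<^sub>i\<close> hold for vertices as well.\<close>

definition join_cochain :: "('a \<times> bool) set \<Rightarrow> bit" where
  "join_cochain U = (if U = {} then 1 else of_bool (poshit jmat (card U - 1) U))"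

text \<open>For at least two vertices this is the parity of positive endpoints. A single vertex has
  the empty facet, of value 1, and \<open>hit\<close> without rows always holds.\<close>

lemma sum_join_cochain_facets:
  assumes st: "finite \<sigma>" "finite \<tau>" "f ` \<sigma> \<union> f ` \<tau> \<subseteq> V" "convex hull (f ` \<sigma>) \<inter> convex hull (f ` \<tau>) = {}"
    and n: "card (join \<sigma> \<tau>) = Suc n" "n \<le> Suc DIM('b)"
  shows "(\<Sum>i\<in>join \<sigma> \<tau>. join_cochain (join \<sigma> \<tau> - {i})) = of_bool (hit jmat n (join \<sigma> \<tau>))"
proof (cases n)
  case 0
  then obtain x where x: "join \<sigma> \<tau> = {x}" using n(1) by (auto simp: card_Suc_eq)
  have "hit jmat 0 {x}" unfolding hit_def by (intro exI[of _ "\<lambda>_. 1"]) auto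
  then show ?thesis using 0 unfolding x by (simp add: join_cochain_def)
next
  case (Suc n')
  let ?U = "join \<sigma> \<tau>"
  have fU: "finite ?U" using st by simp
  have cU: "card ?U = n' + 2" using n Suc by simp
  have "join_cochain (?U - {i}) = of_bool (poshit jmat n' (?U - {i}))" if "i \<in> ?U" for i
  proof -
    have c: "card (?U - {i}) = Suc n'" using that fU cU by simp
    then have "?U - {i} \<noteq> {}" by (metis card.empty nat.simps(3))
    then show ?thesis unfolding join_cochain_def c by simp
  qed
  then have "(\<Sum>i\<in>?U. join_cochain (?U - {i})) = (\<Sum>i\<in>?U. of_bool (poshit jmat n' (?U - {i})))"
    by (intro sum.cong) auto
  also have "\<dots> = of_nat (card {i\<in>?U. poshit jmat n' (?U - {i})})" by (rule sum_of_bool_bit[OF fU])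
  also have "\<dots> = of_bool (hit jmat (Suc n') ?U)"
    unfolding of_nat_bit
  proof (rule arg_cong[where f=of_bool], rule parity_poshit_facets[OF fU cU])
    fix x assume x: "x \<in> ?U"
    then have "card (?U - {x}) = Suc n'" using fU cU by simp
    then show "\<not> hit jmat (Suc n') (?U - {x})"
      using n Suc by (intro not_hit_join[OF st]) auto
    fix y assume y: "y \<in> ?U" "x \<noteq> y"
    then have "card (?U - {x, y}) = n'" using fU cU x by (simp add: card_Diff_subset)
    then show "\<not> hit jmat n' (?U - {x, y})"
      using n Suc by (intro not_hit_join[OF st]) auto
  qed
  finally show ?thesis using Suc by simp
qed

text \<open>Exchanging the factors negates every join vector.\<close>

lemma poshit_join_swap:
  assumes "finite \<sigma>" "finite \<tau>"
  shows "poshit jmat n (join \<tau> \<sigma>) \<longleftrightarrow> poshit (\<lambda>i r. - jmat i r) n (join \<sigma> \<tau>)"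
proof -
  have neg: "jmat (v, \<not> b) r = - jmat (v, b) r" for v b r
    by (cases b) (simp_all add: jmat_def join_vector_def inner_prod_def)
  have sw: "(\<Sum>i\<in>join \<tau> \<sigma>. c i * jmat i r) = (\<Sum>i\<in>join \<sigma> \<tau>. c (fst i, \<not> snd i) * - jmat i r)" for c r
    using assms neg[of _ True] neg[of _ False] by (simp add: sum_join add.commute)
  have sw': "(\<Sum>i\<in>join \<sigma> \<tau>. c i * - jmat i r) = (\<Sum>i\<in>join \<tau> \<sigma>. c (fst i, \<not> snd i) * jmat i r)" for c r
    unfolding sw by (simp add: sum_join assms)
  show ?thesis
  proof
    assume "poshit jmat n (join \<tau> \<sigma>)"
    then obtain c where c: "\<forall>i\<in>join \<tau> \<sigma>. 0 \<le> c i" "\<forall>r<n. (\<Sum>i\<in>join \<tau> \<sigma>. c i * jmat i r) = 0"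
      "(\<Sum>i\<in>join \<tau> \<sigma>. c i * jmat i n) > 0" unfolding poshit_def by blast
    then show "poshit (\<lambda>i r. - jmat i r) n (join \<sigma> \<tau>)" unfolding poshit_def sw
      by (intro exI[of _ "\<lambda>i. c (fst i, \<not> snd i)"]) (auto simp: Ball_join)
  next
    assume "poshit (\<lambda>i r. - jmat i r) n (join \<sigma> \<tau>)"
    then obtain c where c: "\<forall>i\<in>join \<sigma> \<tau>. 0 \<le> c i" "\<forall>r<n. (\<Sum>i\<in>join \<sigma> \<tau>. c i * - jmat i r) = 0"
      "(\<Sum>i\<in>join \<sigma> \<tau>. c i * - jmat i n) > 0" unfolding poshit_def by blast
    then show "poshit jmat n (join \<tau> \<sigma>)" unfolding poshit_def sw'
      by (intro exI[of _ "\<lambda>i. c (fst i, \<not> snd i)"]) (auto simp: Ball_join)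
  qed
qed

lemma join_cochain_symmetrized:
  assumes st: "finite \<sigma>" "finite \<tau>" "f ` \<sigma> \<union> f ` \<tau> \<subseteq> V" "convex hull (f ` \<sigma>) \<inter> convex hull (f ` \<tau>) = {}"
    and n: "card (join \<sigma> \<tau>) = Suc n" "n \<le> DIM('b)"
  shows "join_cochain (join \<sigma> \<tau>) + join_cochain (join \<tau> \<sigma>) = of_bool (hit jmat n (join \<sigma> \<tau>))"
proof -
  have c': "card (join \<tau> \<sigma>) = Suc n" using n st by (simp add: card_join add.commute)
  have ne: "join \<sigma> \<tau> \<noteq> {}" "join \<tau> \<sigma> \<noteq> {}" using n(1) c' by (metis card.empty nat.simps(3))+
  have "\<not> hit jmat (Suc n) (join \<sigma> \<tau>)" using n by (intro not_hit_join[OF st]) auto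
  then have "hit jmat n (join \<sigma> \<tau>) \<longleftrightarrow> poshit jmat n (join \<sigma> \<tau>) \<noteq> poshit jmat n (join \<tau> \<sigma>)"
    unfolding poshit_join_swap[OF st(1,2)] by (rule hit_iff_poshit_neq)
  moreover have "of_bool a + of_bool b = (of_bool (a \<noteq> b) :: bit)" for a b by (cases a; cases b) simp_all
  ultimately show ?thesis unfolding join_cochain_def n(1) c' using ne by simp
qed

lemma join_cochain_top:
  assumes st: "finite \<sigma>" "finite \<tau>" "f ` \<sigma> \<union> f ` \<tau> \<subseteq> V" and n: "card (join \<sigma> \<tau>) = Suc DIM('b)"
  shows "join_cochain (join \<sigma> \<tau>) = of_bool (in_cone (p, 1) (join_vector f f) (join \<sigma> \<tau>))"
proof -
  let ?U = "join \<sigma> \<tau>"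
  have ne: "?U \<noteq> {}" using n by (metis card.empty nat.simps(3))
  have last: "test_functional DIM('b) \<bullet> x = snd x" for x by (simp add: test_functional_def inner_prod_def)
  have first: "(\<forall>r<DIM('b). test_functional r \<bullet> x = 0) \<longleftrightarrow> (\<forall>r<DIM('b). \<phi> r \<bullet> x = 0)" for x by (simp add: test_functional_def)
  have "poshit jmat DIM('b) ?U \<longleftrightarrow> in_cone (p, 1) (join_vector f f) ?U"
  proof
    assume "poshit jmat DIM('b) ?U"
    then obtain c where c: "\<forall>i\<in>?U. 0 \<le> c i" "\<forall>r<DIM('b). \<phi> r \<bullet> (\<Sum>i\<in>?U. c i *\<^sub>R join_vector f f i) = 0"
      "snd (\<Sum>i\<in>?U. c i *\<^sub>R join_vector f f i) > 0"
      unfolding poshit_def sum_jmat last first by blast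
    let ?x = "\<Sum>i\<in>?U. c i *\<^sub>R join_vector f f i"
    define s where "s = snd ?x"
    have x: "?x = s *\<^sub>R (p, 1)" unfolding s_def by (rule kernel_eq_apex_line[OF c(2)])
    have s: "s > 0" using c(3) by (simp only: s_def)
    have "(\<Sum>i\<in>?U. (c i / s) *\<^sub>R join_vector f f i) = (1 / s) *\<^sub>R ?x" by (simp add: scaleR_sum_right)
    also have "\<dots> = (p, 1)" unfolding x using s by simp
    finally show "in_cone (p, 1) (join_vector f f) ?U"
      unfolding in_cone_def using c(1) s by (intro exI[of _ "\<lambda>i. c i / s"]) simp
  next
    assume "in_cone (p, 1) (join_vector f f) ?U"
    then obtain c where c: "\<forall>i\<in>?U. 0 \<le> c i" "(\<Sum>i\<in>?U. c i *\<^sub>R join_vector f f i) = (p, 1)"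
      unfolding in_cone_def by blast
    then show "poshit jmat DIM('b) ?U"
      unfolding poshit_def sum_jmat last first using apex by (intro exI[of _ c]) simp
  qed
  then show ?thesis unfolding join_cochain_def n using ne by simp
qed

section \<open>The cochain on cells of the complex\<close>

context
  fixes K A :: "'a set set"
  assumes K: "geometric_complex K" and A: "subdivision A K" "linear_on_simplices A f" and V: "V = f ` \<Union>A"
begin

text \<open>As \<open>f\<close> is linear only on simplices of \<open>A\<close>, a cell of the
  deleted join receives the sum over the joins of pieces that subdivide it.\<close>

definition cell_cochain :: "'a set \<Rightarrow> 'a set \<Rightarrow> bit" where
  "cell_cochain \<alpha> \<beta> = (\<Sum>\<sigma>\<in>pieces A \<alpha>. \<Sum>\<tau>\<in>pieces A \<beta>. join_cochain (join \<sigma> \<tau>))"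

lemma geometric_complex_A: "geometric_complex A" using A by (simp add: subdivision_def)

lemma pieces_props:
  assumes "\<sigma> \<in> pieces A \<alpha>"
  shows "finite \<sigma>" "f ` \<sigma> \<subseteq> V" "convex hull (f ` \<sigma>) \<subseteq> f ` (convex hull \<alpha>)" "card \<sigma> = card \<alpha>"
proof -
  have \<sigma>: "\<sigma> = {} \<or> \<sigma> \<in> A" "\<sigma> \<subseteq> convex hull \<alpha>" "card \<sigma> = card \<alpha>" using assms by (auto simp: pieces_def)
  show "finite \<sigma>" using \<sigma>(1) geometric_complexD(2)[OF geometric_complex_A] by auto
  show "f ` \<sigma> \<subseteq> V" using \<sigma>(1) unfolding V by auto
  show "card \<sigma> = card \<alpha>" by fact
  show "convex hull (f ` \<sigma>) \<subseteq> f ` (convex hull \<alpha>)"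
  proof (cases "\<sigma> = {}")
    case False
    then have "\<sigma> \<in> A" using \<sigma> by auto
    then have "convex hull (f ` \<sigma>) = f ` (convex hull \<sigma>)"
      using image_convex_hull_linear[OF A(2)] geometric_complexD(2)[OF geometric_complex_A] by simp
    also have "\<dots> \<subseteq> f ` (convex hull \<alpha>)" using \<sigma>(2) by (intro image_mono hull_minimal convex_convex_hull)
    finally show ?thesis .
  qed simp
qed

lemma cell_cochain_empty: "cell_cochain {} {} = 1"
  by (simp add: cell_cochain_def pieces_empty[OF geometric_complex_A] join_cochain_def join_def)

text \<open>Subdivision is a chain map in each factor separately.\<close>

lemma cell_coboundary:
  assumes "\<alpha> \<in> insert {} K" "\<beta> \<in> insert {} K"
  shows "(\<Sum>e\<in>\<alpha>. cell_cochain (\<alpha> - {e}) \<beta>) + (\<Sum>e\<in>\<beta>. cell_cochain \<alpha> (\<beta> - {e})) =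
    (\<Sum>\<sigma>\<in>pieces A \<alpha>. \<Sum>\<tau>\<in>pieces A \<beta>. \<Sum>i\<in>join \<sigma> \<tau>. join_cochain (join \<sigma> \<tau> - {i}))"
proof -
  have "(\<Sum>\<sigma>\<in>pieces A \<alpha>. \<Sum>\<tau>\<in>pieces A \<beta>. \<Sum>i\<in>join \<sigma> \<tau>. join_cochain (join \<sigma> \<tau> - {i})) =
    (\<Sum>\<sigma>\<in>pieces A \<alpha>. \<Sum>\<tau>\<in>pieces A \<beta>. (\<Sum>x\<in>\<sigma>. join_cochain (join (\<sigma> - {x}) \<tau>)) +
      (\<Sum>y\<in>\<tau>. join_cochain (join \<sigma> (\<tau> - {y}))))"
    by (intro sum.cong refl) (simp only: sum_join pieces_props(1) join_minus)
  also have "\<dots> = (\<Sum>\<tau>\<in>pieces A \<beta>. \<Sum>\<sigma>\<in>pieces A \<alpha>. \<Sum>x\<in>\<sigma>. join_cochain (join (\<sigma> - {x}) \<tau>)) +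
      (\<Sum>\<sigma>\<in>pieces A \<alpha>. \<Sum>\<tau>\<in>pieces A \<beta>. \<Sum>y\<in>\<tau>. join_cochain (join \<sigma> (\<tau> - {y})))"
    by (simp only: sum.distrib) (subst sum.swap, rule refl)
  also have "(\<Sum>\<tau>\<in>pieces A \<beta>. \<Sum>\<sigma>\<in>pieces A \<alpha>. \<Sum>x\<in>\<sigma>. join_cochain (join (\<sigma> - {x}) \<tau>)) =
      (\<Sum>\<tau>\<in>pieces A \<beta>. \<Sum>e\<in>\<alpha>. \<Sum>\<rho>\<in>pieces A (\<alpha> - {e}). join_cochain (join \<rho> \<tau>))"
    using sum_pieces_boundary[OF K A(1) assms(1), of "\<lambda>\<sigma>. join_cochain (join \<sigma> \<tau>)" for \<tau>] by simp
  also have "\<dots> = (\<Sum>e\<in>\<alpha>. cell_cochain (\<alpha> - {e}) \<beta>)"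
    unfolding cell_cochain_def by (subst sum.swap) (intro sum.cong refl sum.swap)
  also have "(\<Sum>\<sigma>\<in>pieces A \<alpha>. \<Sum>\<tau>\<in>pieces A \<beta>. \<Sum>y\<in>\<tau>. join_cochain (join \<sigma> (\<tau> - {y}))) =
      (\<Sum>\<sigma>\<in>pieces A \<alpha>. \<Sum>e\<in>\<beta>. \<Sum>\<rho>\<in>pieces A (\<beta> - {e}). join_cochain (join \<sigma> \<rho>))"
    using sum_pieces_boundary[OF K A(1) assms(2), of "\<lambda>\<tau>. join_cochain (join \<sigma> \<tau>)" for \<sigma>] by simp
  also have "\<dots> = (\<Sum>e\<in>\<beta>. cell_cochain \<alpha> (\<beta> - {e}))"
    unfolding cell_cochain_def by (rule sum.swap)
  finally show ?thesis by simp
qed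

text \<open>For each pair of pieces, both the symmetrized cochain and the sum over facets equal the
  indicator of a hit.\<close>

lemma cell_cochain_symmetrized:
  assumes ab: "\<alpha> \<in> insert {} K" "\<beta> \<in> insert {} K" and disj: "f ` (convex hull \<alpha>) \<inter> f ` (convex hull \<beta>) = {}"
    and card: "1 \<le> card \<alpha> + card \<beta>" "card \<alpha> + card \<beta> \<le> Suc DIM('b)"
  shows "cell_cochain \<alpha> \<beta> + cell_cochain \<beta> \<alpha> =
    (\<Sum>e\<in>\<alpha>. cell_cochain (\<alpha> - {e}) \<beta>) + (\<Sum>e\<in>\<beta>. cell_cochain \<alpha> (\<beta> - {e}))"
proof -
  have "cell_cochain \<alpha> \<beta> + cell_cochain \<beta> \<alpha> =
      (\<Sum>\<sigma>\<in>pieces A \<alpha>. \<Sum>\<tau>\<in>pieces A \<beta>. join_cochain (join \<sigma> \<tau>) + join_cochain (join \<tau> \<sigma>))"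
    unfolding cell_cochain_def by (subst (2) sum.swap) (simp only: sum.distrib)
  also have "\<dots> = (\<Sum>\<sigma>\<in>pieces A \<alpha>. \<Sum>\<tau>\<in>pieces A \<beta>. \<Sum>i\<in>join \<sigma> \<tau>. join_cochain (join \<sigma> \<tau> - {i}))"
  proof (intro sum.cong refl)
    fix \<sigma> \<tau> assume \<sigma>\<tau>: "\<sigma> \<in> pieces A \<alpha>" "\<tau> \<in> pieces A \<beta>"
    note s = pieces_props[OF \<sigma>\<tau>(1)] and t = pieces_props[OF \<sigma>\<tau>(2)]
    obtain n where n: "card (join \<sigma> \<tau>) = Suc n" "n \<le> DIM('b)"
    proof (rule that)
      show "card (join \<sigma> \<tau>) = Suc (card (join \<sigma> \<tau>) - 1)" "card (join \<sigma> \<tau>) - 1 \<le> DIM('b)"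
        using card s(4) t(4) card_join[OF s(1) t(1)] by simp_all
    qed
    have d: "f ` \<sigma> \<union> f ` \<tau> \<subseteq> V" "convex hull (f ` \<sigma>) \<inter> convex hull (f ` \<tau>) = {}"
      using s t disj by blast+
    show "join_cochain (join \<sigma> \<tau>) + join_cochain (join \<tau> \<sigma>) = (\<Sum>i\<in>join \<sigma> \<tau>. join_cochain (join \<sigma> \<tau> - {i}))"
      using join_cochain_symmetrized[OF s(1) t(1) d n] sum_join_cochain_facets[OF s(1) t(1) d n(1)] n(2) by simp
  qed
  finally show ?thesis unfolding cell_coboundary[OF ab] .
qed

text \<open>With \<open>d + 2\<close> vertices the facet sums indicate a hit by all
  \<open>d + 1\<close> functionals, which disjoint images rule out.\<close>

lemma cell_coboundary_top:
  assumes ab: "\<alpha> \<in> insert {} K" "\<beta> \<in> insert {} K" and disj: "f ` (convex hull \<alpha>) \<inter> f ` (convex hull \<beta>) = {}"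
    and card: "card \<alpha> + card \<beta> = Suc (Suc DIM('b))"
  shows "(\<Sum>e\<in>\<alpha>. cell_cochain (\<alpha> - {e}) \<beta>) + (\<Sum>e\<in>\<beta>. cell_cochain \<alpha> (\<beta> - {e})) = 0"
  unfolding cell_coboundary[OF ab]
proof (rule sum.neutral, rule ballI, rule sum.neutral, rule ballI)
  fix \<sigma> \<tau> assume \<sigma>\<tau>: "\<sigma> \<in> pieces A \<alpha>" "\<tau> \<in> pieces A \<beta>"
  note s = pieces_props[OF \<sigma>\<tau>(1)] and t = pieces_props[OF \<sigma>\<tau>(2)]
  have n: "card (join \<sigma> \<tau>) = Suc (Suc DIM('b))" using card s t card_join[OF s(1) t(1)] by simp
  have d: "f ` \<sigma> \<union> f ` \<tau> \<subseteq> V" "convex hull (f ` \<sigma>) \<inter> convex hull (f ` \<tau>) = {}"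
    using s t disj by blast+
  have "\<not> hit jmat (Suc DIM('b)) (join \<sigma> \<tau>)" by (rule not_hit_join[OF s(1) t(1) d order_refl]) simp
  then show "(\<Sum>i\<in>join \<sigma> \<tau>. join_cochain (join \<sigma> \<tau> - {i})) = 0"
    using sum_join_cochain_facets[OF s(1) t(1) d n] by simp
qed

lemma subdivision_restrict:
  assumes L: "L \<subseteq> K" "geometric_complex L"
  shows "subdivision {\<sigma>\<in>A. \<exists>\<tau>\<in>L. \<sigma> \<subseteq> convex hull \<tau>} L"
proof -
  let ?A = "{\<sigma>\<in>A. \<exists>\<tau>\<in>L. \<sigma> \<subseteq> convex hull \<tau>}"
  note AD = geometric_complexD[OF geometric_complex_A]
  have sub: "convex hull \<sigma> \<subseteq> convex hull \<tau>" if "\<sigma> \<subseteq> convex hull \<tau>" for \<sigma> \<tau> :: "'a set"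
    using that by (intro hull_minimal convex_convex_hull)
  have "geometric_complex ?A" unfolding geometric_complex_def
  proof (intro conjI ballI allI impI)
    show "finite ?A" using AD(1) by simp
    fix \<sigma> assume \<sigma>: "\<sigma> \<in> ?A"
    then show "finite \<sigma>" "\<sigma> \<noteq> {}" "\<not> affine_dependent \<sigma>" using AD by auto
    show "\<tau> \<in> ?A" if "\<tau> \<subseteq> \<sigma> \<and> \<tau> \<noteq> {}" for \<tau> using \<sigma> that AD(5)[of \<sigma> \<tau>] by blast
    show "convex hull \<sigma> \<inter> convex hull \<tau> = convex hull (\<sigma> \<inter> \<tau>)" if "\<tau> \<in> ?A" for \<tau>
      using \<sigma> that by (intro AD(6)) auto
  qed
  moreover have "body ?A = body L"
  proof
    show "body ?A \<subseteq> body L" using sub unfolding body_def by blast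
    show "body L \<subseteq> body ?A"
    proof
      fix x assume "x \<in> body L"
      then obtain \<tau> where \<tau>: "\<tau> \<in> L" "x \<in> convex hull \<tau>" by (auto simp: body_def)
      obtain \<rho> where \<rho>: "\<rho> \<in> A" "\<rho> \<subseteq> convex hull \<tau>" "x \<in> open_simplex \<rho>"
        using subdivision_carrier[OF K A(1) _ \<tau>(2)] L(1) \<tau>(1) by blast
      then have "x \<in> convex hull \<rho>" using open_simplex_subset[OF AD(2)] by blast
      then show "x \<in> body ?A" using \<rho> \<tau> unfolding body_def by blast
    qed
  qed
  ultimately show ?thesis unfolding subdivision_def using sub by blast
qed

text \<open>Linking does not depend on apex and triangulations, so it may be computed with the
  restrictions of \<open>A\<close> and the special apex \<open>p\<close>, for which crossings are
  values of the top cochain.\<close>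

lemma linked_mod2_boundaries:
  fixes X Y :: "'a set"
  assumes X: "finite X" "\<not> affine_dependent X" "card X = k + 2" "geometric_complex (simplex_boundary X)" "simplex_boundary X \<subseteq> K"
    and Y: "finite Y" "\<not> affine_dependent Y" "card Y = l + 2" "geometric_complex (simplex_boundary Y)" "simplex_boundary Y \<subseteq> K"
    and dim: "DIM('b) = k + l + 1" and disj: "f ` body (simplex_boundary X) \<inter> f ` body (simplex_boundary Y) = {}"
  shows "of_bool (linked_mod2 (simplex_boundary X) f (simplex_boundary Y) f) =
    (\<Sum>e\<in>X. \<Sum>e'\<in>Y. cell_cochain (X - {e}) (Y - {e'}))"
proof -
  define AX where "AX = {\<sigma>\<in>A. \<exists>\<tau>\<in>simplex_boundary X. \<sigma> \<subseteq> convex hull \<tau>}"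
  define AY where "AY = {\<sigma>\<in>A. \<exists>\<tau>\<in>simplex_boundary Y. \<sigma> \<subseteq> convex hull \<tau>}"
  have sX: "subdivision AX (simplex_boundary X)" "linear_on_simplices AX f"
    and sY: "subdivision AY (simplex_boundary Y)" "linear_on_simplices AY f"
    using subdivision_restrict[OF X(5,4)] subdivision_restrict[OF Y(5,4)] A(2)
    by (auto simp: AX_def AY_def linear_on_simplices_def)
  have finA: "finite AX" "finite AY" using geometric_complexD(1)[OF geometric_complex_A] by (auto simp: AX_def AY_def)
  have finV: "finite V" unfolding V using geometric_complexD(1,2)[OF geometric_complex_A] by auto
  have p: "in_general_position p (f ` \<Union>AX \<union> f ` \<Union>AY)"
    by (rule in_general_position_mono[OF apex_general_position[OF finV]]) (auto simp: V AX_def AY_def)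
  have cards: "\<forall>\<sigma>\<in>simplex_boundary Z. card \<sigma> \<le> Suc m" if "finite Z" "card Z = m + 2" for Z :: "'a set" and m
  proof
    fix \<sigma> assume "\<sigma> \<in> simplex_boundary Z"
    then have "card \<sigma> < card Z" using that(1) by (intro psubset_card_mono) (auto simp: simplex_boundary_def)
    then show "card \<sigma> \<le> Suc m" using that(2) by simp
  qed
  note cX = cards[OF X(1,3)] and cY = cards[OF Y(1,3)]
  let ?TX = "{\<sigma>\<in>AX. card \<sigma> = Suc k}" and ?TY = "{\<tau>\<in>AY. card \<tau> = Suc l}"
  have "linked_mod2 (simplex_boundary X) f (simplex_boundary Y) f \<longleftrightarrow> odd (card (crossings p f ?TX f ?TY))"
    by (rule linked_mod2_iff[OF X(4) cX Y(4) cY sX sY dim disj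
          simplex_boundary_cycle[OF X(1-4)] simplex_boundary_cycle[OF Y(1-4)] p])
  then have "of_bool (linked_mod2 (simplex_boundary X) f (simplex_boundary Y) f) =
      (of_nat (card (crossings p f ?TX f ?TY)) :: bit)" by (simp only: of_nat_bit)
  also have "\<dots> = (\<Sum>\<sigma>\<in>?TX. \<Sum>\<tau>\<in>?TY. of_bool (in_cone (p, 1) (join_vector f f) (join \<sigma> \<tau>)))"
    using finA by (intro of_nat_card_crossings) auto
  also have "\<dots> = (\<Sum>\<sigma>\<in>?TX. \<Sum>\<tau>\<in>?TY. join_cochain (join \<sigma> \<tau>))"
  proof (intro sum.cong refl)
    fix \<sigma> \<tau> assume \<sigma>\<tau>: "\<sigma> \<in> ?TX" "\<tau> \<in> ?TY"
    then have A': "\<sigma> \<in> A" "\<tau> \<in> A" "card \<sigma> = Suc k" "card \<tau> = Suc l" by (auto simp: AX_def AY_def)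
    then have fin: "finite \<sigma>" "finite \<tau>" using geometric_complexD(2)[OF geometric_complex_A] by auto
    show "of_bool (in_cone (p, 1) (join_vector f f) (join \<sigma> \<tau>)) = join_cochain (join \<sigma> \<tau>)"
      using A' fin dim by (intro join_cochain_top[symmetric]) (auto simp: V card_join)
  qed
  also have "\<dots> = (\<Sum>e\<in>X. \<Sum>\<sigma>\<in>pieces AX (X - {e}). \<Sum>e'\<in>Y. \<Sum>\<tau>\<in>pieces AY (Y - {e'}). join_cochain (join \<sigma> \<tau>))"
    unfolding sum_top_simplices[OF X(1-4) sX(1)] sum_top_simplices[OF Y(1-4) sY(1)] ..
  also have "\<dots> = (\<Sum>e\<in>X. \<Sum>e'\<in>Y. \<Sum>\<sigma>\<in>pieces AX (X - {e}). \<Sum>\<tau>\<in>pieces AY (Y - {e'}). join_cochain (join \<sigma> \<tau>))"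
    by (intro sum.cong refl sum.swap)
  also have "\<dots> = (\<Sum>e\<in>X. \<Sum>e'\<in>Y. cell_cochain (X - {e}) (Y - {e'}))"
  proof (intro sum.cong refl)
    fix e e' assume e: "e \<in> X" "e' \<in> Y"
    have "X - {e} \<in> simplex_boundary X" by (rule facet_in_simplex_boundary[OF X(1-4) sX(1) e(1)])
    then have "pieces AX (X - {e}) = pieces A (X - {e})" unfolding pieces_def AX_def by blast
    moreover have "Y - {e'} \<in> simplex_boundary Y" by (rule facet_in_simplex_boundary[OF Y(1-4) sY(1) e(2)])
    then have "pieces AY (Y - {e'}) = pieces A (Y - {e'})" unfolding pieces_def AY_def by blast
    ultimately show "(\<Sum>\<sigma>\<in>pieces AX (X - {e}). \<Sum>\<tau>\<in>pieces AY (Y - {e'}). join_cochain (join \<sigma> \<tau>)) =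
        cell_cochain (X - {e}) (Y - {e'})" unfolding cell_cochain_def by simp
  qed
  finally show ?thesis .
qed

end

end

section \<open>Counting linked pairs\<close>

lemma sum_vert_image: "(\<Sum>e\<in>vert ` s. h e) = (\<Sum>i\<in>s. h (vert i))"
  by (simp add: sum.reindex inj_vert)

lemma vert_image_Diff: "vert ` s - {vert i} = vert ` (s - {i})"
  using image_set_diff[of vert s "{i}"] inj_vert[of UNIV] by simp

text \<open>The facets of \<open>{0} \<union> j\<^sup>c\<close> containing the vertex 0 occur in pairs and cancel, so the linking numbers
  sum up to the crossings of disjoint faces of the simplex \<open>[k+l+3]\<close>.\<close>

lemma sum_linking_pairs:
  fixes C :: "nat set \<Rightarrow> nat set \<Rightarrow> bit"
  shows "(\<Sum>j\<in>{j. j \<subseteq> {1..k + l + 3} \<and> card j = k + 2}.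
      \<Sum>a\<in>j. \<Sum>b\<in>insert 0 ({1..k + l + 3} - j). C (j - {a}) (insert 0 ({1..k + l + 3} - j) - {b})) =
    (\<Sum>(\<alpha>, \<beta>)\<in>disjoint_pairs {1..k + l + 3} (k + 1) (l + 1). C \<alpha> \<beta>)"
proof -
  let ?N = "{1..k + l + 3}"
  have finN: "finite ?N" by simp
  have "(\<Sum>j\<in>{j. j \<subseteq> ?N \<and> card j = k + 2}. \<Sum>a\<in>j. \<Sum>b\<in>insert 0 (?N - j). C (j - {a}) (insert 0 (?N - j) - {b})) =
    (\<Sum>(\<alpha>, \<beta>)\<in>disjoint_pairs ?N (k + 2) (l + 1). \<Sum>a\<in>\<alpha>. \<Sum>b\<in>insert 0 \<beta>. C (\<alpha> - {a}) (insert 0 \<beta> - {b}))"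
  proof (rule sum.reindex_bij_witness[of _ fst "\<lambda>j. (j, ?N - j)"])
    fix j assume j: "j \<in> {j. j \<subseteq> ?N \<and> card j = k + 2}"
    then have "card (?N - j) = l + 1" using card_Diff_subset[OF finite_subset[OF _ finN], of j] by simp
    then show "(j, ?N - j) \<in> disjoint_pairs ?N (k + 2) (l + 1)" using j by (auto simp: disjoint_pairs_def)
  next
    fix p assume p: "p \<in> disjoint_pairs ?N (k + 2) (l + 1)"
    then obtain \<alpha> \<beta> where ab: "p = (\<alpha>, \<beta>)" "\<alpha> \<subseteq> ?N" "\<beta> \<subseteq> ?N" "\<alpha> \<inter> \<beta> = {}" "card \<alpha> = k + 2" "card \<beta> = l + 1"
      by (auto simp: disjoint_pairs_def)
    have fab: "finite \<alpha>" "finite \<beta>" using ab finite_subset[OF _ finN] by auto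
    then have "card (?N - \<alpha>) = l + 1" using ab by (simp add: card_Diff_subset)
    then have "\<beta> = ?N - \<alpha>" using ab by (intro card_subset_eq) auto
    then show "(fst p, ?N - fst p) = p" using ab by simp
    show "fst p \<in> {j. j \<subseteq> ?N \<and> card j = k + 2}" using ab by simp
  qed auto
  also have "\<dots> = (\<Sum>(\<alpha>, \<beta>)\<in>disjoint_pairs ?N (k + 2) (l + 1).
      (\<Sum>a\<in>\<alpha>. C (\<alpha> - {a}) \<beta>) + (\<Sum>a\<in>\<alpha>. \<Sum>b\<in>\<beta>. C (\<alpha> - {a}) (insert 0 (\<beta> - {b}))))"
  proof (intro sum.cong refl, clarify)
    fix \<alpha> \<beta> assume "(\<alpha>, \<beta>) \<in> disjoint_pairs ?N (k + 2) (l + 1)"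
    then have b: "\<beta> \<subseteq> ?N" by (auto simp: disjoint_pairs_def)
    then have fb: "finite \<beta>" "0 \<notin> \<beta>" using finite_subset[OF b finN] by auto
    have "(\<Sum>b\<in>insert 0 \<beta>. C (\<alpha> - {a}) (insert 0 \<beta> - {b})) =
        C (\<alpha> - {a}) \<beta> + (\<Sum>b\<in>\<beta>. C (\<alpha> - {a}) (insert 0 (\<beta> - {b})))" for a
    proof -
      have "(\<Sum>b\<in>\<beta>. C (\<alpha> - {a}) (insert 0 \<beta> - {b})) = (\<Sum>b\<in>\<beta>. C (\<alpha> - {a}) (insert 0 (\<beta> - {b})))"
        using fb(2) by (intro sum.cong refl arg_cong2[where f=C]) auto
      moreover have "insert 0 \<beta> - {0} = \<beta>" using fb(2) by auto
      ultimately show ?thesis using fb by simp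
    qed
    then show "(\<Sum>a\<in>\<alpha>. \<Sum>b\<in>insert 0 \<beta>. C (\<alpha> - {a}) (insert 0 \<beta> - {b})) =
        (\<Sum>a\<in>\<alpha>. C (\<alpha> - {a}) \<beta>) + (\<Sum>a\<in>\<alpha>. \<Sum>b\<in>\<beta>. C (\<alpha> - {a}) (insert 0 (\<beta> - {b})))"
      by (simp only: sum.distrib)
  qed
  also have "\<dots> = (\<Sum>(\<alpha>, \<beta>)\<in>disjoint_pairs ?N (k + 2) (l + 1). \<Sum>a\<in>\<alpha>. C (\<alpha> - {a}) \<beta>) +
      (\<Sum>(\<alpha>, \<beta>)\<in>disjoint_pairs ?N (k + 2) (l + 1). \<Sum>a\<in>\<alpha>. \<Sum>b\<in>\<beta>. C (\<alpha> - {a}) (insert 0 (\<beta> - {b})))"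
    by (simp only: split_def sum.distrib)
  also have "(\<Sum>(\<alpha>, \<beta>)\<in>disjoint_pairs ?N (k + 2) (l + 1). \<Sum>a\<in>\<alpha>. C (\<alpha> - {a}) \<beta>) =
      (\<Sum>(\<alpha>, \<beta>)\<in>disjoint_pairs ?N (k + 1) (l + 1). C \<alpha> \<beta>)"
  proof -
    have "int (card ?N) - int (k + 2) - int (l + 1) + 1 = 1" "int (k + 2) - 1 = int (k + 1)" by simp_all
    then show ?thesis by (simp only: sum_disjoint_pairs_remove_fst[OF finN] of_int_1 mult_1_left)
  qed
  also have "(\<Sum>(\<alpha>, \<beta>)\<in>disjoint_pairs ?N (k + 2) (l + 1). \<Sum>a\<in>\<alpha>. \<Sum>b\<in>\<beta>. C (\<alpha> - {a}) (insert 0 (\<beta> - {b}))) = 0"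
  proof -
    \<comment> \<open>The vertex \<open>a\<close> can be restored in one way, \<open>b\<close>
      afterwards in two, so every face through 0 occurs an even number of times.\<close>
    have 1: "int (card ?N) - int (k + 2) - int (l + 1) + 1 = 1" "int (k + 2) - 1 = int (k + 1)" by simp_all
    have 2: "int (card ?N) - int (k + 1) - int (l + 1) + 1 = 2" by simp
    have "(\<Sum>(\<alpha>, \<beta>)\<in>disjoint_pairs ?N (k + 2) (l + 1). \<Sum>a\<in>\<alpha>. \<Sum>b\<in>\<beta>. C (\<alpha> - {a}) (insert 0 (\<beta> - {b}))) =
        (\<Sum>(\<alpha>, \<beta>)\<in>disjoint_pairs ?N (k + 1) (l + 1). \<Sum>b\<in>\<beta>. C \<alpha> (insert 0 (\<beta> - {b})))"
      using sum_disjoint_pairs_remove_fst[OF finN, of "\<lambda>\<alpha> \<beta>. \<Sum>b\<in>\<beta>. C \<alpha> (insert 0 (\<beta> - {b}))" "k + 2" "l + 1"]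
      unfolding 1 by simp
    also have "\<dots> = 0"
      using sum_disjoint_pairs_remove_snd[OF finN, of "\<lambda>\<alpha> \<beta>. C \<alpha> (insert 0 \<beta>)" "k + 1" "l + 1"]
      unfolding 2 by simp
    finally show ?thesis .
  qed
  finally show ?thesis by simp
qed

lemma odd_linked_pairs:
  fixes f :: "real_inf \<Rightarrow> real ^ 'n"
  assumes lk: "l \<le> k" and dim: "CARD('n::finite) = k + l + 1"
    and PL: "PL_map (linking_complex k l) f" and almost: "almost_embedding (linking_complex k l) f"
  shows "odd (card {j. j \<subseteq> {1..k + l + 3} \<and> card j = k + 2 \<and>
    linked_mod2 (simplex_boundary (vert ` j)) f (simplex_boundary (vert ` insert 0 ({1..k + l + 3} - j))) f})"
proof -
  let ?F = "linking_complex k l" and ?N = "{1..k + l + 3}"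
  have dimE: "DIM(real ^ 'n) = k + l + 1" using dim by simp
  have gF: "geometric_complex ?F" using k_complex_linking_complex[OF lk] by (simp add: k_complex_def)
  obtain A where A: "subdivision A ?F" "linear_on_simplices A f" using PL by (auto simp: PL_map_def)
  have geometric_complex_A: "geometric_complex A" using A by (simp add: subdivision_def)
  define V where "V = f ` \<Union>A"
  have finV: "finite V" unfolding V_def using geometric_complexD(1,2)[OF geometric_complex_A] by auto
  \<comment> \<open>Besides the lifted images of vertices, \<open>?X\<close> contains a horizontal
    basis, which both the existence of the apex and the separation of points by the functionals rely
    on.\<close>
  let ?X = "(\<lambda>w. (w, 1::real)) ` V \<union> (\<lambda>b. (b, 0)) ` (Basis :: (real ^ 'n) set)"
  have "finite ?X" using finV by simp
  then obtain \<phi> :: "nat \<Rightarrow> (real ^ 'n) \<times> real" where \<phi>: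
    "\<forall>m\<le>DIM(real ^ 'n). \<forall>W x. W \<subseteq> ?X \<longrightarrow> card W \<le> m \<longrightarrow> x \<in> span W \<longrightarrow> (\<forall>r<m. \<phi> r \<bullet> x = 0) \<longrightarrow> x = 0"
    using generic_functionals[of ?X "DIM(real ^ 'n)"] by blast
  have "x = 0" if "x \<in> span ((\<lambda>b. (b, 0)) ` Basis)" "\<forall>r<DIM(real ^ 'n). \<phi> r \<bullet> x = 0" for x
  proof (rule \<phi>[rule_format, OF order_refl _ _ that(1)])
    show "\<phi> r \<bullet> x = 0" if "r < DIM(real ^ 'n)" for r using \<open>\<forall>r<DIM(real ^ 'n). \<phi> r \<bullet> x = 0\<close> that by blast
    show "card ((\<lambda>b. (b, 0::real)) ` (Basis :: (real ^ 'n) set)) \<le> DIM(real ^ 'n)" by (rule card_image_le) simp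
  qed auto
  then obtain p where p: "\<forall>r<DIM(real ^ 'n). \<phi> r \<bullet> (p, 1) = 0" using generic_apex[of \<phi>] by blast
  define cell where "cell = cell_cochain f \<phi> A"
  define C where "C \<alpha> \<beta> = cell (vert ` \<alpha>) (vert ` \<beta>)" for \<alpha> \<beta>
  note symm = cell_cochain_symmetrized[OF \<phi> p gF A V_def, folded cell_def]
  note top = cell_coboundary_top[OF \<phi> p gF A V_def, folded cell_def]
  note linked = linked_mod2_boundaries[OF \<phi> p gF A V_def, folded cell_def]
  have in_F: "vert ` \<alpha> \<in> insert {} ?F" if "\<alpha> \<subseteq> ?N" "card \<alpha> \<le> k + 1" for \<alpha>
    using that by (auto simp: linking_complex_def linking_family_def)
  have disj: "f ` (convex hull (vert ` \<alpha>)) \<inter> f ` (convex hull (vert ` \<beta>)) = {}"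
    if "vert ` \<alpha> \<in> insert {} ?F" "vert ` \<beta> \<in> insert {} ?F" "finite \<alpha>" "finite \<beta>" "\<alpha> \<inter> \<beta> = {}" for \<alpha> \<beta>
  proof (cases "\<alpha> = {} \<or> \<beta> = {}")
    case True
    then show ?thesis by auto
  next
    case False
    have "convex hull (vert ` \<alpha>) \<inter> convex hull (vert ` \<beta>) = {}"
      using that(5) by (simp add: convex_hull_vert_Int[OF that(3,4)])
    moreover have "vert ` \<alpha> \<in> ?F" "vert ` \<beta> \<in> ?F" using that(1,2) False by auto
    ultimately show ?thesis using almost unfolding almost_embedding_def by blast
  qed
  have cob: "(\<Sum>e\<in>vert ` \<alpha>. cell (vert ` \<alpha> - {e}) (vert ` \<beta>)) + (\<Sum>e\<in>vert ` \<beta>. cell (vert ` \<alpha>) (vert ` \<beta> - {e})) =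
      pair_coboundary C \<alpha> \<beta>" for \<alpha> \<beta>
    unfolding pair_coboundary_def C_def sum_vert_image vert_image_Diff ..
  have fin: "finite \<alpha>" if "\<alpha> \<subseteq> ?N" for \<alpha> by (rule finite_subset[OF that]) simp
  have total: "(\<Sum>(\<alpha>, \<beta>)\<in>disjoint_pairs ?N (k + 1) (l + 1). C \<alpha> \<beta>) = 1"
  proof -
    have "(\<Sum>(\<alpha>, \<beta>)\<in>disjoint_pairs ?N (int (k + 1)) (int (l + 1)). C \<alpha> \<beta>) = 1"
    \<comment> \<open>A top cell has \<open>d + 1 = k + l + 2\<close> vertices, one less than the
      whole vertex set.\<close>
    proof (rule sum_top_eq_1[where n = "k + l + 2"])
      show "C {} {} = 1"
        unfolding C_def cell_def using cell_cochain_empty[OF \<phi> p gF A V_def] by simp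
      fix \<alpha> \<beta> assume ab: "\<alpha> \<subseteq> ?N" "\<beta> \<subseteq> ?N" "\<alpha> \<inter> \<beta> = {}" "card \<alpha> \<le> k + 1" "card \<beta> \<le> k + 1"
      have F: "vert ` \<alpha> \<in> insert {} ?F" "vert ` \<beta> \<in> insert {} ?F" using in_F ab by blast+
      note d = disj[OF F fin[OF ab(1)] fin[OF ab(2)] ab(3)]
      show "C \<alpha> \<beta> + C \<beta> \<alpha> = pair_coboundary C \<alpha> \<beta>" if "1 \<le> card \<alpha> + card \<beta>" "card \<alpha> + card \<beta> \<le> k + l + 2"
        using symm[OF F d] that dimE unfolding cob by (simp add: C_def)
      show "pair_coboundary C \<alpha> \<beta> = 0" if "card \<alpha> + card \<beta> = k + l + 2 + 1"
        using top[OF F d] that dimE unfolding cob by simp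
    qed (use lk in auto)
    then show ?thesis by simp
  qed
  have link: "of_bool (linked_mod2 (simplex_boundary (vert ` j)) f (simplex_boundary (vert ` insert 0 (?N - j))) f) =
      (\<Sum>a\<in>j. \<Sum>b\<in>insert 0 (?N - j). C (j - {a}) (insert 0 (?N - j) - {b}))"
    if j: "j \<subseteq> ?N" "card j = k + 2" for j
  proof -
    let ?j' = "insert 0 (?N - j)"
    have fj: "finite j" "finite ?j'" using fin[OF j(1)] by auto
    have cj': "card ?j' = l + 2" using j fj by (simp add: card_Diff_subset)
    have jj: "j \<inter> ?j' = {}" using j(1) by auto
    note S = linking_complex_spheres[OF lk j]
    have "f ` body (simplex_boundary (vert ` j)) \<inter> f ` body (simplex_boundary (vert ` ?j')) = {}"
    proof -
      have "f ` (convex hull (vert ` s)) \<inter> f ` (convex hull (vert ` t)) = {}"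
        if st: "s \<subset> j" "s \<noteq> {}" "t \<subset> ?j'" "t \<noteq> {}" for s t
      proof (rule disj)
        show "vert ` s \<in> insert {} ?F" using S(1) st unfolding simplex_boundary_vert by auto
        show "vert ` t \<in> insert {} ?F" using S(2) st unfolding simplex_boundary_vert by auto
        show "finite s" "finite t" using st fj finite_subset by (metis psubset_imp_subset)+
        show "s \<inter> t = {}" using st jj by blast
      qed
      then show ?thesis unfolding body_def simplex_boundary_vert by blast
    qed
    then have "of_bool (linked_mod2 (simplex_boundary (vert ` j)) f (simplex_boundary (vert ` ?j')) f) =
        (\<Sum>e\<in>vert ` j. \<Sum>e'\<in>vert ` ?j'. cell (vert ` j - {e}) (vert ` ?j' - {e'}))"
      using linked[where k = k and l = l, of "vert ` j" "vert ` ?j'"] fj j(2) cj' dimE S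
        affine_independent_vert[OF fj(1)] affine_independent_vert[OF fj(2)]
        geometric_complex_boundary_vert[OF fj(1)] geometric_complex_boundary_vert[OF fj(2)]
      by (simp only: card_vert_image finite_imageI not_False_eq_True simp_thms)
    then show ?thesis unfolding sum_vert_image vert_image_Diff C_def .
  qed
  let ?J = "{j. j \<subseteq> ?N \<and> card j = k + 2}"
  let ?L = "\<lambda>j. linked_mod2 (simplex_boundary (vert ` j)) f (simplex_boundary (vert ` insert 0 (?N - j))) f"
  have finJ: "finite ?J" by (rule finite_subset[of _ "Pow ?N"]) auto
  have "(of_nat (card {j\<in>?J. ?L j}) :: bit) = (\<Sum>j\<in>?J. of_bool (?L j))"
    by (rule sum_of_bool_bit[OF finJ, symmetric])
  also have "\<dots> = (\<Sum>j\<in>?J. \<Sum>a\<in>j. \<Sum>b\<in>insert 0 (?N - j). C (j - {a}) (insert 0 (?N - j) - {b}))"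
    using link by (intro sum.cong refl) blast
  also have "\<dots> = 1" unfolding sum_linking_pairs by (rule total)
  finally have "odd (card {j\<in>?J. ?L j})" by (simp add: of_nat_bit split: if_splits)
  then show ?thesis by (simp only: mem_Collect_eq conj_assoc not_False_eq_True)
qed

theorem theorem1p7:
  fixes k l :: nat
  assumes "l \<le> k" and "CARD('n::finite) = k + l + 1"
  shows "\<exists>(F :: real_inf set set) (Sk :: nat set \<Rightarrow> real_inf set set)
            (Sl :: nat set \<Rightarrow> real_inf set set).
     k_complex k F \<and>
     (\<forall>j. j \<subseteq> {1..k + l + 3} \<and> card j = k + 2 \<longrightarrow>
        subcomplex (Sk j) F \<and> subcomplex (Sl j) F \<and>
        body (Sk j) \<inter> body (Sl j) = {} \<and>
        sphere_complex k (Sk j) \<and> sphere_complex l (Sl j)) \<and>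
     (\<exists>g :: real_inf \<Rightarrow> real ^ 'n. PL_embedding F g) \<and>
     (\<forall>f :: real_inf \<Rightarrow> real ^ 'n. PL_map F f \<and> almost_embedding F f \<longrightarrow>
        odd (card {j. j \<subseteq> {1..k + l + 3} \<and> card j = k + 2 \<and>
                      linked_mod2 (Sk j) f (Sl j) f}))"
proof (rule exI[of _ "linking_complex k l"], rule exI[of _ "\<lambda>j. simplex_boundary (vert ` j)"],
    rule exI[of _ "\<lambda>j. simplex_boundary (vert ` insert 0 ({1..k + l + 3} - j))"],
    intro conjI allI impI; (elim conjE)?)
  show "k_complex k (linking_complex k l)" by (rule k_complex_linking_complex[OF assms(1)])
  show "\<exists>g :: real_inf \<Rightarrow> real ^ 'n. PL_embedding (linking_complex k l) g"
    by (rule linking_complex_embeds[OF assms])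
  show "odd (card {j. j \<subseteq> {1..k + l + 3} \<and> card j = k + 2 \<and>
      linked_mod2 (simplex_boundary (vert ` j)) f (simplex_boundary (vert ` insert 0 ({1..k + l + 3} - j))) f})"
    if "PL_map (linking_complex k l) f" "almost_embedding (linking_complex k l) f" for f :: "real_inf \<Rightarrow> real ^ 'n"
    by (rule odd_linked_pairs[OF assms that])
  fix j assume j: "j \<subseteq> {1..k + l + 3}" "card j = k + 2"
  let ?j' = "insert 0 ({1..k + l + 3} - j)"
  have fj: "finite j" by (rule finite_subset[OF j(1)]) simp
  then have fj': "finite ?j'" by simp
  have cj': "card ?j' = l + 2" using j fj by (simp add: card_Diff_subset)
  note S = linking_complex_spheres[OF assms(1) j]
  show "subcomplex (simplex_boundary (vert ` j)) (linking_complex k l)"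
    using S(1) geometric_complex_boundary_vert[OF fj] by (simp add: subcomplex_def)
  show "subcomplex (simplex_boundary (vert ` ?j')) (linking_complex k l)"
    using S(2) geometric_complex_boundary_vert[OF fj'] by (simp add: subcomplex_def)
  show "body (simplex_boundary (vert ` j)) \<inter> body (simplex_boundary (vert ` ?j')) = {}"
    by (rule body_boundary_vert_disjoint[OF fj fj']) (use j(1) in auto)
  show "sphere_complex k (simplex_boundary (vert ` j))"
    by (rule sphere_complex_boundary_vert[OF fj j(2)])
  show "sphere_complex l (simplex_boundary (vert ` ?j'))"
    by (rule sphere_complex_boundary_vert[OF fj' cj'])
qed

end
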